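(* The mixed integer trust region problem (MITR) $$\min\ x^{\mathsf T} H x + h^{\mathsf T} x \quad \text{s.t.}\quad x^{\mathsf T} x \le 1,\quad x \in \Pi_p(b^1,\dots,b^n) + \{c\},$$ where $H \in \mathbb{Q}^{n\times n}$ is symmetric, $h, c \in \mathbb{Q}^n$, $b^1,\dots,b^n \in \mathbb{Q}^n$ are linearly independent, and $p \in \{0,1,\dots,n\}$, is strongly NP-hard, and it is NP-hard to find an $\epsilon$-approximate solution to it with $\epsilon < 1/17$, even if $p = n$ and the problem is feasible.
   Context: For linearly independent $b^1,\dots,b^n$ and $p \in \{0,\dots,n\}$, the mixed integer lattice is $$\Pi_p(b^1,\dots,b^n) := \Big\{\sum_{i=1}^n \mu_i b^i : \mu_i \in \mathbb{Z}\ \forall i=1,\dots,p,\ \mu_i \in \mathbb{R}\ \forall i=p+1,\dots,n\Big\}.$$ For an optimization problem $\inf\{f(x) : x \in \mathcal{S}\}$, let $f_{\inf}$ and $f_{\sup}$ denote the infimum and supremum of $f$ on $\mathcal{S}$. For $\epsilon \in [0,1]$, a point $x^\diamond \in \mathcal{S}$ is an $\epsilon$-approximate solution if $f(x^\diamond) - f_{\inf} \le \epsilon \cdot (f_{\sup} - f_{\inf})$. *)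

theory Defs
  imports "HOL-Computational_Algebra.Polynomial" "Jordan_Normal_Form.VS_Connect"
begin

section \<open>Turing machines\<close>

text \<open>Deterministic multi-tape Turing machines, optionally with an oracle. Tapes are infinite in both
  directions; symbol 0 is the blank, the symbols 1 and 2 are the bits False and True.
  A tape is given by its contents and its head position. A transition maps the current state and
  the list of scanned symbols to the next state and, for each tape, a symbol to write and a head
  movement.\<close>

type_synonym tape = "(int \<Rightarrow> nat) \<times> int"
type_synonym config = "nat \<times> tape list"

record tm =
  tapes :: nat
  symbols :: nat
  states :: nat
  delta :: "nat \<Rightarrow> nat list \<Rightarrow> nat \<times> (nat \<times> int) list"

abbreviation (input) start_state :: nat where "start_state \<equiv> 0"
abbreviation (input) halt_state :: nat where "halt_state \<equiv> 1"
abbreviation (input) query_state :: nat where "query_state \<equiv> 2"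
abbreviation (input) answer_state :: nat where "answer_state \<equiv> 3"

text \<open>The last conjunct restricts \<^const>\<open>delta\<close> only on its finite domain of legal arguments; its values
  elsewhere are never used.\<close>

definition wf_tm :: "tm \<Rightarrow> bool" where
  "wf_tm M \<longleftrightarrow> 2 \<le> tapes M \<and> 3 \<le> symbols M \<and> 4 \<le> states M \<and>
     (\<forall>q ss. q < states M \<longrightarrow> length ss = tapes M \<longrightarrow> set ss \<subseteq> {..<symbols M} \<longrightarrow>
        (case delta M q ss of (q', as) \<Rightarrow>
           q' < states M \<and> length as = tapes M \<and>
           (\<forall>(s, d) \<in> set as. s < symbols M \<and> d \<in> {-1, 0, 1})))"

definition string_cells :: "bool list \<Rightarrow> int \<Rightarrow> nat" where
  "string_cells w i =
     (if 0 \<le> i \<and> i < int (length w) then (if w ! nat i then 2 else 1) else 0)"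

definition tape_of :: "bool list \<Rightarrow> tape" where
  "tape_of w = (string_cells w, 0)"

text \<open>The bit string on a tape: the cells from 0 onwards, up to the first one that is not a bit.\<close>

definition tape_string :: "tape \<Rightarrow> bool list" where
  "tape_string t =
     map (\<lambda>j. fst t (int j) = 2) [0..<(LEAST j. fst t (int j) \<notin> {1, 2})]"

definition scan :: "tape \<Rightarrow> nat" where
  "scan t = fst t (snd t)"

definition act :: "nat \<times> int \<Rightarrow> tape \<Rightarrow> tape" where
  "act a t = ((fst t)(snd t := fst a), snd t + snd a)"

text \<open>With an oracle, the machine in the query state replaces, in one step, the string on tape 1 by the
  oracle's answer to it. Without an oracle, the query state is an ordinary state.\<close>

definition step :: "(bool list \<Rightarrow> bool list) option \<Rightarrow> tm \<Rightarrow> config \<Rightarrow> config" where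
  "step orc M cfg = (case cfg of (q, ts) \<Rightarrow>
     if q = halt_state then (q, ts)
     else if q = query_state \<and> orc \<noteq> None
       then (answer_state, ts[1 := tape_of (the orc (tape_string (ts ! 1)))])
     else (case delta M q (map scan ts) of (q', as) \<Rightarrow> (q', map2 act as ts)))"

definition init_config :: "tm \<Rightarrow> bool list \<Rightarrow> config" where
  "init_config M w = (start_state, tape_of w # replicate (tapes M - 1) (tape_of []))"

text \<open>On input \<open>w\<close>, the machine halts after at most \<open>T\<close> steps with output \<open>y\<close> on tape 0.\<close>

definition outputs_within ::
  "(bool list \<Rightarrow> bool list) option \<Rightarrow> tm \<Rightarrow> bool list \<Rightarrow> nat \<Rightarrow> bool list \<Rightarrow> bool" where
  "outputs_within orc M w T y \<longleftrightarrow>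
     (\<exists>t \<le> T. \<exists>ts. (step orc M ^^ t) (init_config M w) = (halt_state, ts) \<and>
        tape_string (ts ! 0) = y)"

section \<open>NP-hardness\<close>

definition polytime :: "(bool list \<Rightarrow> bool list) \<Rightarrow> bool" where
  "polytime f \<longleftrightarrow> (\<exists>M (P :: nat poly). wf_tm M \<and>
     (\<forall>w. outputs_within None M w (poly P (length w)) (f w)))"

text \<open>A self-delimiting code: \<open>frame u @ v\<close> determines both \<open>u\<close> and \<open>v\<close>.\<close>

definition frame :: "bool list \<Rightarrow> bool list" where
  "frame bs = concat (map (\<lambda>b. [True, b]) bs) @ [False]"

definition in_P :: "bool list set \<Rightarrow> bool" where
  "in_P L \<longleftrightarrow> polytime (\<lambda>w. [w \<in> L])"

definition in_NP :: "bool list set \<Rightarrow> bool" where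
  "in_NP L \<longleftrightarrow> (\<exists>V (P :: nat poly). in_P V \<and>
     (\<forall>w. w \<in> L \<longleftrightarrow> (\<exists>u. length u \<le> poly P (length w) \<and> frame w @ u \<in> V)))"

text \<open>A decision problem is given by its set \<open>D\<close> of instances, their encoding, and the yes-instances \<open>Q\<close>.
  Hardness is with respect to many-one reductions that only produce instances from \<open>D\<close>; so if \<open>D\<close> is
  a subset of the instances of some problem, this is hardness of the problem even on \<open>D\<close>.\<close>

definition NP_hard :: "('i \<Rightarrow> bool list) \<Rightarrow> 'i set \<Rightarrow> ('i \<Rightarrow> bool) \<Rightarrow> bool" where
  "NP_hard enc D Q \<longleftrightarrow> (\<forall>L. in_NP L \<longrightarrow>
     (\<exists>f. polytime f \<and> (\<forall>w. \<exists>I \<in> D. f w = enc I \<and> (w \<in> L \<longleftrightarrow> Q I))))"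

definition rat_magnitude :: "rat \<Rightarrow> nat" where
  "rat_magnitude r = (case quotient_of r of (a, b) \<Rightarrow> max (nat \<bar>a\<bar>) (nat b))"

text \<open>Strong NP-hardness (Garey and Johnson): for some polynomial, the problem remains NP-hard on the
  instances all of whose numbers have numerator and denominator bounded by that polynomial in the
  encoding length. Here \<open>nums I\<close> lists the numbers occurring in \<open>I\<close>.\<close>

definition strongly_NP_hard ::
  "('i \<Rightarrow> bool list) \<Rightarrow> ('i \<Rightarrow> rat list) \<Rightarrow> 'i set \<Rightarrow> ('i \<Rightarrow> bool) \<Rightarrow> bool" where
  "strongly_NP_hard enc nums D Q \<longleftrightarrow> (\<exists>P :: nat poly.
     NP_hard enc {I \<in> D. \<forall>r \<in> set (nums I). rat_magnitude r \<le> poly P (length (enc I))} Q)"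

text \<open>A search problem is a relation between encoded instances and encoded solutions. A function solves it
  if it maps every instance that has a solution to some solution; it is unconstrained on all
  other strings. NP-hardness of a search problem is with respect to polynomial-time Turing reductions,
  the oracle being an arbitrary function that solves the problem.\<close>

definition solves :: "(bool list \<Rightarrow> bool list) \<Rightarrow> (bool list \<Rightarrow> bool list \<Rightarrow> bool) \<Rightarrow> bool" where
  "solves F R \<longleftrightarrow> (\<forall>u. (\<exists>y. R u y) \<longrightarrow> R u (F u))"

definition NP_hard_search :: "(bool list \<Rightarrow> bool list \<Rightarrow> bool) \<Rightarrow> bool" where
  "NP_hard_search R \<longleftrightarrow> (\<forall>L. in_NP L \<longrightarrow>
     (\<exists>M (P :: nat poly). wf_tm M \<and>
        (\<forall>F. solves F R \<longrightarrow>
           (\<forall>w. outputs_within (Some F) M w (poly P (length w)) [w \<in> L]))))"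

section \<open>Binary encodings\<close>

text \<open>Binary digits, least significant first.\<close>

fun bits_of_nat :: "nat \<Rightarrow> bool list" where
  "bits_of_nat n = (if n = 0 then [] else odd n # bits_of_nat (n div 2))"

declare bits_of_nat.simps [simp del]

definition enc_nat :: "nat \<Rightarrow> bool list" where
  "enc_nat n = frame (bits_of_nat n)"

definition enc_int :: "int \<Rightarrow> bool list" where
  "enc_int z = frame ((z < 0) # bits_of_nat (nat \<bar>z\<bar>))"

definition enc_rat :: "rat \<Rightarrow> bool list" where
  "enc_rat r = (case quotient_of r of (a, b) \<Rightarrow> enc_int a @ enc_nat (nat b))"

definition enc_vec :: "rat vec \<Rightarrow> bool list" where
  "enc_vec v = concat (map enc_rat (list_of_vec v))"

section \<open>Approximate solutions\<close>

text \<open>\<open>Inf\<close> and \<open>Sup\<close> on the reals are meaningful here only if \<open>f\<close> is bounded on \<open>S\<close>.\<close>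

definition approx_solution :: "('a \<Rightarrow> real) \<Rightarrow> 'a set \<Rightarrow> real \<Rightarrow> 'a \<Rightarrow> bool" where
  "approx_solution f S \<epsilon> x \<longleftrightarrow> x \<in> S \<and>
     f x - (INF y\<in>S. f y) \<le> \<epsilon> * ((SUP y\<in>S. f y) - (INF y\<in>S. f y))"

section \<open>The mixed integer trust region problem\<close>

definition mixed_lattice :: "nat \<Rightarrow> nat \<Rightarrow> real vec list \<Rightarrow> real vec set" where
  "mixed_lattice n p bs =
     {vec n (\<lambda>j. \<Sum>i<n. \<mu> i * bs ! i $ j) | \<mu> :: nat \<Rightarrow> real. \<forall>i<p. \<mu> i \<in> \<int>}"

record mitr =
  n_of :: nat
  p_of :: nat
  H_of :: "rat mat"
  h_of :: "rat vec"
  c_of :: "rat vec"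
  basis_of :: "rat vec list"

abbreviation real_vec :: "rat vec \<Rightarrow> real vec" where
  "real_vec \<equiv> map_vec real_of_rat"

abbreviation real_mat :: "rat mat \<Rightarrow> real mat" where
  "real_mat \<equiv> map_mat real_of_rat"

text \<open>Linear independence in the library is a property of sets, hence the additional \<^const>\<open>distinct\<close>.\<close>

definition lin_indpt_vecs :: "nat \<Rightarrow> real vec list \<Rightarrow> bool" where
  "lin_indpt_vecs n bs \<longleftrightarrow> distinct bs \<and>
     \<not> module.lin_dep class_ring (module_vec TYPE(real) n) (set bs)"

definition MITR :: "mitr set" where
  "MITR = {I. 1 \<le> n_of I \<and> p_of I \<le> n_of I \<and>
     H_of I \<in> carrier_mat (n_of I) (n_of I) \<and> transpose_mat (H_of I) = H_of I \<and>
     h_of I \<in> carrier_vec (n_of I) \<and> c_of I \<in> carrier_vec (n_of I) \<and>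
     length (basis_of I) = n_of I \<and> set (basis_of I) \<subseteq> carrier_vec (n_of I) \<and>
     lin_indpt_vecs (n_of I) (map real_vec (basis_of I))}"

definition mitr_objective :: "mitr \<Rightarrow> real vec \<Rightarrow> real" where
  "mitr_objective I x = x \<bullet> (real_mat (H_of I) *\<^sub>v x) + real_vec (h_of I) \<bullet> x"

definition mitr_feasible :: "mitr \<Rightarrow> real vec set" where
  "mitr_feasible I = {x \<in> carrier_vec (n_of I). x \<bullet> x \<le> 1 \<and>
     x \<in> {y + real_vec (c_of I) | y.
            y \<in> mixed_lattice (n_of I) (p_of I) (map real_vec (basis_of I))}}"

definition MITR_pure_feasible :: "mitr set" where
  "MITR_pure_feasible = {I \<in> MITR. p_of I = n_of I \<and> mitr_feasible I \<noteq> {}}"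

definition mitr_nums :: "mitr \<Rightarrow> rat list" where
  "mitr_nums I = concat (map list_of_vec (rows (H_of I))) @ list_of_vec (h_of I) @
     list_of_vec (c_of I) @ concat (map list_of_vec (basis_of I))"

definition enc_mitr :: "mitr \<Rightarrow> bool list" where
  "enc_mitr I = enc_nat (n_of I) @ enc_nat (p_of I) @ concat (map enc_rat (mitr_nums I))"

text \<open>The decision version of the minimization problem: an instance together with a rational
  threshold \<open>\<gamma>\<close>, asking for a feasible point of objective value at most \<open>\<gamma>\<close>.\<close>

definition strongly_NP_hard_MITR :: "mitr set \<Rightarrow> bool" where
  "strongly_NP_hard_MITR D \<longleftrightarrow>
     strongly_NP_hard
       (\<lambda>(I, \<gamma>). enc_mitr I @ enc_rat \<gamma>)
       (\<lambda>(I, \<gamma>). mitr_nums I @ [\<gamma>])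
       (D \<times> UNIV)
       (\<lambda>(I, \<gamma>). \<exists>x \<in> mitr_feasible I. mitr_objective I x \<le> real_of_rat \<gamma>)"

text \<open>Solutions are output as rational vectors. For \<open>p = n\<close> all feasible points are
  rational; for \<open>p < n\<close> and \<open>\<epsilon> = 0\<close> an instance may have no rational solution, and then nothing is
  required of an algorithm on it.\<close>

definition mitr_approx_search :: "mitr set \<Rightarrow> real \<Rightarrow> bool list \<Rightarrow> bool list \<Rightarrow> bool" where
  "mitr_approx_search D \<epsilon> u y \<longleftrightarrow> (\<exists>I \<in> D. \<exists>x.
     u = enc_mitr I \<and> y = enc_vec x \<and>
     approx_solution (mitr_objective I) (mitr_feasible I) \<epsilon> (real_vec x))"

end

theory Submission
  imports Defs
begin

text \<open>The hardness lies in the feasible region; the objective is linear and takes only two values. The verifier of a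
  language in NP is turned into a tiling problem whose number of tiles does not depend on the input, and this into
  linear equations with small coefficients in 0/1 variables. These equations are made homogeneous by a further 0/1
  variable \<open>t\<close>, so that \<open>x = 0\<close>, \<open>t = 0\<close> is always a solution whereas a solution with \<open>t = 1\<close> is a tiling.
  For integers \<open>x\<^sub>1, \<dots>, x\<^sub>n\<close>, the inequality \<open>\<Sum>\<^sub>i (x\<^sub>i - 1/2)\<^sup>2 + |A x|\<^sup>2 \<le> n/4\<close> holds if and only if all \<open>x\<^sub>i\<close>
  are 0 or 1 and \<open>A x = 0\<close>, and if \<open>n/4\<close> is a square it can be scaled rationally to the unit ball. Minimizing
  \<open>- t\<close> over the resulting lattice points decides the language, and since there are only two values, so does every
  \<open>\<epsilon>\<close>-approximate solution, even for all \<open>\<epsilon> < 1\<close>.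

  The reduction is computed by a program of a small imperative language on tapes, which is compiled to a Turing
  machine.\<close>

text \<open>The basis must consist of \<open>n\<close> independent vectors in dimension
  \<open>n\<close>, so the residuals \<open>A x\<close> cannot just be appended as further
  coordinates of a degenerate lattice. Each residual coordinate gets an integer variable of its own,
  scaled by a modulus that no residual of a 0/1 point reaches; the basis is then triangular, and a
  coordinate of this kind vanishes only if its residual does. Homogenization provides a known
  feasible point but also admits partial assignments. These are excluded because the grid is glued
  into one chain of cells: a cell with \<open>t = 1\<close> passes a positive east colour on, which
  a cell with \<open>t = 0\<close> cannot absorb. A constant number of tiles makes the blocks of the
  basis constants of the program. What depends on the input is the row of symbols, the relative
  position of two cells, and the side \<open>T\<close> of the grid. Padding each cell to
  \<open>4 * b * b\<close> binary coordinates makes a quarter of their number a square, and if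
  \<open>b\<close> is a power of 2, the denominators \<open>b * T\<close> are written from the
  binary digits of \<open>T\<close> without multiplication.\<close>

subsection \<open>Compiling structured programs to Turing machines\<close>

datatype com = Skip | Wr nat nat int | Mv nat int | Seq com com
  | Cond nat "nat \<Rightarrow> bool" com com | Loop nat "nat \<Rightarrow> bool" com

type_synonym store = "nat \<Rightarrow> tape"

text \<open>The times are the exact numbers of \<open>small\<close> steps. \<open>Seq\<close> pays
  one step for dropping the finished \<open>Skip\<close>, and each round of a loop pays one for the
  unfolding and one for the \<open>Seq\<close> that it creates.\<close>

inductive big :: "com \<Rightarrow> store \<Rightarrow> nat \<Rightarrow> store \<Rightarrow> bool" where
  big_Skip: "big Skip \<sigma> 0 \<sigma>"
| big_Wr: "big (Wr i s d) \<sigma> (Suc 0) (\<sigma>(i := act (s, d) (\<sigma> i)))"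
| big_Mv: "big (Mv i d) \<sigma> (Suc 0) (\<sigma>(i := (fst (\<sigma> i), snd (\<sigma> i) + d)))"
| big_Seq: "big c1 \<sigma> t1 \<sigma>1 \<Longrightarrow> big c2 \<sigma>1 t2 \<sigma>2 \<Longrightarrow> big (Seq c1 c2) \<sigma> (Suc (t1 + t2)) \<sigma>2"
| big_CondT: "P (scan (\<sigma> i)) \<Longrightarrow> big c1 \<sigma> t \<sigma>' \<Longrightarrow> big (Cond i P c1 c2) \<sigma> (Suc t) \<sigma>'"
| big_CondF: "\<not> P (scan (\<sigma> i)) \<Longrightarrow> big c2 \<sigma> t \<sigma>' \<Longrightarrow> big (Cond i P c1 c2) \<sigma> (Suc t) \<sigma>'"
| big_LoopF: "\<not> P (scan (\<sigma> i)) \<Longrightarrow> big (Loop i P c) \<sigma> (Suc 0) \<sigma>"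
| big_LoopT: "P (scan (\<sigma> i)) \<Longrightarrow> big c \<sigma> t1 \<sigma>1 \<Longrightarrow> big (Loop i P c) \<sigma>1 t2 \<sigma>2
    \<Longrightarrow> big (Loop i P c) \<sigma> (Suc (Suc (t1 + t2))) \<sigma>2"

text \<open>A machine step changes one tape only and is given by the remaining program together with this tape, the
  symbol to write and the movement. Control steps rewrite the scanned symbol of tape 0.\<close>

fun cstep :: "com \<Rightarrow> (nat \<Rightarrow> nat) \<Rightarrow> com \<times> nat \<times> nat \<times> int" where
  "cstep Skip r = (Skip, 0, r 0, 0)"
| "cstep (Wr i s d) r = (Skip, i, s, d)"
| "cstep (Mv i d) r = (Skip, i, r i, d)"
| "cstep (Seq c1 c2) r =
     (if c1 = Skip then (c2, 0, r 0, 0) else (Seq (fst (cstep c1 r)) c2, snd (cstep c1 r)))"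
| "cstep (Cond i P c1 c2) r = ((if P (r i) then c1 else c2), 0, r 0, 0)"
| "cstep (Loop i P c) r = ((if P (r i) then Seq c (Loop i P c) else Skip), 0, r 0, 0)"

definition upd :: "nat \<times> nat \<times> int \<Rightarrow> store \<Rightarrow> store" where
  "upd a \<sigma> = \<sigma>(fst a := act (snd a) (\<sigma> (fst a)))"

definition small :: "com \<times> store \<Rightarrow> com \<times> store" where
  "small x = (let y = cstep (fst x) (\<lambda>j. scan (snd x j)) in (fst y, upd (snd y) (snd x)))"

text \<open>That \<open>Skip\<close> is not reached early matters twice: under \<open>Seq\<close> a
  \<open>Skip\<close> is consumed at once, and in the machine the end of the first phase is the
  query state.\<close>

definition steps :: "nat \<Rightarrow> com \<times> store \<Rightarrow> com \<times> store \<Rightarrow> bool" where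
  "steps n x y \<longleftrightarrow> (small ^^ n) x = y \<and> (\<forall>m<n. fst ((small ^^ m) x) \<noteq> Skip)"

lemma upd_nop [simp]: "upd (i, scan (\<sigma> i), 0) \<sigma> = \<sigma>"
  by (auto simp: upd_def act_def scan_def)

lemma steps_0: "steps 0 x x"
  by (simp add: steps_def)

lemma steps_1: "c \<noteq> Skip \<Longrightarrow> small (c, \<sigma>) = y \<Longrightarrow> steps (Suc 0) (c, \<sigma>) y"
  by (simp add: steps_def)

lemma steps_trans: "steps m x y \<Longrightarrow> steps n y z \<Longrightarrow> steps (m + n) x z"
proof -
  assume a: "steps m x y" "steps n y z"
  have y: "(small ^^ m) x = y" using a(1) by (simp add: steps_def)
  have add: "(small ^^ (m + l)) x = (small ^^ l) y" for l
    by (simp add: y[symmetric] add.commute[of m] funpow_add)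
  show ?thesis unfolding steps_def
  proof (intro conjI allI impI)
    show "(small ^^ (m + n)) x = z" using a(2) by (simp add: add steps_def)
    fix l assume l: "l < m + n"
    show "fst ((small ^^ l) x) \<noteq> Skip"
    proof (cases "l < m")
      case True
      then show ?thesis using a(1) by (simp add: steps_def)
    next
      case False
      then have "(small ^^ l) x = (small ^^ (l - m)) y" using add[of "l - m"] by simp
      then show ?thesis using a(2) l False by (simp add: steps_def)
    qed
  qed
qed

lemma steps_Suc_D: "steps (Suc n) x y \<Longrightarrow> fst x \<noteq> Skip \<and> steps n (small x) y"
  unfolding steps_def funpow_Suc_right comp_apply
proof (intro conjI allI impI)
  assume a: "(small ^^ n) (small x) = y \<and> (\<forall>m<Suc n. fst ((small ^^ m) x) \<noteq> Skip)"
  show "fst x \<noteq> Skip" using a[THEN conjunct2, rule_format, of 0] by simp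
  show "(small ^^ n) (small x) = y" using a by simp
  show "fst ((small ^^ m) (small x)) \<noteq> Skip" if "m < n" for m
    using a[THEN conjunct2, rule_format, of "Suc m"] that by (simp add: funpow_swap1)
qed

lemma steps_context: "steps n x y \<Longrightarrow> steps n (Seq (fst x) c, snd x) (Seq (fst y) c, snd y)"
proof (induction n arbitrary: x)
  case 0
  then show ?case by (simp add: steps_def)
next
  case (Suc n)
  from steps_Suc_D[OF Suc.prems]
  have x: "fst x \<noteq> Skip" and s: "steps n (small x) y" by auto
  have "small (Seq (fst x) c, snd x) = (Seq (fst (small x)) c, snd (small x))"
    using x by (simp add: small_def Let_def)
  then have "steps (Suc 0) (Seq (fst x) c, snd x) (Seq (fst (small x)) c, snd (small x))"
    by (intro steps_1) auto
  from steps_trans[OF this Suc.IH[OF s]] show ?case by simp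
qed

lemma steps_Seq:
  assumes "steps t1 (c1, \<sigma>) (Skip, \<sigma>1)" "steps t2 (c2, \<sigma>1) y"
  shows "steps (Suc (t1 + t2)) (Seq c1 c2, \<sigma>) y"
proof -
  have "steps t1 (Seq c1 c2, \<sigma>) (Seq Skip c2, \<sigma>1)"
    using steps_context[OF assms(1)] by simp
  moreover have "steps (Suc 0) (Seq Skip c2, \<sigma>1) (c2, \<sigma>1)"
    by (rule steps_1) (auto simp: small_def Let_def)
  ultimately have "steps (t1 + (Suc 0 + t2)) (Seq c1 c2, \<sigma>) y"
    using assms(2) by (blast intro: steps_trans)
  then show ?thesis by simp
qed

lemma big_steps: "big c \<sigma> t \<sigma>' \<Longrightarrow> steps t (c, \<sigma>) (Skip, \<sigma>')"
proof (induction rule: big.induct)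
  case (big_Skip \<sigma>)
  then show ?case by (rule steps_0)
next
  case (big_Wr i s d \<sigma>)
  then show ?case by (intro steps_1) (auto simp: small_def Let_def upd_def)
next
  case (big_Mv i d \<sigma>)
  then show ?case by (intro steps_1) (auto simp: small_def Let_def upd_def act_def scan_def)
next
  case (big_Seq c1 \<sigma> t1 \<sigma>1 c2 t2 \<sigma>2)
  then show ?case by (blast intro: steps_Seq)
next
  case (big_CondT P \<sigma> i c1 t \<sigma>' c2)
  then have "steps (Suc 0) (Cond i P c1 c2, \<sigma>) (c1, \<sigma>)"
    by (intro steps_1) (auto simp: small_def Let_def)
  from steps_trans[OF this big_CondT.IH] show ?case by simp
next
  case (big_CondF P \<sigma> i c2 t \<sigma>' c1)
  then have "steps (Suc 0) (Cond i P c1 c2, \<sigma>) (c2, \<sigma>)"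
    by (intro steps_1) (auto simp: small_def Let_def)
  from steps_trans[OF this big_CondF.IH] show ?case by simp
next
  case (big_LoopF P \<sigma> i c)
  then show ?case by (intro steps_1) (auto simp: small_def Let_def)
next
  case (big_LoopT P \<sigma> i c t1 \<sigma>1 t2 \<sigma>2)
  then have "steps (Suc 0) (Loop i P c, \<sigma>) (Seq c (Loop i P c), \<sigma>)"
    by (intro steps_1) (auto simp: small_def Let_def)
  from steps_trans[OF this steps_Seq[OF big_LoopT.IH]] show ?case by simp
qed

section \<open>Residual programs: finiteness, closure and legality of their steps\<close>

primrec wf_com :: "nat \<Rightarrow> nat \<Rightarrow> com \<Rightarrow> bool" where
  "wf_com k G Skip = (0 < k)"
| "wf_com k G (Wr i s d) = (i < k \<and> s < G \<and> d \<in> {-1, 0, 1})"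
| "wf_com k G (Mv i d) = (i < k \<and> d \<in> {-1, 0, 1})"
| "wf_com k G (Seq c1 c2) = (wf_com k G c1 \<and> wf_com k G c2)"
| "wf_com k G (Cond i P c1 c2) = (i < k \<and> wf_com k G c1 \<and> wf_com k G c2)"
| "wf_com k G (Loop i P c) = (i < k \<and> wf_com k G c)"

text \<open>The programs that can remain during a run. Unfolding a loop puts its body in front of
  the same loop, so residuals of the body followed by the loop already close the set; it stays
  finite however often the loop runs.\<close>

primrec res :: "com \<Rightarrow> com set" where
  "res Skip = {Skip}"
| "res (Wr i s d) = {Wr i s d, Skip}"
| "res (Mv i d) = {Mv i d, Skip}"
| "res (Seq c1 c2) = (\<lambda>c. Seq c c2) ` res c1 \<union> res c2"
| "res (Cond i P c1 c2) = insert (Cond i P c1 c2) (res c1 \<union> res c2)"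
| "res (Loop i P c) = {Loop i P c, Skip} \<union> (\<lambda>c'. Seq c' (Loop i P c)) ` res c"

lemma finite_res [simp]: "finite (res c)"
  by (induction c) auto

lemma res_self [simp]: "c \<in> res c"
  by (induction c) auto

lemma res_Skip [simp]: "Skip \<in> res c"
  by (induction c) auto

lemma res_closed: "c' \<in> res c \<Longrightarrow> fst (cstep c' r) \<in> res c"
  by (induction c arbitrary: c') (auto split: if_splits)

lemma wf_com_pos: "wf_com k G c \<Longrightarrow> 0 < k"
  by (induction c) auto

lemma wf_com_res: "wf_com k G c \<Longrightarrow> c' \<in> res c \<Longrightarrow> wf_com k G c'"
proof (induction c arbitrary: c')
  case Skip
  then show ?case by simp
next
  case (Wr i s d)
  then show ?case using wf_com_pos[OF Wr.prems(1)] by auto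
next
  case (Mv i d)
  then show ?case using wf_com_pos[OF Mv.prems(1)] by auto
next
  case (Seq c1 c2)
  have w: "wf_com k G c1" "wf_com k G c2" using Seq.prems(1) by simp_all
  from Seq.prems(2) consider c where "c \<in> res c1" "c' = Seq c c2" | "c' \<in> res c2" by auto
  then show ?case
    by cases (use Seq.IH(1)[OF w(1)] Seq.IH(2)[OF w(2)] w(2) in simp_all)
next
  case (Cond i P c1 c2)
  have w: "wf_com k G c1" "wf_com k G c2" using Cond.prems(1) by simp_all
  from Cond.prems(2) consider "c' = Cond i P c1 c2" | "c' \<in> res c1" | "c' \<in> res c2" by auto
  then show ?case
  proof cases
    case 1
    then show ?thesis using Cond.prems(1) by simp
  qed (use Cond.IH(1)[OF w(1)] Cond.IH(2)[OF w(2)] in blast)+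
next
  case (Loop i P c)
  have w: "wf_com k G c" using Loop.prems(1) by simp
  from Loop.prems(2) consider "c' = Loop i P c" | "c' = Skip" | c1 where "c1 \<in> res c" "c' = Seq c1 (Loop i P c)" by auto
  then show ?case
  proof cases
    case 1
    then show ?thesis using Loop.prems(1) by simp
  next
    case 2
    then show ?thesis using wf_com_pos[OF Loop.prems(1)] by simp
  next
    case 3
    have "wf_com k G c1" by (rule Loop.IH[OF w 3(1)])
    then show ?thesis using 3(2) Loop.prems(1) by simp
  qed
qed

lemma wf_com_cstep:
  assumes "wf_com k G c" "\<And>i. i < k \<Longrightarrow> r i < G" "snd (cstep c r) = (i, s, d)"
  shows "i < k \<and> s < G \<and> d \<in> {-1, 0, 1}"
  using assms
  by (induction c) (auto split: if_splits simp: wf_com_pos)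

lemma wf_com_mono: "wf_com k G c \<Longrightarrow> G \<le> G' \<Longrightarrow> wf_com k G' c"
  by (induction c) auto

definition init_store :: "bool list \<Rightarrow> store" where
  "init_store w = (\<lambda>i. if i = 0 then tape_of w else tape_of [])"

text \<open>The first four numbers are the start, halt, query and answer states. \<open>Inl\<close>
  and \<open>Inr\<close> keep the two phases apart, so a residual program that occurs in both gets
  two states.\<close>

definition numbering :: "(com + com \<Rightarrow> nat) \<Rightarrow> com \<Rightarrow> com \<Rightarrow> com + com \<Rightarrow> nat" where
  "numbering g c1 c2 z = (if z = Inl c1 then 0 else if z = Inr Skip then 1 else
     if z = Inl Skip then 2 else if z = Inr c2 then 3 else 4 + g z)"

lemma numbering_simps:
  assumes "c1 \<noteq> Skip" "c2 \<noteq> Skip"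
  shows "numbering g c1 c2 (Inl c1) = 0" "numbering g c1 c2 (Inr Skip) = 1"
    "numbering g c1 c2 (Inl Skip) = 2" "numbering g c1 c2 (Inr c2) = 3"
  using assms by (auto simp: numbering_def)

lemma numbering_inj: "inj_on g Z \<Longrightarrow> inj_on (numbering g c1 c2) Z"
  unfolding inj_on_def by (auto simp: numbering_def)

text \<open>The move from \<open>Inl Skip\<close> to \<open>Inr c2\<close> is made only without an
  oracle; with one, \<open>step\<close> itself passes from the query to the answer state.\<close>

definition next_prog :: "com \<Rightarrow> com + com \<Rightarrow> (nat \<Rightarrow> nat) \<Rightarrow> (com + com) \<times> nat \<times> nat \<times> int" where
  "next_prog c2 z r = (case z of
      Inl c \<Rightarrow> if c = Skip then (Inr c2, 0, r 0, 0) else (Inl (fst (cstep c r)), snd (cstep c r))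
    | Inr c \<Rightarrow> (Inr (fst (cstep c r)), snd (cstep c r)))"

definition acts :: "nat \<times> nat \<times> int \<Rightarrow> nat list \<Rightarrow> (nat \<times> int) list" where
  "acts a ss = (map (\<lambda>s. (s, 0)) ss)[fst a := snd a]"

lemma map2_acts:
  assumes "length ts = k" "i < k"
  shows "map2 act (acts (i, s, d) (map scan ts)) ts = ts[i := act (s, d) (ts ! i)]"
  using assms by (auto simp: acts_def list_eq_iff_nth_eq nth_list_update act_def scan_def)

lemma store_upd:
  assumes "i < k"
  shows "(map \<sigma> [0..<k])[i := act (s, d) (\<sigma> i)] = map (upd (i, s, d) \<sigma>) [0..<k]"
  using assms by (auto simp: list_eq_iff_nth_eq nth_list_update upd_def)

text \<open>A machine with \<open>k\<close> tapes knows only the list of \<open>k\<close> scanned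
  symbols, and \<open>(!) ss\<close> is unspecified beyond its end; a program on \<open>k\<close>
  tapes never looks there.\<close>

lemma cstep_cong: "wf_com k G c \<Longrightarrow> (\<And>i. i < k \<Longrightarrow> r i = r' i) \<Longrightarrow> cstep c r = cstep c r'"
  by (induction c) (auto simp: wf_com_pos)

text \<open>The states of the machine are the finitely many residual programs, numbered so that \<open>c1\<close> ends in the query
  state and \<open>c2\<close> begins in the answer state; without an oracle the query step does nothing.\<close>

lemma program_tm:
  assumes wf1: "wf_com k G c1" and wf2: "wf_com k G c2" and k: "2 \<le> k" and G: "3 \<le> G"
    and ne: "c1 \<noteq> Skip" "c2 \<noteq> Skip"
  obtains M where "wf_tm M"
    "\<And>orc w t1 \<sigma>1 t2 \<sigma>2. big c1 (init_store w) t1 \<sigma>1 \<Longrightarrow>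
       big c2 (case orc of None \<Rightarrow> \<sigma>1 | Some F \<Rightarrow> \<sigma>1(1 := tape_of (F (tape_string (\<sigma>1 1))))) t2 \<sigma>2 \<Longrightarrow>
       outputs_within orc M w (t1 + 1 + t2) (tape_string (\<sigma>2 0))"
proof -
  define Z where "Z = Inl ` res c1 \<union> Inr ` res c2"
  have finZ: "finite Z" by (simp add: Z_def)
  obtain g :: "com + com \<Rightarrow> nat" where g: "inj_on g Z"
    using finite_imp_inj_to_nat_seg[OF finZ] by blast
  define \<nu> where "\<nu> = numbering g c1 c2"
  define dec where "dec = inv_into Z \<nu>"
  have inj: "inj_on \<nu> Z" unfolding \<nu>_def using g by (rule numbering_inj)
  have dec: "dec (\<nu> z) = z" if "z \<in> Z" for z
    unfolding dec_def using inj that by (rule inv_into_f_f)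
  have inZ: "Inl c1 \<in> Z" "Inr Skip \<in> Z" "Inl Skip \<in> Z" "Inr c2 \<in> Z"
    by (auto simp: Z_def)
  note nu = numbering_simps[OF ne, of g, folded \<nu>_def]
  \<comment> \<open>Numbers below the maximum that belong to no residual program get an arbitrary
    legal transition, so that the machine is well-formed.\<close>
  define M where "M = \<lparr>tapes = k, symbols = G, states = Suc (Max (\<nu> ` Z)),
    delta = (\<lambda>q ss. if q \<in> \<nu> ` Z
      then let y = next_prog c2 (dec q) ((!) ss) in (\<nu> (fst y), acts (snd y) ss)
      else (0, map (\<lambda>s. (s, 0)) ss))\<rparr>"
  have M: "tapes M = k" "symbols M = G" "states M = Suc (Max (\<nu> ` Z))"
    by (simp_all add: M_def)
  have deltaM: "delta M (\<nu> z) ss =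
      (\<nu> (fst (next_prog c2 z ((!) ss))), acts (snd (next_prog c2 z ((!) ss))) ss)" if "z \<in> Z" for z ss
    using that by (auto simp: M_def dec Let_def)
  have nuZ: "\<nu> z < states M" if "z \<in> Z" for z
    using that finZ by (simp add: M_def less_Suc_eq_le)
  have np_closed: "fst (next_prog c2 z r) \<in> Z" if "z \<in> Z" for z r
    using that by (auto simp: Z_def next_prog_def res_closed)
  have np_act: "i < k \<and> s < G \<and> d \<in> {-1, 0, 1}"
    if "z \<in> Z" "\<And>i. i < k \<Longrightarrow> r i < G" "snd (next_prog c2 z r) = (i, s, d)" for z r i s d
  proof (cases z)
    case (Inl c)
    then have "wf_com k G c" using that(1) wf1 by (auto simp: Z_def intro: wf_com_res)
    then show ?thesis using that Inl wf_com_cstep[of k G c r i s d] k G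
      by (cases "c = Skip") (auto simp: next_prog_def)
  next
    case (Inr c)
    then have "wf_com k G c" using that(1) wf2 by (auto simp: Z_def intro: wf_com_res)
    then show ?thesis using that Inr wf_com_cstep[of k G c r i s d]
      by (auto simp: next_prog_def)
  qed
  have wfM: "wf_tm M"
    unfolding wf_tm_def M
  proof (intro conjI allI impI)
    show "2 \<le> k" by fact
    show "3 \<le> G" by fact
    show "4 \<le> Suc (Max (\<nu> ` Z))" using nuZ[OF inZ(4)] nu(4) M(3) by simp
    fix q ss assume ss: "length ss = k" "set ss \<subseteq> {..<G}"
    have lt: "ss ! i < G" if "i < k" for i using that ss by (metis lessThan_iff nth_mem subsetD)
    show "case delta M q ss of (q', as) \<Rightarrow> q' < Suc (Max (\<nu> ` Z)) \<and> length as = k \<and>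
        (\<forall>(s, d) \<in> set as. s < G \<and> d \<in> {-1, 0, 1})"
    proof (cases "q \<in> \<nu> ` Z")
      case False
      then show ?thesis using ss by (auto simp: M_def)
    next
      case True
      then obtain z where z: "z \<in> Z" "q = \<nu> z" by auto
      obtain i s d where isd: "snd (next_prog c2 z ((!) ss)) = (i, s, d)" by (metis prod_cases3)
      have "set (acts (i, s, d) ss) \<subseteq> insert (s, d) ((\<lambda>s. (s, 0)) ` set ss)"
        unfolding acts_def by (metis fst_conv list.set_map set_update_subset_insert snd_conv)
      then have "\<forall>(s, d) \<in> set (acts (i, s, d) ss). s < G \<and> d \<in> {-1, 0, 1}"
        using np_act[OF z(1) lt isd] ss by fastforce
      moreover have "\<nu> (fst (next_prog c2 z ((!) ss))) < Suc (Max (\<nu> ` Z))"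
        using nuZ[OF np_closed[OF z(1)]] M(3) by simp
      ultimately show ?thesis using z ss by (simp add: deltaM isd acts_def)
    qed
  qed
  define conf where "conf z \<sigma> = (\<nu> z, map \<sigma> [0..<k])" for z and \<sigma> :: store
  have k0: "0 < k" using k by simp
  have conf_step: "step orc M (conf z \<sigma>) = conf (fst y) (upd (snd y) \<sigma>)"
    if "z \<in> Z" "z \<noteq> Inr Skip" "orc = None \<or> z \<noteq> Inl Skip"
      "y = next_prog c2 z (\<lambda>j. scan (\<sigma> j))" for orc z \<sigma> y
  proof -
    have q1: "\<nu> z \<noteq> 1" using inj that(1,2) inZ nu(2) by (metis inj_onD)
    have q2: "orc = None \<or> \<nu> z \<noteq> 2" using inj that(1,3) inZ nu(3) by (metis inj_onD)
    let ?ss = "map scan (map \<sigma> [0..<k])"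
    have "step orc M (conf z \<sigma>) = (\<nu> (fst (next_prog c2 z ((!) ?ss))),
        map2 act (acts (snd (next_prog c2 z ((!) ?ss))) ?ss) (map \<sigma> [0..<k]))"
      using q1 q2 by (auto simp: step_def conf_def deltaM[OF that(1)])
    moreover have "next_prog c2 z ((!) ?ss) = y"
    proof (cases z)
      case (Inl c)
      then have "wf_com k G c" using that(1) wf1 by (auto simp: Z_def intro: wf_com_res)
      then have "cstep c ((!) ?ss) = cstep c (\<lambda>j. scan (\<sigma> j))" by (rule cstep_cong) auto
      then show ?thesis using that(4) Inl k0 by (simp add: next_prog_def)
    next
      case (Inr c)
      then have "wf_com k G c" using that(1) wf2 by (auto simp: Z_def intro: wf_com_res)
      then have "cstep c ((!) ?ss) = cstep c (\<lambda>j. scan (\<sigma> j))" by (rule cstep_cong) auto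
      then show ?thesis using that(4) Inr by (simp add: next_prog_def)
    qed
    moreover obtain i s d where isd: "snd y = (i, s, d)" by (metis prod_cases3)
    moreover have "i < k"
    proof (cases z)
      case (Inl c)
      then have wf: "wf_com k G c" using that(1) wf1 by (auto simp: Z_def intro: wf_com_res)
      \<comment> \<open>The store is arbitrary and may contain symbols outside the alphabet. Only
        \<open>i < k\<close> is wanted, so the alphabet is enlarged until it contains all scanned
        symbols.\<close>
      have "scan (\<sigma> j) < Suc (Max ((\<lambda>j. scan (\<sigma> j)) ` {..<k}) + G)" if "j < k" for j
        using that by (simp add: less_Suc_eq_le trans_le_add1)
      from wf_com_cstep[where r = "\<lambda>j. scan (\<sigma> j)", OF wf_com_mono[OF wf] this] Inl isd that(4) k0
      show ?thesis by (cases "c = Skip") (auto simp: next_prog_def)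
    next
      case (Inr c)
      then have wf: "wf_com k G c" using that(1) wf2 by (auto simp: Z_def intro: wf_com_res)
      have "scan (\<sigma> j) < Suc (Max ((\<lambda>j. scan (\<sigma> j)) ` {..<k}) + G)" if "j < k" for j
        using that by (simp add: less_Suc_eq_le trans_le_add1)
      from wf_com_cstep[where r = "\<lambda>j. scan (\<sigma> j)", OF wf_com_mono[OF wf] this] Inr isd that(4) k0
      show ?thesis by (auto simp: next_prog_def)
    qed
    ultimately show ?thesis
      by (simp add: map2_acts[of _ k] store_upd conf_def del: map_map)
  qed
  have run1: "(step orc M ^^ t) (conf (Inl c) \<sigma>) = conf (Inl (fst y)) (snd y)"
    if "steps t (c, \<sigma>) y" "c \<in> res c1" for orc t c \<sigma> y
    using that
  proof (induction t arbitrary: c \<sigma>)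
    case 0
    then show ?case by (auto simp: steps_def)
  next
    case (Suc t)
    from steps_Suc_D[OF Suc.prems(1)]
    have c: "c \<noteq> Skip" and s: "steps t (small (c, \<sigma>)) y" by auto
    have "step orc M (conf (Inl c) \<sigma>) = conf (Inl (fst (small (c, \<sigma>)))) (snd (small (c, \<sigma>)))"
      using c Suc.prems(2) by (subst conf_step[OF _ _ _ refl]) (auto simp: Z_def next_prog_def small_def Let_def)
    moreover have "fst (small (c, \<sigma>)) \<in> res c1"
      using Suc.prems(2) by (simp add: small_def Let_def res_closed)
    ultimately show ?case using Suc.IH[of "fst (small (c, \<sigma>))" "snd (small (c, \<sigma>))"] s
      by (simp add: funpow_Suc_right del: funpow.simps)
  qed
  have run2: "(step orc M ^^ t) (conf (Inr c) \<sigma>) = conf (Inr (fst y)) (snd y)"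
    if "steps t (c, \<sigma>) y" "c \<in> res c2" for orc t c \<sigma> y
    using that
  proof (induction t arbitrary: c \<sigma>)
    case 0
    then show ?case by (auto simp: steps_def)
  next
    case (Suc t)
    from steps_Suc_D[OF Suc.prems(1)]
    have c: "c \<noteq> Skip" and s: "steps t (small (c, \<sigma>)) y" by auto
    have "step orc M (conf (Inr c) \<sigma>) = conf (Inr (fst (small (c, \<sigma>)))) (snd (small (c, \<sigma>)))"
      using c Suc.prems(2) by (subst conf_step[OF _ _ _ refl]) (auto simp: Z_def next_prog_def small_def Let_def)
    moreover have "fst (small (c, \<sigma>)) \<in> res c2"
      using Suc.prems(2) by (simp add: small_def Let_def res_closed)
    ultimately show ?case using Suc.IH[of "fst (small (c, \<sigma>))" "snd (small (c, \<sigma>))"] s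
      by (simp add: funpow_Suc_right del: funpow.simps)
  qed
  have query: "step orc M (conf (Inl Skip) \<sigma>) =
      conf (Inr c2) (case orc of None \<Rightarrow> \<sigma> | Some F \<Rightarrow> \<sigma>(1 := tape_of (F (tape_string (\<sigma> 1)))))" for orc \<sigma>
  proof (cases orc)
    case None
    have "step None M (conf (Inl Skip) \<sigma>) = conf (Inr c2) \<sigma>"
      by (subst conf_step[OF _ _ _ refl]) (auto simp: Z_def next_prog_def)
    then show ?thesis using None by simp
  next
    case (Some F)
    have "map (\<sigma>(1 := x)) [0..<k] = (map \<sigma> [0..<k])[1 := x]" for x
      by (auto simp: list_eq_iff_nth_eq nth_list_update)
    then show ?thesis using Some k by (simp add: step_def conf_def nu)
  qed
  have init: "init_config M w = conf (Inl c1) (init_store w)" for w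
  proof -
    obtain k' where "k = Suc k'" using k0 by (cases k) auto
    then show ?thesis
      by (auto simp: init_config_def conf_def nu M init_store_def list_eq_iff_nth_eq nth_Cons nth_append
        split: nat.splits simp del: upt_Suc)
  qed
  have "outputs_within orc M w (t1 + 1 + t2) (tape_string (\<sigma>2 0))"
    if b: "big c1 (init_store w) t1 \<sigma>1"
      "big c2 (case orc of None \<Rightarrow> \<sigma>1 | Some F \<Rightarrow> \<sigma>1(1 := tape_of (F (tape_string (\<sigma>1 1))))) t2 \<sigma>2"
    for orc w t1 \<sigma>1 t2 \<sigma>2
  proof -
    have "(step orc M ^^ (t2 + (Suc 0 + t1))) (init_config M w) = conf (Inr Skip) \<sigma>2"
      using run1[OF big_steps[OF b(1)], of orc] run2[OF big_steps[OF b(2)], of orc]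
      unfolding funpow_add by (simp add: init query)
    then show ?thesis unfolding outputs_within_def using k0
      by (intro exI[of _ "t1 + 1 + t2"] conjI exI[of _ "map \<sigma>2 [0..<k]"])
        (auto simp: conf_def nu ac_simps)
  qed
  with wfM show ?thesis using that by blast
qed

subsection \<open>Tapes holding lists\<close>

definition tp :: "nat list \<Rightarrow> int \<Rightarrow> tape" where
  "tp xs h = ((\<lambda>i. if 0 \<le> i \<and> i < int (length xs) then xs ! nat i else 0), h)"

definition bsym :: "bool \<Rightarrow> nat" where
  "bsym b = (if b then 2 else 1)"

lemma bsym_simps [simp]: "bsym True = 2" "bsym False = 1"
  by (auto simp: bsym_def)

lemma tape_of_tp: "tape_of w = tp (map bsym w) 0"
  by (auto simp: tape_of_def tp_def string_cells_def bsym_def fun_eq_iff nat_less_iff)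

lemma tape_string_tp [simp]: "tape_string (tp (map bsym w) h) = w"
proof -
  have "(LEAST j. fst (tp (map bsym w) h) (int j) \<notin> {1, 2}) = length w"
  proof (rule Least_equality)
    show "fst (tp (map bsym w) h) (int (length w)) \<notin> {1, 2}" by (simp add: tp_def)
    fix y assume "fst (tp (map bsym w) h) (int y) \<notin> {1, 2}"
    then show "length w \<le> y" by (cases "y < length w") (auto simp: tp_def bsym_def split: if_splits)
  qed
  then have "tape_string (tp (map bsym w) h) = map (\<lambda>j. fst (tp (map bsym w) h) (int j) = 2) [0..<length w]"
    by (simp only: tape_string_def)
  also have "\<dots> = w" by (rule nth_equalityI) (auto simp: tp_def bsym_def)
  finally show ?thesis .
qed

lemma scan_tp [simp]: "scan (tp xs (int j)) = (if j < length xs then xs ! j else 0)"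
  by (auto simp: scan_def tp_def)

lemma scan_tp_0 [simp]: "scan (tp xs 0) = (if xs = [] then 0 else hd xs)"
  using scan_tp[of xs 0] by (auto simp: hd_conv_nth)

lemma scan_tp_neg [simp]: "h < 0 \<Longrightarrow> scan (tp xs h) = 0"
  by (auto simp: scan_def tp_def)

lemma snd_tp [simp]: "snd (tp xs h) = h"
  by (simp add: tp_def)

lemma tp_move [simp]: "(fst (tp xs h), h') = tp xs h'"
  by (simp add: tp_def)

lemma act_tp_end [simp]: "act (s, d) (tp xs (int (length xs))) = tp (xs @ [s]) (int (length xs) + d)"
  by (auto simp: act_def tp_def fun_eq_iff nth_append)

lemma act_tp_mid: "act (s, d) (tp (xs @ x # ys) (int (length xs))) = tp (xs @ s # ys) (int (length xs) + d)"
  by (auto simp: act_def tp_def fun_eq_iff nth_append)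

definition app :: "nat list \<Rightarrow> tape \<Rightarrow> tape" where
  "app ss t = foldl (\<lambda>t s. act (s, 1) t) t ss"

lemma app_simps [simp]: "app [] t = t" "app (s # ss) t = app ss (act (s, 1) t)"
  "app (xs @ ys) t = app ys (app xs t)"
  by (auto simp: app_def)

lemma app_tp [simp]: "app ys (tp xs (int (length xs))) = tp (xs @ ys) (int (length xs + length ys))"
proof (induction ys arbitrary: xs)
  case (Cons y ys)
  show ?case using Cons[of "xs @ [y]"] by (simp add: add.commute)
qed simp

lemma app_tp_Nil [simp]: "app ys (tp [] 0) = tp ys (int (length ys))"
  using app_tp[of ys "[]"] by simp

subsection \<open>Locality of programs\<close>

primrec vars :: "com \<Rightarrow> nat set" where
  "vars Skip = {}"
| "vars (Wr i s d) = {i}"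
| "vars (Mv i d) = {i}"
| "vars (Seq c1 c2) = vars c1 \<union> vars c2"
| "vars (Cond i P c1 c2) = insert i (vars c1 \<union> vars c2)"
| "vars (Loop i P c) = insert i (vars c)"

text \<open>This lets the body of nested loops run while the counter tape of an outer loop stands at
  any position.\<close>

lemma big_frame: "big c \<sigma> t \<sigma>' \<Longrightarrow> i \<notin> vars c \<Longrightarrow> big c (\<sigma>(i := x)) t (\<sigma>'(i := x))"
proof (induction rule: big.induct)
  case (big_Wr j s d \<sigma>)
  then have "(\<sigma>(j := act (s, d) (\<sigma> j)))(i := x) = (\<sigma>(i := x))(j := act (s, d) ((\<sigma>(i := x)) j))"
    by (auto simp: fun_eq_iff)
  then show ?case by (simp only: big.big_Wr)
next
  case (big_Mv j d \<sigma>)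
  then have "(\<sigma>(j := (fst (\<sigma> j), snd (\<sigma> j) + d)))(i := x) =
      (\<sigma>(i := x))(j := (fst ((\<sigma>(i := x)) j), snd ((\<sigma>(i := x)) j) + d))"
    by (auto simp: fun_eq_iff)
  then show ?case by (simp only: big.big_Mv)
next
  case (big_LoopT P \<sigma> j c t1 \<sigma>1 t2 \<sigma>2)
  have "i \<notin> vars c" "i \<noteq> j" using big_LoopT.prems by auto
  then show ?case using big_LoopT by (intro big.big_LoopT) simp_all
qed (auto intro: big.intros)

subsection \<open>Polynomially bounded running time\<close>

definition pbd :: "('i \<Rightarrow> nat) \<Rightarrow> 'i set \<Rightarrow> ('i \<Rightarrow> nat) \<Rightarrow> bool" where
  "pbd sz D f \<longleftrightarrow> (\<exists>P :: nat poly. \<forall>i\<in>D. f i \<le> poly P (sz i))"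

lemma poly_nat_mono: "x \<le> y \<Longrightarrow> poly P x \<le> poly P y" for P :: "nat poly"
  by (induction P) (auto intro!: add_mono mult_mono)

lemma pbd_const [intro]: "pbd sz D (\<lambda>i. c)"
  unfolding pbd_def by (rule exI[of _ "[:c:]"]) auto

lemma pbd_sz [intro]: "pbd sz D sz"
  unfolding pbd_def by (rule exI[of _ "[:0, 1:]"]) auto

lemma pbd_add [intro]: "pbd sz D f \<Longrightarrow> pbd sz D g \<Longrightarrow> pbd sz D (\<lambda>i. f i + g i)"
  unfolding pbd_def
proof safe
  fix P Q :: "nat poly" assume "\<forall>i\<in>D. f i \<le> poly P (sz i)" "\<forall>i\<in>D. g i \<le> poly Q (sz i)"
  then show "\<exists>P. \<forall>i\<in>D. f i + g i \<le> poly P (sz i)"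
    by (intro exI[of _ "P + Q"]) (auto intro: add_mono)
qed

lemma pbd_mult [intro]: "pbd sz D f \<Longrightarrow> pbd sz D g \<Longrightarrow> pbd sz D (\<lambda>i. f i * g i)"
  unfolding pbd_def
proof safe
  fix P Q :: "nat poly" assume "\<forall>i\<in>D. f i \<le> poly P (sz i)" "\<forall>i\<in>D. g i \<le> poly Q (sz i)"
  then show "\<exists>P. \<forall>i\<in>D. f i * g i \<le> poly P (sz i)"
    by (intro exI[of _ "P * Q"]) (auto intro: mult_mono)
qed

lemma pbd_Suc [intro]: "pbd sz D f \<Longrightarrow> pbd sz D (\<lambda>i. Suc (f i))"
  using pbd_add[of sz D f "\<lambda>_. 1"] by auto

lemma pbd_le: "pbd sz D g \<Longrightarrow> (\<And>i. i \<in> D \<Longrightarrow> f i \<le> g i) \<Longrightarrow> pbd sz D f"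
  unfolding pbd_def by (meson order_trans)

lemma pbd_poly: "pbd sz D f \<Longrightarrow> pbd sz D (\<lambda>i. poly P (f i))" for P :: "nat poly"
  by (induction P) auto

text \<open>Running times are existentially hidden in this notion, so that none has to be computed explicitly.\<close>

definition pex :: "('i \<Rightarrow> nat) \<Rightarrow> 'i set \<Rightarrow> com \<Rightarrow> ('i \<Rightarrow> store) \<Rightarrow> ('i \<Rightarrow> store) \<Rightarrow> bool" where
  "pex sz D c S S' \<longleftrightarrow> (\<exists>P :: nat poly. \<forall>i\<in>D. \<exists>t \<le> poly P (sz i). big c (S i) t (S' i))"

lemma pexI:
  assumes "pbd sz D f" "\<And>i. i \<in> D \<Longrightarrow> \<exists>t \<le> f i. big c (S i) t (S' i)"
  shows "pex sz D c S S'"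
  using assms unfolding pbd_def pex_def by (meson order_trans)

lemma pexE:
  assumes "pex sz D c S S'"
  obtains f where "pbd sz D f" "\<And>i. i \<in> D \<Longrightarrow> \<exists>t \<le> f i. big c (S i) t (S' i)"
proof -
  from assms obtain P :: "nat poly" where "\<forall>i\<in>D. \<exists>t \<le> poly P (sz i). big c (S i) t (S' i)"
    unfolding pex_def by blast
  then show ?thesis using that[of "\<lambda>i. poly P (sz i)"] by (auto simp: pbd_def)
qed

lemma pex_Skip: "(\<And>i. i \<in> D \<Longrightarrow> S i = S' i) \<Longrightarrow> pex sz D Skip S S'"
  by (rule pexI[OF pbd_const[of _ _ 0]]) (auto intro: big_Skip)

lemma pex_Wr: "(\<And>i. i \<in> D \<Longrightarrow> S' i = (S i)(x := act (s, d) (S i x))) \<Longrightarrow> pex sz D (Wr x s d) S S'"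
  by (rule pexI[OF pbd_const[of _ _ 1]], rule exI[of _ 1]) (simp add: big_Wr)

lemma pex_Mv: "(\<And>i. i \<in> D \<Longrightarrow> S' i = (S i)(x := (fst (S i x), snd (S i x) + d))) \<Longrightarrow> pex sz D (Mv x d) S S'"
  by (rule pexI[OF pbd_const[of _ _ 1]], rule exI[of _ 1]) (simp add: big_Mv)

lemma pex_Seq:
  assumes "pex sz D c1 S S1" "pex sz D c2 S1 S2"
  shows "pex sz D (Seq c1 c2) S S2"
proof -
  obtain f where f: "pbd sz D f" "\<And>i. i \<in> D \<Longrightarrow> \<exists>t \<le> f i. big c1 (S i) t (S1 i)"
    using pexE[OF assms(1)] by blast
  obtain g where g: "pbd sz D g" "\<And>i. i \<in> D \<Longrightarrow> \<exists>t \<le> g i. big c2 (S1 i) t (S2 i)"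
    using pexE[OF assms(2)] by blast
  show ?thesis
  proof (rule pexI)
    show "pbd sz D (\<lambda>i. f i + 1 + g i)" by (intro pbd_add pbd_const f(1) g(1))
    fix i assume "i \<in> D"
    then obtain t1 t2 where "t1 \<le> f i" "big c1 (S i) t1 (S1 i)" "t2 \<le> g i" "big c2 (S1 i) t2 (S2 i)"
      using f g by meson
    then show "\<exists>t\<le>f i + 1 + g i. big (Seq c1 c2) (S i) t (S2 i)"
      by (intro exI[of _ "Suc (t1 + t2)"] conjI big_Seq) auto
  qed
qed

lemma pex_cong:
  assumes "pex sz D c S S'" "\<And>i. i \<in> D \<Longrightarrow> S i = R i" "\<And>i. i \<in> D \<Longrightarrow> S' i = R' i"
  shows "pex sz D c R R'"
  using assms unfolding pex_def by metis

text \<open>Change of index: \<open>g\<close> names the old run that serves for a new index. Sizes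
  may grow because polynomials over the naturals are monotone.\<close>

lemma pex_sub:
  assumes "pex sz D c S S'"
    "\<And>i. i \<in> D' \<Longrightarrow> g i \<in> D \<and> sz (g i) \<le> sz' i \<and> R i = S (g i) \<and> R' i = S' (g i)"
  shows "pex sz' D' c R R'"
proof -
  obtain P where P: "\<And>i. i \<in> D \<Longrightarrow> \<exists>t \<le> poly P (sz i). big c (S i) t (S' i)"
    using assms(1) unfolding pex_def by blast
  have "\<exists>t \<le> poly P (sz' i). big c (R i) t (R' i)" if "i \<in> D'" for i
  proof -
    from assms(2)[OF that] have g: "g i \<in> D" "sz (g i) \<le> sz' i" "R i = S (g i)" "R' i = S' (g i)" by auto
    from P[OF g(1)] obtain t where "t \<le> poly P (sz (g i))" "big c (R i) t (R' i)" using g by auto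
    then show ?thesis using poly_nat_mono[OF g(2), of P] by (meson order_trans)
  qed
  then show ?thesis unfolding pex_def by blast
qed

lemma pex_Cond:
  assumes "pex sz {i \<in> D. P (scan (S i x))} c1 S S'" "pex sz {i \<in> D. \<not> P (scan (S i x))} c2 S S'"
  shows "pex sz D (Cond x P c1 c2) S S'"
proof -
  obtain A where A: "\<And>i. i \<in> D \<Longrightarrow> P (scan (S i x)) \<Longrightarrow> \<exists>t \<le> poly A (sz i). big c1 (S i) t (S' i)"
    using assms(1) unfolding pex_def by blast
  obtain B where B: "\<And>i. i \<in> D \<Longrightarrow> \<not> P (scan (S i x)) \<Longrightarrow> \<exists>t \<le> poly B (sz i). big c2 (S i) t (S' i)"
    using assms(2) unfolding pex_def by blast
  show ?thesis
  proof (rule pexI)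
    show "pbd sz D (\<lambda>i. 1 + (poly A (sz i) + poly B (sz i)))"
      by (intro pbd_add pbd_const pbd_poly pbd_sz)
    fix i assume i: "i \<in> D"
    show "\<exists>t\<le>1 + (poly A (sz i) + poly B (sz i)). big (Cond x P c1 c2) (S i) t (S' i)"
    proof (cases "P (scan (S i x))")
      case True
      with A[OF i] obtain t where "t \<le> poly A (sz i)" "big c1 (S i) t (S' i)" by blast
      then show ?thesis using big_CondT[of P "S i" x c1 t "S' i" c2] True
        by (intro exI[of _ "Suc t"]) auto
    next
      case False
      with B[OF i] obtain t where "t \<le> poly B (sz i)" "big c2 (S i) t (S' i)" by blast
      then show ?thesis using big_CondF[of P "S i" x c2 t "S' i" c1] False
        by (intro exI[of _ "Suc t"]) auto
    qed
  qed
qed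

lemma big_Loop_iter:
  assumes "\<And>j. j < n \<Longrightarrow> P (scan (S j x)) \<and> (\<exists>t \<le> tb. big c (S j) t (S (Suc j)))"
    and "\<not> P (scan (S n x))"
  shows "\<exists>t \<le> n * (tb + 2) + 1. big (Loop x P c) (S 0) t (S n)"
  using assms
proof (induction n arbitrary: S)
  case 0
  then show ?case by (intro exI[of _ "Suc 0"] conjI big_LoopF) simp_all
next
  case (Suc n)
  have "\<exists>t \<le> n * (tb + 2) + 1. big (Loop x P c) (S (Suc 0)) t (S (Suc n))"
    using Suc.prems by (intro Suc.IH[of "\<lambda>j. S (Suc j)"]) auto
  then obtain t2 where t2: "t2 \<le> n * (tb + 2) + 1" "big (Loop x P c) (S (Suc 0)) t2 (S (Suc n))" by blast
  obtain t1 where t1: "t1 \<le> tb" "big c (S 0) t1 (S (Suc 0))" "P (scan (S 0 x))"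
    using Suc.prems(1)[of 0] by auto
  show ?case using big_LoopT[of P "S 0" x c t1 "S (Suc 0)" t2 "S (Suc n)"] t1 t2
    by (intro exI[of _ "Suc (Suc (t1 + t2))"]) auto
qed

text \<open>The body is treated as one family indexed by pairs of an input and a round, with the
  size of the input alone. Hence a single polynomial bounds all rounds, and the bounds cannot
  compound from round to round.\<close>

lemma pex_Loop:
  assumes body: "pex (\<lambda>(i, j). sz i) {(i, j). i \<in> D \<and> j < n i} c (\<lambda>(i, j). S i j) (\<lambda>(i, j). S i (Suc j))"
    and n: "pbd sz D n"
    and P: "\<And>i j. i \<in> D \<Longrightarrow> j < n i \<Longrightarrow> P (scan (S i j x))"
    and nP: "\<And>i. i \<in> D \<Longrightarrow> \<not> P (scan (S i (n i) x))"
    and S0: "\<And>i. i \<in> D \<Longrightarrow> R i = S i 0" and Sn: "\<And>i. i \<in> D \<Longrightarrow> R' i = S i (n i)"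
  shows "pex sz D (Loop x P c) R R'"
proof -
  obtain A :: "nat poly" where A: "\<And>i j. i \<in> D \<Longrightarrow> j < n i \<Longrightarrow>
      \<exists>t \<le> poly A (sz i). big c (S i j) t (S i (Suc j))"
    using body unfolding pex_def by fastforce
  show ?thesis
  proof (rule pexI)
    show "pbd sz D (\<lambda>i. n i * (poly A (sz i) + 2) + 1)"
      by (intro pbd_add pbd_mult pbd_const pbd_poly pbd_sz n)
    fix i assume i: "i \<in> D"
    have "\<exists>t \<le> n i * (poly A (sz i) + 2) + 1. big (Loop x P c) (S i 0) t (S i (n i))"
      using A[OF i] P[OF i] nP[OF i] by (intro big_Loop_iter) auto
    then show "\<exists>t \<le> n i * (poly A (sz i) + 2) + 1. big (Loop x P c) (R i) t (R' i)"
      using S0[OF i] Sn[OF i] by simp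
  qed
qed

primrec switch :: "nat \<Rightarrow> nat \<Rightarrow> (nat \<Rightarrow> com) \<Rightarrow> com" where
  "switch x 0 f = f 0"
| "switch x (Suc n) f = Cond x (\<lambda>s. s = Suc n) (f (Suc n)) (switch x n f)"

lemma pex_switch:
  assumes "\<And>i. i \<in> D \<Longrightarrow> scan (S i x) \<le> n"
    and "\<And>s. s \<le> n \<Longrightarrow> pex sz {i \<in> D. scan (S i x) = s} (f s) S S'"
  shows "pex sz D (switch x n f) S S'"
  using assms
proof (induction n arbitrary: D)
  case 0
  then have "{i \<in> D. scan (S i x) = 0} = D" by auto
  then show ?case using 0(2)[of 0] by simp
next
  case (Suc n)
  have "pex sz {i \<in> D. scan (S i x) \<noteq> Suc n} (switch x n f) S S'"
  proof (rule Suc.IH)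
    show "scan (S i x) \<le> n" if "i \<in> {i \<in> D. scan (S i x) \<noteq> Suc n}" for i
      using that Suc.prems(1)[of i] by auto
    fix s assume "s \<le> n"
    then have "{i \<in> {i \<in> D. scan (S i x) \<noteq> Suc n}. scan (S i x) = s} = {i \<in> D. scan (S i x) = s}" by auto
    then show "pex sz {i \<in> {i \<in> D. scan (S i x) \<noteq> Suc n}. scan (S i x) = s} (f s) S S'"
      using Suc.prems(2)[of s] \<open>s \<le> n\<close> by simp
  qed
  then show ?case using Suc.prems(2)[of "Suc n"] by (auto intro: pex_Cond)
qed

text \<open>The first move leaves the blank behind the contents, where the head may stand. The loop
  then stops at the blank in cell \<open>-1\<close>, provided that there is no blank inside the
  contents.\<close>

definition rewind :: "nat \<Rightarrow> com" where
  "rewind x = Seq (Mv x (-1)) (Seq (Loop x (\<lambda>s. s \<noteq> 0) (Mv x (-1))) (Mv x 1))"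

lemma big_rewind:
  assumes "\<sigma> x = tp xs (int h)" "h \<le> length xs" "0 \<notin> set xs"
  shows "\<exists>t \<le> 3 * h + 5. big (rewind x) \<sigma> t (\<sigma>(x := tp xs 0))"
proof -
  have "\<exists>t \<le> h * (1 + 2) + 1. big (Loop x (\<lambda>s. s \<noteq> 0) (Mv x (-1)))
      ((\<lambda>j. \<sigma>(x := tp xs (int h - 1 - int j))) 0) t ((\<lambda>j. \<sigma>(x := tp xs (int h - 1 - int j))) h)"
  proof (rule big_Loop_iter, intro conjI)
    fix j assume j: "j < h"
    then have e: "int h - 1 - int j = int (h - 1 - j)" by simp
    have "xs ! (h - 1 - j) \<in> set xs" using j assms(2) by (intro nth_mem) simp
    then have "xs ! (h - 1 - j) \<noteq> 0" using assms(3) by metis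
    then show "scan ((\<sigma>(x := tp xs (int h - 1 - int j))) x) \<noteq> 0"
      using j assms(2) unfolding fun_upd_same e scan_tp by simp
    show "\<exists>t\<le>1. big (Mv x (- 1)) (\<sigma>(x := tp xs (int h - 1 - int j))) t
            (\<sigma>(x := tp xs (int h - 1 - int (Suc j))))"
      using big_Mv[of x "-1" "\<sigma>(x := tp xs (int h - 1 - int j))"]
      by (intro exI[of _ 1]) (simp add: algebra_simps)
  qed simp
  then obtain t where t: "t \<le> h * (1 + 2) + 1"
    "big (Loop x (\<lambda>s. s \<noteq> 0) (Mv x (-1))) (\<sigma>(x := tp xs (int h - 1))) t (\<sigma>(x := tp xs (- 1)))"
    by auto
  have "big (rewind x) \<sigma> (Suc (Suc 0 + Suc (t + Suc 0))) (\<sigma>(x := tp xs 0))"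
    unfolding rewind_def
    using big_Mv[of x "-1" \<sigma>] big_Mv[of x 1 "\<sigma>(x := tp xs (- 1))"] assms(1) t(2)
    by (intro big_Seq) (auto simp: algebra_simps)
  then show ?thesis using t(1) by (intro exI[of _ "Suc (Suc 0 + Suc (t + Suc 0))"]) auto
qed

lemma pex_rewind:
  assumes "pbd sz D h"
    and "\<And>i. i \<in> D \<Longrightarrow> S i x = tp (xs i) (int (h i)) \<and> h i \<le> length (xs i) \<and> 0 \<notin> set (xs i)"
    and "\<And>i. i \<in> D \<Longrightarrow> S' i = (S i)(x := tp (xs i) 0)"
  shows "pex sz D (rewind x) S S'"
proof (rule pexI)
  show "pbd sz D (\<lambda>i. 3 * h i + 5)" by (intro pbd_add pbd_mult pbd_const assms(1))
  fix i assume "i \<in> D"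
  then show "\<exists>t\<le>3 * h i + 5. big (rewind x) (S i) t (S' i)"
    using big_rewind[of "S i" x "xs i" "h i"] assms(2,3) by auto
qed

primrec repeat :: "nat \<Rightarrow> com \<Rightarrow> com" where
  "repeat 0 c = Skip"
| "repeat (Suc n) c = Seq c (repeat n c)"

lemma big_repeat:
  assumes "\<And>j. j < n \<Longrightarrow> \<exists>t \<le> tb. big c (S j) t (S (Suc j))"
  shows "\<exists>t \<le> n * (tb + 1). big (repeat n c) (S 0) t (S n)"
  using assms
proof (induction n arbitrary: S)
  case 0
  show ?case by (intro exI[of _ 0]) (simp add: big_Skip)
next
  case (Suc n)
  have "\<exists>t \<le> n * (tb + 1). big (repeat n c) (S (Suc 0)) t (S (Suc n))"
    using Suc.prems by (intro Suc.IH[of "\<lambda>j. S (Suc j)"]) auto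
  then obtain t2 where t2: "t2 \<le> n * (tb + 1)" "big (repeat n c) (S (Suc 0)) t2 (S (Suc n))" by blast
  obtain t1 where t1: "t1 \<le> tb" "big c (S 0) t1 (S (Suc 0))"
    using Suc.prems(1)[of 0] by auto
  show ?case using big_Seq[OF t1(2) t2(2)] t1(1) t2(1)
    by (intro exI[of _ "Suc (t1 + t2)"]) auto
qed

subsection \<open>Polynomially many iterations\<close>

text \<open>Horner's scheme, which is exactly the shape of nested loops: \<open>a\<close>
  executions, then \<open>l\<close> times the remaining levels.\<close>

primrec pval :: "nat list \<Rightarrow> nat \<Rightarrow> nat" where
  "pval [] l = 0"
| "pval (a # as) l = a + l * pval as l"

text \<open>Nested loops over the tapes from \<open>b\<close> on, each of which holds the argument of the polynomial in unary.\<close>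

primrec forpoly :: "nat list \<Rightarrow> nat \<Rightarrow> com \<Rightarrow> com" where
  "forpoly [] b c = Skip"
| "forpoly (a # as) b c = Seq (repeat a c)
     (Seq (Loop b (\<lambda>s. s \<noteq> 0) (Seq (forpoly as (Suc b) c) (Mv b 1))) (rewind b))"

primrec ftime :: "nat list \<Rightarrow> nat \<Rightarrow> nat \<Rightarrow> nat" where
  "ftime [] l tb = 0"
| "ftime (a # as) l tb = a * (tb + 1) + l * (ftime as l tb + 4) + 1 + (3 * l + 5) + 2"

lemma big_forpoly:
  assumes "vars c \<subseteq> {..<b}"
    and "\<And>j. j < pval as l \<Longrightarrow> \<exists>t \<le> tb. big c (S j) t (S (Suc j))"
    and "\<And>j x. b \<le> x \<Longrightarrow> x < b + length as \<Longrightarrow> S j x = tp (replicate l 1) 0"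
  shows "\<exists>t \<le> ftime as l tb. big (forpoly as b c) (S 0) t (S (pval as l))"
  using assms
proof (induction as arbitrary: b S)
  case Nil
  show ?case by (intro exI[of _ 0]) (simp add: big_Skip)
next
  case (Cons a as)
  let ?ones = "replicate l (1 :: nat)"
  define v where "v = pval as l"
  \<comment> \<open>The state after \<open>m\<close> rounds of the outermost loop: the body has run
    \<open>a + m * v\<close> times and the counter tape stands at \<open>m\<close>.\<close>
  define U where "U m = (S (a + m * v))(b := tp ?ones (int m))" for m
  have Sb: "S j b = tp ?ones 0" for j using Cons.prems(3)[of b j] by simp
  obtain t1 where t1: "t1 \<le> a * (tb + 1)" "big (repeat a c) (S 0) t1 (S a)"
    using big_repeat[of a tb c S] Cons.prems(2) by auto
  have "\<exists>t \<le> l * ((ftime as l tb + 2) + 2) + 1.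
      big (Loop b (\<lambda>s. s \<noteq> 0) (Seq (forpoly as (Suc b) c) (Mv b 1))) (U 0) t (U l)"
  proof (rule big_Loop_iter, intro conjI)
    fix m assume m: "m < l"
    show "scan (U m b) \<noteq> 0" using m by (simp add: U_def)
    \<comment> \<open>The executions that belong to round \<open>m\<close>, seen by the inner loops
      with the counter tape fixed at \<open>m\<close>.\<close>
    define S' where "S' j = (S (a + m * v + j))(b := tp ?ones (int m))" for j
    have "\<exists>t \<le> ftime as l tb. big (forpoly as (Suc b) c) (S' 0) t (S' (pval as l))"
    proof (rule Cons.IH)
      show "vars c \<subseteq> {..<Suc b}" using Cons.prems(1) by auto
      show "S' j x = tp ?ones 0" if "Suc b \<le> x" "x < Suc b + length as" for j x
        using that Cons.prems(3)[of x] by (simp add: S'_def)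
      fix j assume j: "j < pval as l"
      have "a + m * v + j < a + Suc m * v" using j by (simp add: v_def)
      also have "\<dots> \<le> a + l * v" using m by (intro add_left_mono mult_le_mono1) simp
      finally have "\<exists>t \<le> tb. big c (S (a + m * v + j)) t (S (Suc (a + m * v + j)))"
        by (intro Cons.prems(2)) (simp add: v_def)
      moreover have "b \<notin> vars c" using Cons.prems(1) by auto
      ultimately show "\<exists>t \<le> tb. big c (S' j) t (S' (Suc j))"
        unfolding S'_def by (auto intro: big_frame)
    qed
    then obtain t where t: "t \<le> ftime as l tb" "big (forpoly as (Suc b) c) (S' 0) t (S' v)"
      by (auto simp: v_def)
    have "big (Mv b 1) (S' v) (Suc 0) (U (Suc m))"
      using big_Mv[of b 1 "S' v"] by (simp add: S'_def U_def algebra_simps)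
    moreover have "S' 0 = U m" by (simp add: S'_def U_def)
    ultimately have "big (Seq (forpoly as (Suc b) c) (Mv b 1)) (U m) (Suc (t + Suc 0)) (U (Suc m))"
      using big_Seq t(2) by metis
    then show "\<exists>t\<le>ftime as l tb + 2. big (Seq (forpoly as (Suc b) c) (Mv b 1)) (U m) t (U (Suc m))"
      using t(1) by (intro exI[of _ "Suc (t + Suc 0)"]) auto
  next
    show "\<not> scan (U l b) \<noteq> 0" by (simp add: U_def)
  qed
  moreover have "U 0 = S a" using Sb[of a] by (auto simp: U_def)
  moreover have "l * ((ftime as l tb + 2) + 2) + 1 = l * (ftime as l tb + 4) + 1" by (simp add: algebra_simps)
  ultimately obtain t2 where t2: "t2 \<le> l * (ftime as l tb + 4) + 1"
    "big (Loop b (\<lambda>s. s \<noteq> 0) (Seq (forpoly as (Suc b) c) (Mv b 1))) (S a) t2 (U l)"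
    by metis
  have "(U l)(b := tp ?ones 0) = S (a + l * v)"
    using Sb[of "a + l * v"] by (auto simp: U_def)
  then obtain t3 where t3: "t3 \<le> 3 * l + 5" "big (rewind b) (U l) t3 (S (a + l * v))"
    using big_rewind[of "U l" b ?ones l] by (auto simp: U_def)
  show ?case using big_Seq[OF t1(2) big_Seq[OF t2(2) t3(2)]] t1(1) t2(1) t3(1)
    by (intro exI[of _ "Suc (t1 + Suc (t2 + t3))"]) (auto simp: v_def)
qed

lemma pbd_ftime: "pbd sz D l \<Longrightarrow> pbd sz D tb \<Longrightarrow> pbd sz D (\<lambda>i. ftime as (l i) (tb i))"
  by (induction as) (auto intro!: pbd_add pbd_mult)

lemma pex_forpoly:
  assumes "vars c \<subseteq> {..<b}"
    and body: "pex (\<lambda>(i, j). sz i) {(i, j). i \<in> D \<and> j < pval as (l i)} c (\<lambda>(i, j). S i j) (\<lambda>(i, j). S i (Suc j))"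
    and tps: "\<And>i j x. i \<in> D \<Longrightarrow> b \<le> x \<Longrightarrow> x < b + length as \<Longrightarrow> S i j x = tp (replicate (l i) 1) 0"
    and l: "pbd sz D l"
    and S0: "\<And>i. i \<in> D \<Longrightarrow> R i = S i 0" and Sn: "\<And>i. i \<in> D \<Longrightarrow> R' i = S i (pval as (l i))"
  shows "pex sz D (forpoly as b c) R R'"
proof -
  obtain A :: "nat poly" where A: "\<And>i j. i \<in> D \<Longrightarrow> j < pval as (l i) \<Longrightarrow>
      \<exists>t \<le> poly A (sz i). big c (S i j) t (S i (Suc j))"
    using body unfolding pex_def by fastforce
  show ?thesis
  proof (rule pexI)
    show "pbd sz D (\<lambda>i. ftime as (l i) (poly A (sz i)))"
      by (intro pbd_ftime l pbd_poly pbd_sz)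
    fix i assume i: "i \<in> D"
    have "\<exists>t \<le> ftime as (l i) (poly A (sz i)). big (forpoly as b c) (S i 0) t (S i (pval as (l i)))"
      using assms(1) A[OF i] tps[OF i] by (intro big_forpoly) auto
    then show "\<exists>t \<le> ftime as (l i) (poly A (sz i)). big (forpoly as b c) (R i) t (R' i)"
      using S0[OF i] Sn[OF i] by simp
  qed
qed

lemma pval_coeffs: "pval (coeffs P) l = poly P l" for P :: "nat poly"
proof -
  have "pval as l = horner_sum id l as" for as by (induction as) auto
  then show ?thesis by (simp add: poly_def)
qed

subsection \<open>Programs that append to a tape\<close>

text \<open>The quantification over \<open>ys\<close>, the string appended so far, makes the notion closed under composition.\<close>

definition emitter :: "('i \<Rightarrow> nat) \<Rightarrow> 'i set \<Rightarrow> nat \<Rightarrow> com \<Rightarrow> ('i \<Rightarrow> store) \<Rightarrow> ('i \<Rightarrow> nat list) \<Rightarrow> bool" where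
  "emitter sz D x c S ss \<longleftrightarrow> pex (\<lambda>(i, ys). sz i) (D \<times> UNIV) c
     (\<lambda>(i, ys). (S i)(x := app ys (S i x))) (\<lambda>(i, ys). (S i)(x := app (ys @ ss i) (S i x)))"

lemma emitter_pex:
  assumes "emitter sz D x c S ss" "\<And>i. i \<in> D \<Longrightarrow> S' i = (S i)(x := app (ss i) (S i x))"
  shows "pex sz D c S S'"
  by (rule pex_sub[OF assms(1)[unfolded emitter_def], where g = "\<lambda>i. (i, [])"]) (auto simp: assms(2))

lemma emitter_Skip: "(\<And>i. i \<in> D \<Longrightarrow> ss i = []) \<Longrightarrow> emitter sz D x Skip S ss"
  unfolding emitter_def by (rule pex_Skip) auto

lemma emitter_Seq:
  assumes "emitter sz D x c1 S s1" "emitter sz D x c2 S s2" "\<And>i. i \<in> D \<Longrightarrow> ss i = s1 i @ s2 i"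
  shows "emitter sz D x (Seq c1 c2) S ss"
  unfolding emitter_def
proof (rule pex_Seq)
  show "pex (\<lambda>(i, ys). sz i) (D \<times> UNIV) c1
     (\<lambda>(i, ys). (S i)(x := app ys (S i x))) (\<lambda>(i, ys). (S i)(x := app (ys @ s1 i) (S i x)))"
    using assms(1) unfolding emitter_def .
  show "pex (\<lambda>(i, ys). sz i) (D \<times> UNIV) c2
     (\<lambda>(i, ys). (S i)(x := app (ys @ s1 i) (S i x))) (\<lambda>(i, ys). (S i)(x := app (ys @ ss i) (S i x)))"
    by (rule pex_sub[OF assms(2)[unfolded emitter_def], where g = "\<lambda>(i, ys). (i, ys @ s1 i)"])
      (auto simp: assms(3))
qed

lemma emitter_cong:
  assumes "emitter sz D x c S ss" "\<And>i. i \<in> D \<Longrightarrow> ss i = ss' i"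
  shows "emitter sz D x c S ss'"
  using assms unfolding emitter_def by (auto intro: pex_cong)

primrec emit :: "nat \<Rightarrow> nat list \<Rightarrow> com" where
  "emit x [] = Skip"
| "emit x (s # ss) = Seq (Wr x s 1) (emit x ss)"

lemma emitter_Wr: "(\<And>i. i \<in> D \<Longrightarrow> ss i = [s]) \<Longrightarrow> emitter sz D x (Wr x s 1) S ss"
  unfolding emitter_def by (rule pex_Wr) auto

lemma emitter_emit: "(\<And>i. i \<in> D \<Longrightarrow> ss i = s) \<Longrightarrow> emitter sz D x (emit x s) S ss"
proof (induction s arbitrary: ss)
  case Nil
  then show ?case by (auto intro: emitter_Skip)
next
  case (Cons a s)
  then show ?case by (auto intro!: emitter_Seq[OF emitter_Wr[of D "\<lambda>_. [a]"] Cons.IH[of "\<lambda>_. s"]])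
qed

lemma emitter_switch:
  assumes "\<And>i. i \<in> D \<Longrightarrow> scan (S i y) \<le> n" "y \<noteq> x"
    and "\<And>s. s \<le> n \<Longrightarrow> emitter sz {i \<in> D. scan (S i y) = s} x (f s) S ss"
  shows "emitter sz D x (switch y n f) S ss"
  unfolding emitter_def
proof (rule pex_switch)
  show "scan ((case i of (i, ys) \<Rightarrow> (S i)(x := app ys (S i x))) y) \<le> n" if "i \<in> D \<times> UNIV" for i
    using that assms(1,2) by auto
  fix s assume s: "s \<le> n"
  have "{i \<in> D \<times> UNIV. scan ((case i of (i, ys) \<Rightarrow> (S i)(x := app ys (S i x))) y) = s}
      = {i \<in> D. scan (S i y) = s} \<times> UNIV"
    using assms(2) by auto
  then show "pex (\<lambda>(i, ys). sz i) {i \<in> D \<times> UNIV. scan ((case i of (i, ys) \<Rightarrow> (S i)(x := app ys (S i x))) y) = s}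
     (f s) (\<lambda>(i, ys). (S i)(x := app ys (S i x))) (\<lambda>(i, ys). (S i)(x := app (ys @ ss i) (S i x)))"
    using assms(3)[OF s] unfolding emitter_def by simp
qed

text \<open>In contrast to a plain emitter, round \<open>j\<close> may append its own string and
  change the rest of the store; a head that moves on in each round needs this.\<close>

lemma emitter_forpoly_family:
  assumes v: "vars c \<subseteq> {..<b}" "x < b"
    and body: "pex (\<lambda>((i, j), ys). sz i) ({(i, j). i \<in> D \<and> j < pval as (l i)} \<times> UNIV) c
      (\<lambda>((i, j), ys). (S i j)(x := app ys (S i 0 x))) (\<lambda>((i, j), ys). (S i (Suc j))(x := app (ys @ ss i j) (S i 0 x)))"
    and tps: "\<And>i j x. i \<in> D \<Longrightarrow> b \<le> x \<Longrightarrow> x < b + length as \<Longrightarrow> S i j x = tp (replicate (l i) 1) 0"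
    and l: "pbd sz D l"
    and R: "\<And>i ys. i \<in> D \<Longrightarrow> R (i, ys) = (S i 0)(x := app ys (S i 0 x))"
    and R': "\<And>i ys. i \<in> D \<Longrightarrow> R' (i, ys) =
      (S i (pval as (l i)))(x := app (ys @ concat (map (ss i) [0..<pval as (l i)])) (S i 0 x))"
  shows "pex (\<lambda>(i, ys). sz i) (D \<times> UNIV) (forpoly as b c) R R'"
proof (rule pex_forpoly[where l = "l \<circ> fst" and
      S = "\<lambda>(i, ys) j. (S i j)(x := app (ys @ concat (map (ss i) [0..<j])) (S i 0 x))"])
  show "vars c \<subseteq> {..<b}" by fact
  show "pex (\<lambda>(i, j). case i of (i, ys) \<Rightarrow> sz i) {(i, j). i \<in> D \<times> UNIV \<and> j < pval as ((l \<circ> fst) i)} c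
     (\<lambda>(i, j). (\<lambda>(i, ys) j. (S i j)(x := app (ys @ concat (map (ss i) [0..<j])) (S i 0 x))) i j)
     (\<lambda>(i, j). (\<lambda>(i, ys) j. (S i j)(x := app (ys @ concat (map (ss i) [0..<j])) (S i 0 x))) i (Suc j))"
    by (rule pex_sub[OF body, where g = "\<lambda>((i, ys), j). ((i, j), ys @ concat (map (ss i) [0..<j]))"]) auto
  show "(case i of (i, ys) \<Rightarrow> \<lambda>j. (S i j)(x := app (ys @ concat (map (ss i) [0..<j])) (S i 0 x))) j xa
      = tp (replicate ((l \<circ> fst) i) 1) 0"
    if "i \<in> D \<times> UNIV" "b \<le> xa" "xa < b + length as" for i j xa
    using that tps v(2) by auto
  show "pbd (\<lambda>(i, ys). sz i) (D \<times> UNIV) (l \<circ> fst)"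
    using l unfolding pbd_def by fastforce
qed (auto simp: R R')

lemma emitter_forpoly:
  assumes v: "vars c \<subseteq> {..<b}" "x < b"
    and body: "emitter sz D x c S s"
    and tps: "\<And>i x. i \<in> D \<Longrightarrow> b \<le> x \<Longrightarrow> x < b + length as \<Longrightarrow> S i x = tp (replicate (l i) 1) 0"
    and l: "pbd sz D l"
    and ss: "\<And>i. i \<in> D \<Longrightarrow> ss i = concat (replicate (pval as (l i)) (s i))"
  shows "emitter sz D x (forpoly as b c) S ss"
  unfolding emitter_def
proof (rule emitter_forpoly_family[OF v _ _ l, where S = "\<lambda>i j. S i" and ss = "\<lambda>i j. s i"])
  show "pex (\<lambda>((i, j), ys). sz i) ({(i, j). i \<in> D \<and> j < pval as (l i)} \<times> UNIV) c
     (\<lambda>((i, j), ys). (S i)(x := app ys (S i x))) (\<lambda>((i, j), ys). (S i)(x := app (ys @ s i) (S i x)))"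
    by (rule pex_sub[OF body[unfolded emitter_def], where g = "\<lambda>((i, j), ys). (i, ys)"]) auto
qed (use tps in \<open>auto simp: ss map_replicate_const\<close>)

definition foreach :: "nat \<Rightarrow> com \<Rightarrow> com" where
  "foreach y c = Seq (Loop y (\<lambda>s. s \<noteq> 0) (Seq c (Mv y 1))) (rewind y)"

lemma emitter_foreach:
  assumes yx: "y \<noteq> x"
    and body: "pex (\<lambda>((i, j), ys). sz i) ({(i, j). i \<in> D \<and> j < length (xs i)} \<times> UNIV) c
      (\<lambda>((i, j), ys). (S i)(y := tp (xs i) (int j), x := app ys (S i x)))
      (\<lambda>((i, j), ys). (S i)(y := tp (xs i) (int j), x := app (ys @ ss i j) (S i x)))"
    and S: "\<And>i. i \<in> D \<Longrightarrow> S i y = tp (xs i) 0 \<and> 0 \<notin> set (xs i)"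
    and len: "pbd sz D (\<lambda>i. length (xs i))"
    and s: "\<And>i. i \<in> D \<Longrightarrow> s i = concat (map (ss i) [0..<length (xs i)])"
  shows "emitter sz D x (foreach y c) S s"
  unfolding emitter_def foreach_def
proof (rule pex_Seq)
  let ?U = "\<lambda>(i, ys) j. (S i)(y := tp (xs i) (int j), x := app (ys @ concat (map (ss i) [0..<j])) (S i x))"
  have len': "pbd (\<lambda>(i, ys). sz i) (D \<times> UNIV) (\<lambda>(i, ys). length (xs i))"
    using len unfolding pbd_def by fastforce
  show "pex (\<lambda>(i, ys). sz i) (D \<times> UNIV) (Loop y (\<lambda>s. s \<noteq> 0) (Seq c (Mv y 1)))
     (\<lambda>(i, ys). (S i)(x := app ys (S i x))) (\<lambda>(i, ys). ?U (i, ys) (length (xs i)))"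
  proof (rule pex_Loop[where S = ?U and n = "\<lambda>(i, ys). length (xs i)"])
    show "pex (\<lambda>(i, j). case i of (i, ys) \<Rightarrow> sz i) {(i, j). i \<in> D \<times> UNIV \<and> j < (case i of (i, ys) \<Rightarrow> length (xs i))}
       (Seq c (Mv y 1)) (\<lambda>(i, j). ?U i j) (\<lambda>(i, j). ?U i (Suc j))"
    proof (rule pex_Seq)
      let ?V = "\<lambda>((i, ys), j). (S i)(y := tp (xs i) (int j), x := app (ys @ concat (map (ss i) [0..<Suc j])) (S i x))"
      show "pex (\<lambda>(i, j). case i of (i, ys) \<Rightarrow> sz i) {(i, j). i \<in> D \<times> UNIV \<and> j < (case i of (i, ys) \<Rightarrow> length (xs i))}
        c (\<lambda>(i, j). ?U i j) ?V"
        by (rule pex_sub[OF body, where g = "\<lambda>((i, ys), j). ((i, j), ys @ concat (map (ss i) [0..<j]))"]) auto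
      show "pex (\<lambda>(i, j). case i of (i, ys) \<Rightarrow> sz i) {(i, j). i \<in> D \<times> UNIV \<and> j < (case i of (i, ys) \<Rightarrow> length (xs i))}
        (Mv y 1) ?V (\<lambda>(i, j). ?U i (Suc j))"
        by (rule pex_Mv) (use yx in \<open>auto simp: fun_upd_twist add.commute\<close>)
    qed
    show "pbd (\<lambda>(i, ys). sz i) (D \<times> UNIV) (\<lambda>(i, ys). length (xs i))" by (rule len')
    show "scan (?U i j y) \<noteq> 0" if "i \<in> D \<times> UNIV" "j < (case i of (i, ys) \<Rightarrow> length (xs i))" for i j
      using that S yx by (auto simp: in_set_conv_nth split: prod.splits)
    show "\<not> scan (?U i (case i of (i, ys) \<Rightarrow> length (xs i)) y) \<noteq> 0" if "i \<in> D \<times> UNIV" for i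
      using that yx by (auto split: prod.splits)
  qed (use S yx in \<open>auto simp: fun_eq_iff\<close>)
  show "pex (\<lambda>(i, ys). sz i) (D \<times> UNIV) (rewind y) (\<lambda>(i, ys). ?U (i, ys) (length (xs i)))
     (\<lambda>(i, ys). (S i)(x := app (ys @ s i) (S i x)))"
    by (rule pex_rewind[OF len', where xs = "\<lambda>(i, ys). xs i"]) (use S yx s in \<open>auto simp: fun_eq_iff\<close>)
qed

lemma concat_map_nth: "concat (map (\<lambda>j. f (xs ! j)) [0..<length xs]) = concat (map f xs)"
  by (metis map_map[unfolded comp_def] map_nth)

lemma emitter_foreach_sym:
  assumes yx: "y \<noteq> x"
    and S: "\<And>i. i \<in> D \<Longrightarrow> S i y = tp (xs i) 0 \<and> 0 \<notin> set (xs i) \<and> set (xs i) \<subseteq> {..n}"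
    and len: "pbd sz D (\<lambda>i. length (xs i))"
    and s: "\<And>i. i \<in> D \<Longrightarrow> s i = concat (map f (xs i))"
  shows "emitter sz D x (foreach y (switch y n (\<lambda>a. emit x (f a)))) S s"
proof (rule emitter_foreach[OF yx _ _ len, where ss = "\<lambda>i j. f (xs i ! j)"])
  let ?D = "{(i, j). i \<in> D \<and> j < length (xs i)}"
  have "emitter (\<lambda>(i, j). sz i) ?D x (switch y n (\<lambda>a. emit x (f a)))
     (\<lambda>(i, j). (S i)(y := tp (xs i) (int j))) (\<lambda>(i, j). f (xs i ! j))"
  proof (rule emitter_switch)
    show "scan ((case i of (i, j) \<Rightarrow> (S i)(y := tp (xs i) (int j))) y) \<le> n" if "i \<in> ?D" for i
      using that S by (fastforce simp: subset_iff)
  qed (auto intro!: emitter_emit yx)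
  then show "pex (\<lambda>((i, j), ys). sz i) (?D \<times> UNIV) (switch y n (\<lambda>a. emit x (f a)))
     (\<lambda>((i, j), ys). (S i)(y := tp (xs i) (int j), x := app ys (S i x)))
     (\<lambda>((i, j), ys). (S i)(y := tp (xs i) (int j), x := app (ys @ f (xs i ! j)) (S i x)))"
    unfolding emitter_def using yx by (elim pex_sub[where g = id]) auto
qed (use S in \<open>auto simp: s concat_map_nth\<close>)

subsection \<open>A binary counter\<close>

definition inc :: "nat \<Rightarrow> com" where
  "inc x = Seq (Loop x (\<lambda>s. s = 2) (Wr x 1 1)) (Seq (Wr x 2 1) (rewind x))"

lemma bits_0 [simp]: "bits_of_nat 0 = []"
  by (simp add: bits_of_nat.simps)

lemma bits_pos: "n > 0 \<Longrightarrow> bits_of_nat n = odd n # bits_of_nat (n div 2)"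
  by (subst bits_of_nat.simps) simp

text \<open>The carry runs through the leading block of True digits and then turns a False into True
  or creates a new digit; \<open>tl xs\<close> covers both cases, as
  \<open>tl [] = []\<close>.\<close>

lemma bits_Suc: "\<exists>r xs. bits_of_nat n = replicate r True @ xs \<and> (xs \<noteq> [] \<longrightarrow> \<not> hd xs) \<and>
    bits_of_nat (Suc n) = replicate r False @ True # tl xs"
proof (induction n rule: less_induct)
  case (less n)
  show ?case
  proof (cases "n = 0")
    case True
    then show ?thesis by (intro exI[of _ 0] exI[of _ "[]"]) (simp add: bits_pos)
  next
    case n: False
    show ?thesis
    proof (cases "even n")
      case True
      then show ?thesis using n
        by (intro exI[of _ 0] exI[of _ "bits_of_nat n"]) (simp add: bits_pos)
    next
      case False
      then have "n div 2 < n" using n by simp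
      from less.IH[OF this] obtain r xs where
        "bits_of_nat (n div 2) = replicate r True @ xs" "xs \<noteq> [] \<longrightarrow> \<not> hd xs"
        "bits_of_nat (Suc (n div 2)) = replicate r False @ True # tl xs" by blast
      then show ?thesis using n False
        by (intro exI[of _ "Suc r"] exI[of _ xs]) (simp add: bits_pos)
    qed
  qed
qed

lemma length_bits: "length (bits_of_nat n) \<le> n"
proof (induction n rule: less_induct)
  case (less n)
  show ?case
  proof (cases "n = 0")
    case False
    then have "length (bits_of_nat (n div 2)) \<le> n div 2" by (intro less.IH) simp
    then show ?thesis using False by (simp add: bits_pos)
  qed simp
qed

lemma big_inc:
  assumes "\<sigma> x = tp (map bsym (bits_of_nat n)) 0"
  shows "\<exists>t \<le> 6 * n + 12. big (inc x) \<sigma> t (\<sigma>(x := tp (map bsym (bits_of_nat (Suc n))) 0))"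
proof -
  obtain r xs where r: "bits_of_nat n = replicate r True @ xs" "xs \<noteq> [] \<Longrightarrow> \<not> hd xs"
    "bits_of_nat (Suc n) = replicate r False @ True # tl xs" using bits_Suc[of n] by blast
  have rn: "r \<le> n" using length_bits[of n] r(1) by simp
  define U where "U j = \<sigma>(x := tp (replicate j 1 @ replicate (r - j) 2 @ map bsym xs) (int j))" for j
  have U0: "U 0 = \<sigma>" using assms r(1) by (auto simp: U_def)
  have "\<exists>t \<le> r * (1 + 2) + 1. big (Loop x (\<lambda>s. s = 2) (Wr x 1 1)) (U 0) t (U r)"
  proof (rule big_Loop_iter, intro conjI)
    fix j assume j: "j < r"
    then obtain m where m: "r - j = Suc m" "r - Suc j = m" by (metis Suc_diff_Suc)
    show "scan (U j x) = 2" using j by (simp add: U_def nth_append)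
    have "act (1, 1) (tp (replicate j 1 @ 2 # (replicate m 2 @ map bsym xs)) (int (length (replicate j (1::nat))))) =
       tp (replicate j 1 @ 1 # (replicate m 2 @ map bsym xs)) (int (length (replicate j (1::nat))) + 1)"
      by (rule act_tp_mid)
    then have "(U j)(x := act (1, 1) (U j x)) = U (Suc j)"
      using m by (simp add: U_def add.commute replicate_app_Cons_same)
    then show "\<exists>t\<le>1. big (Wr x 1 1) (U j) t (U (Suc j))"
      using big_Wr[of x 1 1 "U j"] by auto
  next
    show "scan (U r x) \<noteq> 2" using r(2) by (cases xs) (auto simp: U_def nth_append bsym_def)
  qed
  moreover have "r * (1 + 2) + 1 = 3 * r + 1" by simp
  ultimately obtain t where t: "t \<le> 3 * r + 1" "big (Loop x (\<lambda>s. s = 2) (Wr x 1 1)) \<sigma> t (U r)"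
    using U0 by metis
  let ?ys = "map bsym (bits_of_nat (Suc n))"
  have ys: "?ys = replicate r 1 @ 2 # map bsym (tl xs)" using r(3) by simp
  have "act (2, 1) (U r x) = tp ?ys (int r + 1)"
  proof (cases xs)
    case Nil
    then show ?thesis using act_tp_end[of 2 1 "replicate r 1"] by (simp add: U_def ys)
  next
    case (Cons a as)
    then show ?thesis using act_tp_mid[of 2 1 "replicate r 1" "bsym a" "map bsym as"] by (simp add: U_def ys)
  qed
  then have W: "big (Wr x 2 1) (U r) (Suc 0) (\<sigma>(x := tp ?ys (int (r + 1))))"
    using big_Wr[of x 2 1 "U r"] by (simp add: U_def add.commute)
  have "\<exists>t \<le> 3 * (r + 1) + 5. big (rewind x) (\<sigma>(x := tp ?ys (int (r + 1)))) t
      ((\<sigma>(x := tp ?ys (int (r + 1))))(x := tp ?ys 0))"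
    by (rule big_rewind) (auto simp: ys bsym_def)
  then obtain t' where t': "t' \<le> 3 * (r + 1) + 5"
    "big (rewind x) (\<sigma>(x := tp ?ys (int (r + 1)))) t' (\<sigma>(x := tp ?ys 0))" by auto
  have "big (inc x) \<sigma> (Suc (t + Suc (Suc 0 + t'))) (\<sigma>(x := tp ?ys 0))"
    unfolding inc_def using t(2) W t'(2) by (intro big_Seq)
  then show ?thesis using t(1) t'(1) rn by (intro exI[of _ "Suc (t + Suc (Suc 0 + t'))"]) auto
qed

subsection \<open>Computations as tilings\<close>

text \<open>Each row of the tiling but the first describes one step of a computation; the vertical colours between
  two rows give a configuration. The colour of a horizontal edge holds the scanned symbols and the heads that
  cross this edge to the right and to the left. The first row guesses the certificate: its horizontal colours \<open>HI0\<close>,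
  \<open>HI1\<close>, \<open>HI2\<close> occur before the input, up to the end of the certificate, and behind it. \<open>VAcc\<close> may be chosen above
  the origin cell of an accepting configuration, and \<open>VFin\<close> is a requirement on a single cell of the last row.\<close>

datatype hcol = HW | HI0 | HI1 | HI2 | HR "nat list" "bool list" "bool list"
datatype vcol = VL | VB | VI bool | VG | VR | VC nat "nat list" "bool list" | VAcc | VFin

datatype tile = Tile (west: hcol) (east: hcol) (south: vcol) (north: vcol)

text \<open>Halted configurations repeat themselves, so that a tableau of fixed height fits runs of
  every shorter length.\<close>

definition delta' :: "tm \<Rightarrow> nat \<Rightarrow> nat list \<Rightarrow> nat \<times> (nat \<times> int) list" where
  "delta' M q ss = (if q = halt_state then (q, map (\<lambda>s. (s, 0)) ss) else delta M q ss)"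

lemma step_delta':
  "step None M (q, ts) = (fst (delta' M q (map scan ts)), map2 act (snd (delta' M q (map scan ts))) ts)"
proof (cases "q = halt_state")
  case True
  have "map2 act (map (\<lambda>s. (s, 0)) (map scan ts)) ts = ts"
    by (rule nth_equalityI) (auto simp: act_def scan_def)
  then show ?thesis using True by (simp add: step_def delta'_def)
qed (auto simp: step_def delta'_def split: prod.splits)

text \<open>The tile of a cell with contents \<open>s\<close> and heads \<open>h\<close>, when heads \<open>l\<close> and \<open>r\<close> enter from
  the left and from the right.\<close>

definition run_tile :: "tm \<Rightarrow> nat \<Rightarrow> nat list \<Rightarrow> nat list \<Rightarrow> bool list \<Rightarrow> bool list \<Rightarrow> bool list \<Rightarrow> tile" where
  "run_tile M q ss s h l r = (let k = tapes M; d = (\<lambda>j. snd (snd (delta' M q ss) ! j)) in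
     Tile (HR ss l (map (\<lambda>j. h ! j \<and> d j = -1) [0..<k]))
       (HR ss (map (\<lambda>j. h ! j \<and> d j = 1) [0..<k]) r)
       (VC q s h)
       (VC (fst (delta' M q ss))
         (map (\<lambda>j. if h ! j then fst (snd (delta' M q ss) ! j) else s ! j) [0..<k])
         (map (\<lambda>j. h ! j \<and> d j = 0 \<or> l ! j \<or> r ! j) [0..<k])))"

definition acc_tile :: "tile \<Rightarrow> tile" where
  "acc_tile x = Tile (west x) (east x) (south x) VAcc"

text \<open>All heads start in the origin cell, so one flag serves for all tapes.\<close>

definition init_cell :: "tm \<Rightarrow> nat \<Rightarrow> bool \<Rightarrow> vcol" where
  "init_cell M s h = VC start_state (s # replicate (tapes M - 1) 0) (replicate (tapes M) h)"

definition sym_lists :: "tm \<Rightarrow> nat list set" where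
  "sym_lists M = {ss. set ss \<subseteq> {..<symbols M} \<and> length ss = tapes M}"

definition flag_lists :: "tm \<Rightarrow> bool list set" where
  "flag_lists M = {hs. set hs \<subseteq> UNIV \<and> length hs = tapes M}"

definition still :: "tm \<Rightarrow> nat list \<Rightarrow> hcol" where
  "still M ss = HR ss (replicate (tapes M) False) (replicate (tapes M) False)"

text \<open>The symbols \<open>ss\<close> are a guess that the horizontal colours carry along the
  whole row. A cell checks only the components of the heads that it holds; together the cells check
  all of them.\<close>

definition run_tiles :: "tm \<Rightarrow> tile set" where
  "run_tiles M = {run_tile M q ss s h l r | q ss s h l r. q < states M \<and> ss \<in> sym_lists M \<and> s \<in> sym_lists M \<and>
     h \<in> flag_lists M \<and> l \<in> flag_lists M \<and> r \<in> flag_lists M \<and> (\<forall>j<tapes M. h ! j \<longrightarrow> s ! j = ss ! j)}"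

text \<open>From west to east the first row is run by a finite automaton. The heads are placed at
  the step from \<open>HI0\<close> to \<open>HI1\<close>, on the first bit of the input, and the
  certificate ends at the step from \<open>HI1\<close> to \<open>HI2\<close>; if all
  \<open>VG\<close> cells hold bits, the following \<open>VB\<close> cell makes this step.\<close>

definition tiles :: "tm \<Rightarrow> tile set" where
  "tiles M =
     {Tile HW HI0 VL VL} \<union> (\<lambda>ss. Tile HW (still M ss) VL VL) ` sym_lists M \<union>
     {Tile HI2 HW VR VR} \<union> (\<lambda>ss. Tile (still M ss) HW VR VR) ` sym_lists M \<union>
     {Tile HI0 HI0 VB (init_cell M 0 False), Tile HI1 HI2 VB (init_cell M 0 False),
      Tile HI2 HI2 VB (init_cell M 0 False), Tile HI1 HI2 VG (init_cell M 0 False),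
      Tile HI2 HI2 VG (init_cell M 0 False)} \<union>
     (\<lambda>b. Tile HI0 HI1 (VI b) (init_cell M (bsym b) True)) ` UNIV \<union>
     (\<lambda>b. Tile HI1 HI1 (VI b) (init_cell M (bsym b) False)) ` UNIV \<union>
     (\<lambda>b. Tile HI1 HI1 VG (init_cell M (bsym b) False)) ` UNIV \<union>
     run_tiles M \<union> acc_tile ` {x \<in> run_tiles M. \<exists>s h. south x = VC halt_state s h \<and> s ! 0 = 2} \<union>
     (\<lambda>ss. Tile (still M ss) (still M ss) VFin VL) ` sym_lists M"

lemma finite_tiles: "finite (tiles M)"
proof -
  have s: "finite (sym_lists M)" unfolding sym_lists_def by (rule finite_lists_length_eq) simp
  have f: "finite (flag_lists M)" unfolding flag_lists_def by (rule finite_lists_length_eq) simp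
  have "run_tiles M \<subseteq> (\<lambda>(q, ss, s, h, l, r). run_tile M q ss s h l r) `
      ({..<states M} \<times> sym_lists M \<times> sym_lists M \<times> flag_lists M \<times> flag_lists M \<times> flag_lists M)"
  proof
    fix x assume "x \<in> run_tiles M"
    then obtain q ss s h l r where "x = run_tile M q ss s h l r" "q < states M" "ss \<in> sym_lists M"
      "s \<in> sym_lists M" "h \<in> flag_lists M" "l \<in> flag_lists M" "r \<in> flag_lists M"
      unfolding run_tiles_def by blast
    then show "x \<in> (\<lambda>(q, ss, s, h, l, r). run_tile M q ss s h l r) `
      ({..<states M} \<times> sym_lists M \<times> sym_lists M \<times> flag_lists M \<times> flag_lists M \<times> flag_lists M)"
      by (intro image_eqI[of _ _ "(q, ss, s, h, l, r)"]) simp_all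
  qed
  then have "finite (run_tiles M)" by (rule finite_subset) (intro finite_imageI finite_cartesian_product s f finite_lessThan)
  then show ?thesis unfolding tiles_def using s by simp
qed

lemma run_tile_simps [simp]: "south (run_tile M q ss s h l r) = VC q s h"
  by (simp add: run_tile_def Let_def)

lemma run_tiles_in: "y \<in> run_tiles M \<Longrightarrow> y \<in> tiles M"
  by (simp add: tiles_def)

lemma acc_tile_in:
  assumes "y \<in> run_tiles M" "south y = VC halt_state s h" "s ! 0 = 2"
  shows "acc_tile y \<in> tiles M"
proof -
  have "acc_tile y \<in> acc_tile ` {x \<in> run_tiles M. \<exists>s h. south x = VC halt_state s h \<and> s ! 0 = 2}"
    using assms by (intro imageI) auto
  then show ?thesis by (simp add: tiles_def)
qed

lemma tiles_south_VC:
  assumes "x \<in> tiles M" "south x = VC q s h"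
  obtains y where "y \<in> run_tiles M" "west x = west y" "east x = east y" "south y = VC q s h"
    "north x = north y \<or> north x = VAcc \<and> q = halt_state \<and> s ! 0 = 2"
proof -
  have "x \<in> run_tiles M \<or> x \<in> acc_tile ` {x \<in> run_tiles M. \<exists>s h. south x = VC halt_state s h \<and> s ! 0 = 2}"
    using assms by (auto simp: tiles_def)
  then show ?thesis
  proof
    assume "x \<in> acc_tile ` {x \<in> run_tiles M. \<exists>s h. south x = VC halt_state s h \<and> s ! 0 = 2}"
    then obtain y where "y \<in> run_tiles M" "\<exists>s h. south y = VC halt_state s h \<and> s ! 0 = 2" "x = acc_tile y" by blast
    then show ?thesis using assms(2) that[of y] by (auto simp: acc_tile_def)
  qed (use assms(2) that in blast)
qed

lemma run_tiles_south: "y \<in> run_tiles M \<Longrightarrow> \<exists>q s h. south y = VC q s h"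
  by (auto simp: run_tiles_def)

lemma tiles_south_not_VAcc: "x \<in> tiles M \<Longrightarrow> south x \<noteq> VAcc"
  by (auto simp: tiles_def acc_tile_def init_cell_def dest: run_tiles_south)

lemma tiles_north_not_VFin: "x \<in> tiles M \<Longrightarrow> north x \<noteq> VFin"
  by (auto simp: tiles_def acc_tile_def init_cell_def run_tiles_def run_tile_def Let_def)

section \<open>Rows of the tiling as steps of the machine\<close>

definition conf_col :: "config \<Rightarrow> int \<Rightarrow> vcol" where
  "conf_col cfg z = VC (fst cfg) (map (\<lambda>t. fst t z) (snd cfg)) (map (\<lambda>t. snd t = z) (snd cfg))"

definition conf_tile :: "tm \<Rightarrow> config \<Rightarrow> int \<Rightarrow> tile" where
  "conf_tile M cfg z = (let ts = snd cfg; ss = map scan ts; d = (\<lambda>j. snd (snd (delta' M (fst cfg) ss) ! j)) in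
     run_tile M (fst cfg) ss (map (\<lambda>t. fst t z) ts) (map (\<lambda>t. snd t = z) ts)
       (map (\<lambda>j. snd (ts ! j) = z - 1 \<and> d j = 1) [0..<tapes M])
       (map (\<lambda>j. snd (ts ! j) = z + 1 \<and> d j = -1) [0..<tapes M]))"

definition wf_conf :: "tm \<Rightarrow> config \<Rightarrow> bool" where
  "wf_conf M cfg \<longleftrightarrow> fst cfg < states M \<and> length (snd cfg) = tapes M \<and> (\<forall>t\<in>set (snd cfg). \<forall>z. fst t z < symbols M)"

lemma south_conf_tile: "south (conf_tile M cfg z) = conf_col cfg z"
  by (simp add: conf_tile_def conf_col_def Let_def)

lemma east_conf_tile: "length (snd cfg) = tapes M \<Longrightarrow> east (conf_tile M cfg z) = west (conf_tile M cfg (z + 1))"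
  by (auto simp: conf_tile_def run_tile_def Let_def)

lemma wf_delta':
  assumes "wf_tm M" "q < states M" "ss \<in> sym_lists M"
  shows "fst (delta' M q ss) < states M" "length (snd (delta' M q ss)) = tapes M"
    "\<And>j. j < tapes M \<Longrightarrow> fst (snd (delta' M q ss) ! j) < symbols M \<and> snd (snd (delta' M q ss) ! j) \<in> {-1, 0, 1}"
proof -
  obtain q' as where da: "delta' M q ss = (q', as)" by fastforce
  have "q' < states M \<and> length as = tapes M \<and> (\<forall>(s, d) \<in> set as. s < symbols M \<and> d \<in> {-1, 0, 1})"
  proof (cases "q = halt_state")
    case True
    then show ?thesis using da assms(2,3) by (auto simp: delta'_def sym_lists_def)
  next
    case False
    then show ?thesis using da assms unfolding wf_tm_def delta'_def sym_lists_def by fastforce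
  qed
  then have a: "q' < states M" "length as = tapes M" "\<And>x. x \<in> set as \<Longrightarrow> fst x < symbols M \<and> snd x \<in> {-1, 0, 1}"
    by auto
  show "fst (delta' M q ss) < states M" "length (snd (delta' M q ss)) = tapes M" using a da by auto
  show "fst (snd (delta' M q ss) ! j) < symbols M \<and> snd (snd (delta' M q ss) ! j) \<in> {-1, 0, 1}"
    if "j < tapes M" for j
    using a(3)[of "as ! j"] that a(2) da by simp
qed

lemma scan_sym_lists: "wf_conf M cfg \<Longrightarrow> map scan (snd cfg) \<in> sym_lists M"
  by (auto simp: wf_conf_def sym_lists_def scan_def)

lemma wf_conf_step:
  assumes "wf_tm M" "wf_conf M cfg"
  shows "wf_conf M (step None M cfg)"
proof -
  obtain q ts where c: "cfg = (q, ts)" by fastforce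
  have q: "q < states M" "length ts = tapes M" using assms(2) by (auto simp: wf_conf_def c)
  note d = wf_delta'[OF assms(1) q(1), of "map scan ts"]
  have ss: "map scan ts \<in> sym_lists M" using scan_sym_lists[OF assms(2)] c by simp
  show ?thesis unfolding c step_delta' wf_conf_def
  proof (intro conjI ballI allI)
    fix t z assume "t \<in> set (snd (fst (delta' M q (map scan ts)), map2 act (snd (delta' M q (map scan ts))) ts))"
    then obtain j where j: "j < tapes M" "t = act (snd (delta' M q (map scan ts)) ! j) (ts ! j)"
      using q d(2)[OF ss] by (auto simp: set_zip)
    have "fst (ts ! j) z < symbols M" using assms(2) c j q by (auto simp: wf_conf_def)
    then show "fst t z < symbols M" using j d(3)[OF ss] by (auto simp: act_def)
  qed (use d[OF ss] q in auto)
qed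

text \<open>After the step a head is in cell \<open>z\<close> if it was there and stayed, came from
  \<open>z - 1\<close> by moving right, or came from \<open>z + 1\<close> by moving left.\<close>

lemma north_conf_tile:
  assumes "wf_tm M" "wf_conf M cfg"
  shows "north (conf_tile M cfg z) = conf_col (step None M cfg) z"
proof -
  obtain q ts where c: "cfg = (q, ts)" by fastforce
  have q: "q < states M" "length ts = tapes M" using assms(2) by (auto simp: wf_conf_def c)
  have ss: "map scan ts \<in> sym_lists M" using scan_sym_lists[OF assms(2)] c by simp
  note d = wf_delta'[OF assms(1) q(1) ss]
  define as where "as = snd (delta' M q (map scan ts))"
  have d3: "snd (as ! j) \<in> {-1, 0, 1}" if "j < tapes M" for j using d(3)[OF that] by (simp add: as_def)
  have las: "length as = tapes M" using d(2) by (simp add: as_def)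
  have 1: "map (\<lambda>j. if map (\<lambda>t. snd t = z) ts ! j then fst (as ! j) else map (\<lambda>t. fst t z) ts ! j) [0..<tapes M]
     = map (\<lambda>t. fst t z) (map2 act as ts)"
    using q las by (intro nth_equalityI) (auto simp: act_def)
  have 2: "map (\<lambda>j. map (\<lambda>t. snd t = z) ts ! j \<and> snd (as ! j) = 0 \<or>
      map (\<lambda>j. snd (ts ! j) = z - 1 \<and> snd (as ! j) = 1) [0..<tapes M] ! j \<or>
      map (\<lambda>j. snd (ts ! j) = z + 1 \<and> snd (as ! j) = -1) [0..<tapes M] ! j) [0..<tapes M]
     = map (\<lambda>t. snd t = z) (map2 act as ts)"
  proof (intro nth_equalityI)
    fix j assume "j < length (map (\<lambda>j. map (\<lambda>t. snd t = z) ts ! j \<and> snd (as ! j) = 0 \<or>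
      map (\<lambda>j. snd (ts ! j) = z - 1 \<and> snd (as ! j) = 1) [0..<tapes M] ! j \<or>
      map (\<lambda>j. snd (ts ! j) = z + 1 \<and> snd (as ! j) = -1) [0..<tapes M] ! j) [0..<tapes M])"
    then have j: "j < tapes M" by simp
    from d3[OF j] show "map (\<lambda>j. map (\<lambda>t. snd t = z) ts ! j \<and> snd (as ! j) = 0 \<or>
      map (\<lambda>j. snd (ts ! j) = z - 1 \<and> snd (as ! j) = 1) [0..<tapes M] ! j \<or>
      map (\<lambda>j. snd (ts ! j) = z + 1 \<and> snd (as ! j) = -1) [0..<tapes M] ! j) [0..<tapes M] ! j
     = map (\<lambda>t. snd t = z) (map2 act as ts) ! j"
      using q las j by (auto simp: act_def)
  qed (use q las in auto)
  have "north (conf_tile M cfg z) = VC (fst (delta' M q (map scan ts)))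
    (map (\<lambda>t. fst t z) (map2 act as ts)) (map (\<lambda>t. snd t = z) (map2 act as ts))"
    unfolding 1[symmetric] 2[symmetric]
    by (simp add: conf_tile_def run_tile_def Let_def c as_def)
  then show ?thesis unfolding c step_delta' conf_col_def as_def by simp
qed

lemma conf_tile_in: "wf_conf M cfg \<Longrightarrow> conf_tile M cfg z \<in> run_tiles M"
  unfolding run_tiles_def conf_tile_def Let_def
  by (intro CollectI exI conjI refl)
    (force simp: wf_conf_def sym_lists_def flag_lists_def scan_def)+

lemma west_conf_tile_still:
  assumes "\<And>t. t \<in> set (snd cfg) \<Longrightarrow> snd t \<noteq> z - 1 \<and> snd t \<noteq> z" "length (snd cfg) = tapes M"
  shows "west (conf_tile M cfg z) = still M (map scan (snd cfg))"
proof -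
  have "snd (snd cfg ! j) \<noteq> z - 1" "snd (snd cfg ! j) \<noteq> z" if "j < tapes M" for j
    using assms(1)[of "snd cfg ! j"] assms(2) that by auto
  then show ?thesis
    using assms(2) by (auto simp: conf_tile_def run_tile_def Let_def still_def list_eq_iff_nth_eq)
qed

lemma west_conf_tile_halt:
  assumes "fst cfg = halt_state" "length (snd cfg) = tapes M"
  shows "west (conf_tile M cfg z) = still M (map scan (snd cfg))"
  using assms by (auto simp: conf_tile_def run_tile_def Let_def still_def list_eq_iff_nth_eq delta'_def)

text \<open>The guess \<open>ss\<close> is constant along the row, and since all heads lie strictly
  inside, each component is checked by the cell of its head. The heads that enter a cell are
  dictated by its neighbours, and none enter at the two ends. So every tile is the one of the
  configuration, up to the choice of \<open>VAcc\<close>.\<close>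

lemma row_unique:
  assumes wf: "wf_tm M" "wf_conf M cfg"
    and x: "\<And>c. c < m \<Longrightarrow> x c \<in> tiles M" "\<And>c. c < m \<Longrightarrow> south (x c) = conf_col cfg (z0 + int c)"
      "\<And>c. Suc c < m \<Longrightarrow> east (x c) = west (x (Suc c))"
    and ends: "west (x 0) = still M ss0" "east (x (m - 1)) = still M ss1"
    and heads: "\<And>t. t \<in> set (snd cfg) \<Longrightarrow> z0 < snd t \<and> snd t < z0 + int m - 1"
    and c: "c < m"
  shows "north (x c) = conf_col (step None M cfg) (z0 + int c) \<or>
    north (x c) = VAcc \<and> fst cfg = halt_state \<and> fst (snd cfg ! 0) (z0 + int c) = 2"
proof -
  obtain q ts where cfg: "cfg = (q, ts)" by fastforce
  have len: "length ts = tapes M" using wf(2) by (simp add: wf_conf_def cfg)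
  define s where "s c = map (\<lambda>t. fst t (z0 + int c)) ts" for c
  define h where "h c = map (\<lambda>t. snd t = z0 + int c) ts" for c
  define R where "R c ss l r \<longleftrightarrow> ss \<in> sym_lists M \<and> length l = tapes M \<and> length r = tapes M \<and>
      (\<forall>j<tapes M. h c ! j \<longrightarrow> s c ! j = ss ! j) \<and>
      west (x c) = west (run_tile M q ss (s c) (h c) l r) \<and>
      east (x c) = east (run_tile M q ss (s c) (h c) l r) \<and>
      (north (x c) = north (run_tile M q ss (s c) (h c) l r) \<or> north (x c) = VAcc \<and> q = halt_state \<and> s c ! 0 = 2)"
    for c ss l r
  have "\<exists>t. R c (fst t) (fst (snd t)) (snd (snd t))"
    if "c < m" for c
  proof -
    have "south (x c) = VC q (s c) (h c)" using x(2)[OF that] by (simp add: conf_col_def cfg s_def h_def)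
    from tiles_south_VC[OF x(1)[OF that] this] obtain y where y: "y \<in> run_tiles M" "west (x c) = west y"
      "east (x c) = east y" "south y = VC q (s c) (h c)"
      "north (x c) = north y \<or> north (x c) = VAcc \<and> q = halt_state \<and> s c ! 0 = 2" by metis
    from y(1) obtain q' ss s' h' l r where "y = run_tile M q' ss s' h' l r" "ss \<in> sym_lists M"
      "l \<in> flag_lists M" "r \<in> flag_lists M" "\<forall>j<tapes M. h' ! j \<longrightarrow> s' ! j = ss ! j"
      unfolding run_tiles_def by blast
    moreover from this(1) y(4) have "s' = s c" "h' = h c" "q' = q" by auto
    ultimately have "R c ss l r" unfolding R_def using y by (simp add: flag_lists_def)
    then show ?thesis by auto
  qed
  then obtain f where f: "\<And>c. c < m \<Longrightarrow> R c (fst (f c)) (fst (snd (f c))) (snd (snd (f c)))" by metis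
  define ss l r where "ss c = fst (f c)" and "l c = fst (snd (f c))" and "r c = snd (snd (f c))" for c
  note f = f[folded ss_def l_def r_def, unfolded R_def]
  have y:
    "\<And>c. c < m \<Longrightarrow> ss c \<in> sym_lists M" "\<And>c. c < m \<Longrightarrow> length (l c) = tapes M" "\<And>c. c < m \<Longrightarrow> length (r c) = tapes M"
    "\<And>c j. c < m \<Longrightarrow> j < tapes M \<Longrightarrow> h c ! j \<Longrightarrow> s c ! j = ss c ! j"
    "\<And>c. c < m \<Longrightarrow> west (x c) = west (run_tile M q (ss c) (s c) (h c) (l c) (r c))"
    "\<And>c. c < m \<Longrightarrow> east (x c) = east (run_tile M q (ss c) (s c) (h c) (l c) (r c))"
    "\<And>c. c < m \<Longrightarrow> north (x c) = north (run_tile M q (ss c) (s c) (h c) (l c) (r c)) \<or>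
        north (x c) = VAcc \<and> q = halt_state \<and> s c ! 0 = 2"
    using f by (simp_all only:)
  define d where "d c j = snd (snd (delta' M q (ss c)) ! j)" for c j
  have W: "west (x c) = HR (ss c) (l c) (map (\<lambda>j. h c ! j \<and> d c j = -1) [0..<tapes M])" if "c < m" for c
    using y(5)[OF that] by (simp add: run_tile_def Let_def d_def)
  have E: "east (x c) = HR (ss c) (map (\<lambda>j. h c ! j \<and> d c j = 1) [0..<tapes M]) (r c)" if "c < m" for c
    using y(6)[OF that] by (simp add: run_tile_def Let_def d_def)
  have m: "0 < m" using c by simp
  have ss_const: "ss c = ss 0" if "c < m" for c
    using that
  proof (induction c)
    case (Suc c)
    then show ?case using x(3)[of c] E[of c] W[of "Suc c"] by simp
  qed simp
  have ss: "ss 0 = map scan ts"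
  proof (rule nth_equalityI)
    show "length (ss 0) = length (map scan ts)" using y(1)[OF m] len by (simp add: sym_lists_def)
    fix j assume "j < length (ss 0)"
    then have j: "j < tapes M" using y(1)[OF m] by (simp add: sym_lists_def)
    have hd: "z0 < snd (ts ! j)" "snd (ts ! j) < z0 + int m - 1" using heads[of "ts ! j"] j len cfg by auto
    define c where "c = nat (snd (ts ! j) - z0)"
    have c: "c < m" "snd (ts ! j) = z0 + int c" using hd by (auto simp: c_def)
    have "s c ! j = ss c ! j" using c j len by (intro y(4)) (auto simp: h_def)
    then show "ss 0 ! j = map scan ts ! j" using ss_const[OF c(1)] c(2) j len by (simp add: s_def scan_def)
  qed
  let ?d = "\<lambda>j. snd (snd (delta' M q (map scan ts)) ! j)"
  have l: "l c = map (\<lambda>j. snd (ts ! j) = z0 + int c - 1 \<and> ?d j = 1) [0..<tapes M]"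
  proof (cases c)
    case 0
    have "l 0 = replicate (tapes M) False" using W[OF m] ends(1) by (simp add: still_def)
    moreover have "snd (ts ! j) \<noteq> z0 - 1" if "j < tapes M" for j
      using heads[of "ts ! j"] that len cfg by auto
    ultimately show ?thesis using 0 by (auto simp: list_eq_iff_nth_eq)
  next
    case (Suc c')
    then have "l c = map (\<lambda>j. h c' ! j \<and> d c' j = 1) [0..<tapes M]"
      using x(3)[of c'] E[of c'] W[of c] c by simp
    then show ?thesis using Suc c ss_const[of c'] ss len by (auto simp: h_def d_def)
  qed
  have r: "r c = map (\<lambda>j. snd (ts ! j) = z0 + int c + 1 \<and> ?d j = -1) [0..<tapes M]"
  proof (cases "Suc c < m")
    case False
    then have "c = m - 1" using c by simp
    then have "r c = replicate (tapes M) False" using E[OF c] ends(2) by (simp add: still_def)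
    moreover have "snd (ts ! j) \<noteq> z0 + int c + 1" if "j < tapes M" for j
      using heads[of "ts ! j"] that len cfg False c by auto
    ultimately show ?thesis by (auto simp: list_eq_iff_nth_eq)
  next
    case True
    then have "r c = map (\<lambda>j. h (Suc c) ! j \<and> d (Suc c) j = -1) [0..<tapes M]"
      using x(3)[of c] E[of c] W[of "Suc c"] c by simp
    then show ?thesis using True ss_const[of "Suc c"] ss len by (auto simp: h_def d_def add.commute add.left_commute)
  qed
  have "run_tile M q (ss c) (s c) (h c) (l c) (r c) = conf_tile M cfg (z0 + int c)"
    using l r ss_const[OF c] ss by (simp add: conf_tile_def cfg s_def h_def Let_def)
  moreover have "tapes M > 0" using wf(1) by (simp add: wf_tm_def)
  ultimately show ?thesis using y(7)[OF c] north_conf_tile[OF wf] len by (auto simp: cfg s_def)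
qed

text \<open>Row \<open>r\<close>, column \<open>c\<close> of the grid is cell \<open>r * T + c\<close>, so that the right edge of each row is glued to the left
  edge of the next one. Column \<open>1 + \<tau>\<close> corresponds to position 0 of the machine's tapes.\<close>

locale tableau =
  fixes M :: tm and \<tau> :: nat and inp :: "bool list" and g :: nat
  assumes wf: "wf_tm M" and tau: "1 \<le> \<tau>" and inp: "inp \<noteq> []"
begin

definition T where "T = \<tau> + length inp + g + \<tau> + 2"

definition row :: "vcol list" where
  "row = VL # replicate \<tau> VB @ map VI inp @ replicate g VG @ replicate \<tau> VB @ [VR]"

text \<open>The cell of the last row at tape position 0. The row below it has the configuration
  after \<open>T - 3\<close> steps on its south side, hence the time \<open>T - 3\<close> in the
  acceptance condition.\<close>

definition fin where "fin = (T - 1) * T + 1 + \<tau>"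

definition valid :: "(nat \<Rightarrow> tile) \<Rightarrow> bool" where
  "valid \<theta> \<longleftrightarrow> (\<forall>p<T * T. \<theta> p \<in> tiles M \<and> (0 < p \<longrightarrow> east (\<theta> (p - 1)) = west (\<theta> p)) \<and>
     (if p < T then south (\<theta> p) = row ! p
      else if p = fin then north (\<theta> (p - T)) = VAcc \<and> south (\<theta> p) = VFin
      else north (\<theta> (p - T)) = south (\<theta> p)))"

definition run :: "bool list \<Rightarrow> nat \<Rightarrow> config" where
  "run u t = (step None M ^^ t) (init_config M (inp @ u))"

lemma k_pos: "0 < tapes M"
  using wf by (simp add: wf_tm_def)

lemma run_0: "run u 0 = init_config M (inp @ u)"
  by (simp add: run_def)

lemma run_Suc: "run u (Suc t) = step None M (run u t)"
  by (simp add: run_def)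

lemma wf_run: "wf_conf M (run u t)"
proof (induction t)
  case 0
  then show ?case using wf k_pos
    by (auto simp: run_0 wf_conf_def init_config_def tape_of_def string_cells_def wf_tm_def)
next
  case (Suc t)
  then show ?case by (simp add: run_Suc wf_conf_step wf)
qed

lemma length_run: "length (snd (run u t)) = tapes M"
  using wf_run by (simp add: wf_conf_def)

lemma conf_col_init: "conf_col (run u 0) z = init_cell M (string_cells (inp @ u) z) (z = 0)"
proof -
  obtain k where "tapes M = Suc k" using k_pos by (cases "tapes M") auto
  then show ?thesis
    by (auto simp: run_0 conf_col_def init_config_def init_cell_def tape_of_def string_cells_def)
qed

lemma row_nth:
  "row ! 0 = VL"
  "\<And>i. i < \<tau> \<Longrightarrow> row ! (1 + i) = VB"
  "\<And>i. i < length inp \<Longrightarrow> row ! (1 + \<tau> + i) = VI (inp ! i)"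
  "\<And>i. i < g \<Longrightarrow> row ! (1 + \<tau> + length inp + i) = VG"
  "\<And>i. i < \<tau> \<Longrightarrow> row ! (1 + \<tau> + length inp + g + i) = VB"
  "row ! (T - 1) = VR"
  by (auto simp: row_def nth_append T_def nth_Cons split: nat.splits)

lemma col_cases:
  assumes "c < T"
  obtains "c = 0" | i where "c = 1 + i" "i < \<tau>" | i where "c = 1 + \<tau> + i" "i < length inp"
    | i where "c = 1 + \<tau> + length inp + i" "i < g" | i where "c = 1 + \<tau> + length inp + g + i" "i < \<tau>"
    | "c = T - 1"
proof -
  consider "c = 0" | "1 \<le> c" "c < 1 + \<tau>" | "1 + \<tau> \<le> c" "c < 1 + \<tau> + length inp"
    | "1 + \<tau> + length inp \<le> c" "c < 1 + \<tau> + length inp + g"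
    | "1 + \<tau> + length inp + g \<le> c" "c < 1 + \<tau> + length inp + g + \<tau>" | "c = T - 1"
    using assms by (fastforce simp: T_def)
  then show ?thesis
  proof cases
    case 2 then show ?thesis using that(2)[of "c - 1"] by simp
  next
    case 3 then show ?thesis using that(3)[of "c - (1 + \<tau>)"] by simp
  next
    case 4 then show ?thesis using that(4)[of "c - (1 + \<tau> + length inp)"] by simp
  next
    case 5 then show ?thesis using that(5)[of "c - (1 + \<tau> + length inp + g)"] by simp
  qed (use that in auto)
qed

lemma tiles_init:
  assumes "x \<in> tiles M"
  shows "south x = VL \<Longrightarrow> north x = VL \<and> (east x = HI0 \<or> (\<exists>ss. east x = still M ss))"
    "south x = VR \<Longrightarrow> north x = VR \<and> (west x = HI2 \<or> (\<exists>ss. west x = still M ss))"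
    "south x = VB \<Longrightarrow> north x = init_cell M 0 False \<and>
       (west x, east x) \<in> {(HI0, HI0), (HI1, HI2), (HI2, HI2)}"
    "south x = VI b \<Longrightarrow> west x = HI0 \<and> east x = HI1 \<and> north x = init_cell M (bsym b) True \<or>
       west x = HI1 \<and> east x = HI1 \<and> north x = init_cell M (bsym b) False"
    "south x = VG \<Longrightarrow> west x = HI1 \<and> east x = HI1 \<and> (\<exists>b. north x = init_cell M (bsym b) False) \<or>
       west x \<in> {HI1, HI2} \<and> east x = HI2 \<and> north x = init_cell M 0 False"
  using assms by (auto simp: tiles_def acc_tile_def dest: run_tiles_south)

lemma tiles_run_horizontal:
  assumes "x \<in> tiles M" "south x = VC q s h"
  shows "\<exists>ss a b. west x = HR ss a b" "\<exists>ss a b. east x = HR ss a b"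
proof -
  obtain y where y: "y \<in> run_tiles M" "west x = west y" "east x = east y"
    using tiles_south_VC[OF assms] by metis
  then show "\<exists>ss a b. west x = HR ss a b" "\<exists>ss a b. east x = HR ss a b"
    by (auto simp: run_tiles_def run_tile_def Let_def)
qed

lemma validD:
  assumes "valid \<theta>" "p < T * T"
  shows "\<theta> p \<in> tiles M" "0 < p \<Longrightarrow> east (\<theta> (p - 1)) = west (\<theta> p)"
    "p < T \<Longrightarrow> south (\<theta> p) = row ! p"
    "T \<le> p \<Longrightarrow> p \<noteq> fin \<Longrightarrow> north (\<theta> (p - T)) = south (\<theta> p)"
    "p = fin \<Longrightarrow> T \<le> p \<Longrightarrow> north (\<theta> (p - T)) = VAcc \<and> south (\<theta> p) = VFin"
  using assms unfolding valid_def by (auto split: if_splits)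

lemma T_le: "T \<le> T * T"
  by (simp add: T_def)

lemma sound_init:
  assumes v: "valid \<theta>"
  obtains u where "length u \<le> g"
    "\<And>c. 1 \<le> c \<Longrightarrow> c < T - 1 \<Longrightarrow> north (\<theta> c) = conf_col (run u 0) (int c - 1 - int \<tau>)"
proof -
  have tile: "\<theta> c \<in> tiles M" and south: "south (\<theta> c) = row ! c" if "c < T" for c
    using validD[OF v, of c] that T_le by auto
  have adj: "west (\<theta> (Suc c)) = east (\<theta> c)" if "Suc c < T" for c
    using validD(2)[OF v, of "Suc c"] that T_le by simp
  \<comment> \<open>A wall tile may also have a run colour to its east, but then no tile for the
    blank beside it fits; \<open>1 \<le> \<tau>\<close> guarantees this blank.\<close>
  have E0: "east (\<theta> 0) = HI0"
  proof -
    have "1 < T" by (simp add: T_def)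
    then show ?thesis using tiles_init(1)[OF tile[of 0]] south[of 0] row_nth(1) adj[of 0]
        tiles_init(3)[OF tile[of 1]] south[of 1] row_nth(2)[of 0] tau
      by (auto simp: still_def)
  qed
  have E1: "i \<le> \<tau> \<Longrightarrow> east (\<theta> i) = HI0" for i
  proof (induction i)
    case (Suc i)
    then have "Suc i < T" by (simp add: T_def)
    then show ?case using Suc adj[of i] tiles_init(3)[OF tile[of "Suc i"]] south[of "Suc i"] row_nth(2)[of i]
      by auto
  qed (simp add: E0)
  have N1: "north (\<theta> (1 + i)) = init_cell M 0 False" if "i < \<tau>" for i
  proof -
    have "1 + i < T" using that by (simp add: T_def)
    then show ?thesis using tiles_init(3)[OF tile[of "1 + i"]] south[of "1 + i"] row_nth(2)[OF that] by simp
  qed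
  have E2: "i < length inp \<Longrightarrow> east (\<theta> (1 + \<tau> + i)) = HI1 \<and>
      north (\<theta> (1 + \<tau> + i)) = init_cell M (bsym (inp ! i)) (i = 0)" for i
  proof (induction i)
    case 0
    then have "Suc \<tau> < T" by (simp add: T_def)
    then show ?case using 0 E1[of \<tau>] adj[of \<tau>] tiles_init(4)[OF tile[of "Suc \<tau>"]] south[of "Suc \<tau>"] row_nth(3)[of 0]
      by auto
  next
    case (Suc i)
    then have "Suc (1 + \<tau> + i) < T" by (simp add: T_def)
    then show ?case using Suc adj[of "1 + \<tau> + i"] tiles_init(4)[OF tile[of "Suc (1 + \<tau> + i)"]]
        south[of "Suc (1 + \<tau> + i)"] row_nth(3)[of "Suc i"]
      by auto
  qed
  \<comment> \<open>Here \<open>u\<close> is the certificate read from the first \<open>i\<close>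
    cells. The colour is still \<open>HI1\<close> exactly if no blank has been chosen yet;
    afterwards only blanks are possible.\<close>
  have "i \<le> g \<Longrightarrow> \<exists>u. length u \<le> i \<and>
      (\<forall>j<i. north (\<theta> (1 + \<tau> + length inp + j)) = init_cell M (if j < length u then bsym (u ! j) else 0) False) \<and>
      east (\<theta> (\<tau> + length inp + i)) = (if length u = i then HI1 else HI2)" for i
  proof (induction i)
    case 0
    have "1 + \<tau> + (length inp - 1) = \<tau> + length inp" using inp by (cases inp) auto
    then have "east (\<theta> (\<tau> + length inp)) = HI1" using E2[of "length inp - 1"] inp
      unfolding \<open>1 + \<tau> + (length inp - 1) = \<tau> + length inp\<close> by simp
    then show ?case by (intro exI[of _ "[]"]) auto
  next
    case (Suc i)
    then obtain u where u: "length u \<le> i"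
      "\<And>j. j < i \<Longrightarrow> north (\<theta> (1 + \<tau> + length inp + j)) = init_cell M (if j < length u then bsym (u ! j) else 0) False"
      "east (\<theta> (\<tau> + length inp + i)) = (if length u = i then HI1 else HI2)" by auto
    let ?c = "1 + \<tau> + length inp + i"
    have c: "?c < T" using Suc.prems by (simp add: T_def)
    have w: "west (\<theta> ?c) = (if length u = i then HI1 else HI2)"
      using adj[of "\<tau> + length inp + i"] c u(3) by simp
    from tiles_init(5)[OF tile[OF c]] south[OF c] row_nth(4)[of i] Suc.prems
    consider b where "west (\<theta> ?c) = HI1" "east (\<theta> ?c) = HI1" "north (\<theta> ?c) = init_cell M (bsym b) False"
      | "east (\<theta> ?c) = HI2" "north (\<theta> ?c) = init_cell M 0 False" by auto
    then show ?case
    proof cases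
      case 1
      then have "length u = i" using w by (auto split: if_splits)
      then show ?thesis using 1 u
        by (intro exI[of _ "u @ [b]"]) (auto simp: nth_append less_Suc_eq)
    next
      case 2
      then show ?thesis using u
        by (intro exI[of _ u]) (auto simp: less_Suc_eq)
    qed
  qed
  from this[of g] obtain u where u: "length u \<le> g"
    "\<And>j. j < g \<Longrightarrow> north (\<theta> (1 + \<tau> + length inp + j)) = init_cell M (if j < length u then bsym (u ! j) else 0) False"
    by auto
  have N4: "north (\<theta> (1 + \<tau> + length inp + g + i)) = init_cell M 0 False" if "i < \<tau>" for i
  proof -
    have "1 + \<tau> + length inp + g + i < T" using that by (simp add: T_def)
    then show ?thesis using tiles_init(3)[OF tile] south row_nth(5)[OF that] by simp
  qed
  show ?thesis
  proof (rule that[OF u(1)])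
    fix c assume c: "1 \<le> c" "c < T - 1"
    then have "c < T" by simp
    then show "north (\<theta> c) = conf_col (run u 0) (int c - 1 - int \<tau>)"
    proof (cases rule: col_cases)
      case (2 i)
      then show ?thesis using N1[of i] by (simp add: conf_col_init string_cells_def)
    next
      case (3 i)
      then show ?thesis using E2[of i] by (simp add: conf_col_init string_cells_def nth_append bsym_def)
    next
      case (4 i)
      have "nat (int (length inp) + int i) = length inp + i" by simp
      moreover have "int (length inp) + int i \<noteq> 0" using inp by (cases inp) auto
      ultimately show ?thesis using 4 u(2)[of i] inp by (simp add: conf_col_init string_cells_def nth_append bsym_def)
    next
      case (5 i)
      moreover have "int (length inp) + (int g + int i) \<noteq> 0" using inp by (cases inp) auto
      ultimately show ?thesis using N4[of i] u(1) by (simp add: conf_col_init string_cells_def)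
    qed (use c in auto)
  qed
qed

text \<open>The heads never come near the walls, so by uniqueness of rows the tiling copies the run
  on the guessed certificate, row by row, up to the cell below \<open>fin\<close>.\<close>

lemma sound:
  assumes v: "valid \<theta>"
    and heads: "\<And>u t tp. length u \<le> g \<Longrightarrow> tp \<in> set (snd (run u t)) \<Longrightarrow> \<bar>snd tp\<bar> < int \<tau>"
  shows "\<exists>u. length u \<le> g \<and> fst (run u (T - 3)) = halt_state \<and> fst (snd (run u (T - 3)) ! 0) 0 = 2"
proof -
  obtain u where u: "length u \<le> g"
    "\<And>c. 1 \<le> c \<Longrightarrow> c < T - 1 \<Longrightarrow> north (\<theta> c) = conf_col (run u 0) (int c - 1 - int \<tau>)"
    using sound_init[OF v] by metis
  have inp0: "0 < length inp" using inp by simp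
  obtain n0 where n0: "length inp = Suc n0" using inp by (cases inp) auto
  have T3: "3 \<le> T" using tau by (simp add: T_def)
  have cell: "r * T + c < T * T" if "r < T" "c < T" for r c
  proof -
    have "r * T + c < Suc r * T" using that by simp
    also have "\<dots> \<le> T * T" using that by (intro mult_le_mono1) simp
    finally show ?thesis .
  qed
  have not_fin: "r * T + c \<noteq> fin" if "r < T - 1" "c < T" for r c
  proof -
    have "r * T + c < Suc r * T" using that by simp
    also have "\<dots> \<le> (T - 1) * T" using that by (intro mult_le_mono1) simp
    finally show ?thesis by (simp add: fin_def)
  qed
  have up: "south (\<theta> (Suc r * T + c)) = north (\<theta> (r * T + c))" if "Suc r < T - 1" "c < T" for r c
    using validD(4)[OF v, of "Suc r * T + c"] cell[of "Suc r" c] not_fin[of "Suc r" c] that by simp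
  have tile: "\<theta> (r * T + c) \<in> tiles M" if "r < T" "c < T" for r c
    using validD(1)[OF v] cell that by blast
  have adj: "east (\<theta> (r * T + c)) = west (\<theta> (r * T + Suc c))" if "r < T" "Suc c < T" for r c
    using validD(2)[OF v, of "r * T + Suc c"] cell[of r "Suc c"] that by simp
  have walls: "south (\<theta> (r * T)) = VL \<and> south (\<theta> (r * T + (T - 1))) = VR" if "r < T - 1" for r
    using that
  proof (induction r)
    case 0
    have "T - 1 < T * T" using T_le T3 by linarith
    then show ?case using validD(3)[OF v, of 0] validD(3)[OF v, of "T - 1"] row_nth(1,6) T3 by simp
  next
    case (Suc r)
    then show ?case using up[of r 0] up[of r "T - 1"] tiles_init(1)[OF tile[of r 0]] tiles_init(2)[OF tile[of r "T - 1"]]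
      by simp
  qed
  define mid where "mid r \<longleftrightarrow> (\<forall>c. 1 \<le> c \<longrightarrow> c < T - 1 \<longrightarrow>
     south (\<theta> (Suc r * T + c)) = conf_col (run u r) (int c - 1 - int \<tau>))" for r
  have next_row: "north (\<theta> (Suc r * T + c)) = conf_col (run u (Suc r)) (int c - 1 - int \<tau>) \<or>
      north (\<theta> (Suc r * T + c)) = VAcc \<and> fst (run u r) = halt_state \<and> fst (snd (run u r) ! 0) (int c - 1 - int \<tau>) = 2"
    if mid: "mid r" and r: "Suc r < T - 1" and c: "1 \<le> c" "c < T - 1" for r c
  proof -
    let ?x = "\<lambda>c. \<theta> (Suc r * T + Suc c)"
    have S: "south (?x c) = conf_col (run u r) (- int \<tau> + int c)" if "c < T - 2" for c
      using mid that unfolding mid_def by (auto dest!: spec[of _ "Suc c"])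
    have T2: "0 < T - 2" using T3 by simp
    have rT: "Suc r < T" using r by simp
    have T3': "T - 2 - 1 < T - 2" using T3 by linarith
    have W: "\<exists>ss a b. west (?x c) = HR ss a b" and E: "\<exists>ss a b. east (?x c) = HR ss a b" if "c < T - 2" for c
      using tiles_run_horizontal[OF tile[of "Suc r" "Suc c"]] S[OF that] that r by (auto simp: conf_col_def)
    have "east (\<theta> (Suc r * T)) = west (?x 0)" using adj[of "Suc r" 0] r T3 by simp
    \<comment> \<open>The wall tiles of the first row have the same vertical colours, but their
      inner colour \<open>HI0\<close> cannot meet a run tile.\<close>
    then obtain ss0 where ss0: "west (?x 0) = still M ss0"
      using tiles_init(1)[OF tile[of "Suc r" 0]] walls[OF r] rT T3 W[OF T2] by auto
    have "Suc (T - 3) = T - 2" "Suc (T - 2) = T - 1" using T3 by simp_all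
    then have "east (?x (T - 2 - 1)) = west (\<theta> (Suc r * T + (T - 1)))"
      using adj[of "Suc r" "T - 2"] r T3 by (simp add: numeral_eq_Suc)
    then obtain ss1 where ss1: "east (?x (T - 2 - 1)) = still M ss1"
      using tiles_init(2)[OF tile[of "Suc r" "T - 1"]] walls[OF r] rT T3 E[OF T3'] by auto
    have "north (?x (c - 1)) = conf_col (step None M (run u r)) (- int \<tau> + int (c - 1)) \<or>
      north (?x (c - 1)) = VAcc \<and> fst (run u r) = halt_state \<and> fst (snd (run u r) ! 0) (- int \<tau> + int (c - 1)) = 2"
    proof (rule row_unique[OF wf wf_run, of "T - 2"])
      show "?x c \<in> tiles M" if "c < T - 2" for c using that r by (intro tile) auto
      show "east (?x c) = west (?x (Suc c))" if "Suc c < T - 2" for c using that r by (intro adj) auto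
      show "- int \<tau> < snd t \<and> snd t < - int \<tau> + int (T - 2) - 1" if "t \<in> set (snd (run u r))" for t
        using heads[OF u(1) that] n0 by (auto simp: T_def)
      show "c - 1 < T - 2" using c by simp
    qed (use S ss0 ss1 in auto)
    moreover have "- int \<tau> + int (c - 1) = int c - 1 - int \<tau>" "Suc (c - 1) = c" using c by auto
    ultimately show ?thesis by (simp add: run_Suc)
  qed
  have mid: "mid r" if "Suc r < T - 1" for r
    using that
  proof (induction r)
    case 0
    then show ?case unfolding mid_def using u(2) up[of 0] by auto
  next
    case (Suc r)
    show ?case unfolding mid_def
    proof (intro allI impI)
      fix c assume c: "1 \<le> c" "c < T - 1"
      have "south (\<theta> (Suc (Suc r) * T + c)) = north (\<theta> (Suc r * T + c))"
        using up[of "Suc r" c] Suc.prems c by simp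
      \<comment> \<open>No tile has \<open>VAcc\<close> on its south side, so the accepting variant
        of a tile can occur only where the matching condition is replaced, below
        \<open>fin\<close>.\<close>
      moreover have "south (\<theta> (Suc (Suc r) * T + c)) \<noteq> VAcc"
        using Suc.prems c by (intro tiles_south_not_VAcc[where M = M] tile) auto
      ultimately show "south (\<theta> (Suc (Suc r) * T + c)) = conf_col (run u (Suc r)) (int c - 1 - int \<tau>)"
        using next_row[OF Suc.IH, of c] Suc.prems c by auto
    qed
  qed
  have r: "Suc (T - 3) < T - 1" "Suc (T - 3) = T - 2" using T3 by simp_all
  have fin: "fin - T = Suc (T - 3) * T + (1 + \<tau>)" "fin < T * T" "T \<le> fin"
  proof -
    obtain m where m: "T = Suc (Suc m)" using T3 by (cases T rule: nat.exhaust; cases "T - 1" rule: nat.exhaust) auto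
    show "fin - T = Suc (T - 3) * T + (1 + \<tau>)" unfolding r(2) by (simp add: fin_def m)
    show "fin < T * T" using cell[of "T - 1" "1 + \<tau>"] T3 by (simp add: fin_def T_def)
    show "T \<le> fin" by (simp add: fin_def m)
  qed
  have "north (\<theta> (Suc (T - 3) * T + (1 + \<tau>))) = VAcc"
    using validD(5)[OF v fin(2) refl fin(3)] fin(1) by simp
  moreover have "1 + \<tau> < T - 1" using n0 by (simp add: T_def)
  moreover have "int (1 + \<tau>) - 1 - int \<tau> = 0" "1 \<le> 1 + \<tau>" by simp_all
  moreover have "conf_col cfg z \<noteq> VAcc" for cfg z by (simp add: conf_col_def)
  ultimately have "fst (run u (T - 3)) = halt_state \<and> fst (snd (run u (T - 3)) ! 0) 0 = 2"
    using next_row[OF mid[OF r(1)] r(1), of "1 + \<tau>"] by metis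
  then show ?thesis using u(1) by blast
qed

lemma complete:
  assumes u: "length u \<le> g"
    and heads: "\<And>t tp. tp \<in> set (snd (run u t)) \<Longrightarrow> \<bar>snd tp\<bar> < int \<tau>"
    and halt: "fst (run u (T - 3)) = halt_state" "fst (snd (run u (T - 3)) ! 0) 0 = 2"
  shows "\<exists>\<theta>. valid \<theta>"
proof -
  have inp0: "0 < length inp" using inp by simp
  obtain n0 where n0: "length inp = Suc n0" using inp by (cases inp) auto
  have T3: "3 \<le> T" using tau by (simp add: T_def)
  define e0 where "e0 c = (if c = T - 1 then HW else if c \<le> \<tau> then HI0
    else if c \<le> \<tau> + length inp + length u then HI1 else HI2)" for c
  define z where "z c = int c - 1 - int \<tau>" for c
  define x0 where "x0 c = Tile (if c = 0 then HW else e0 (c - 1)) (e0 c) (row ! c)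
    (if c = 0 then VL else if c = T - 1 then VR else conf_col (run u 0) (z c))" for c
  define st where "st r = still M (map scan (snd (run u r)))" for r
  \<comment> \<open>By the last two rows the machine has halted. No head then crosses an edge, all
    horizontal colours are \<open>st r\<close>, and the \<open>VFin\<close> tile fits between its
    neighbours.\<close>
  define x1 where "x1 r c = (if c = 0 then Tile HW (st r) VL VL
    else if c = T - 1 then Tile (st r) HW VR VR
    else if r = T - 3 \<and> c = 1 + \<tau> then acc_tile (conf_tile M (run u r) (z c))
    else if r = T - 2 \<and> c = 1 + \<tau> then Tile (st r) (st r) VFin VL
    else conf_tile M (run u r) (z c))" for r c
  define \<theta> where "\<theta> p = (if p div T = 0 then x0 (p mod T) else x1 (p div T - 1) (p mod T))" for p
  have Tpos: "0 < T" using T3 by simp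
  have \<theta>: "\<theta> (r * T + c) = (if r = 0 then x0 c else x1 (r - 1) c)" if "c < T" for r c
    using that by (simp add: \<theta>_def)
  have x0_tile: "x0 c \<in> tiles M" if "c < T" for c
    using that
  proof (cases rule: col_cases)
    case 1
    then show ?thesis using T3 row_nth(1) by (simp add: x0_def e0_def tiles_def)
  next
    case (2 i)
    then have c: "c \<noteq> T - 1" using that by (auto simp: T_def)
    show ?thesis using 2 row_nth(2)[OF 2(2)] c
      by (simp add: x0_def e0_def tiles_def conf_col_init z_def string_cells_def) (simp add: T_def)
  next
    case (3 i)
    then have c: "c \<noteq> T - 1" "c - 1 \<noteq> T - 1" using that tau by (auto simp: T_def)
    show ?thesis using 3 row_nth(3)[OF 3(2)] c n0
      by (cases "i = 0") (simp_all add: x0_def e0_def tiles_def conf_col_init z_def string_cells_def nth_append bsym_def)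
  next
    case (4 i)
    then have c: "c \<noteq> T - 1" "c - 1 \<noteq> T - 1" using that tau by (auto simp: T_def)
    have n: "nat (int (length inp) + int i) = length inp + i" "int (length inp) + int i \<noteq> 0"
      using n0 by simp_all
    show ?thesis using 4 row_nth(4)[OF 4(2)] c inp0 n
      by (auto simp: x0_def e0_def tiles_def conf_col_init z_def string_cells_def nth_append bsym_def)
  next
    case (5 i)
    then have c: "c \<noteq> T - 1" "c - 1 \<noteq> T - 1" using that tau by (auto simp: T_def)
    have "z c \<noteq> 0" "\<not> z c < int (length (inp @ u))" using 5 n0 u by (simp_all add: z_def)
    then have "conf_col (run u 0) (z c) = init_cell M 0 False" by (simp add: conf_col_init string_cells_def)
    then have x: "x0 c = Tile (e0 (c - 1)) (e0 c) VB (init_cell M 0 False)"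
      using 5 row_nth(5)[OF 5(2)] c by (simp add: x0_def)
    have "e0 c = HI2" "e0 (c - 1) = HI1 \<or> e0 (c - 1) = HI2" using 5 c u n0 by (auto simp: e0_def)
    then show ?thesis unfolding x tiles_def by auto
  next
    case 6
    then show ?thesis using row_nth(6) T3 u tau
      by (auto simp: x0_def e0_def tiles_def T_def)
  qed
  have wfr: "wf_conf M (run u r)" for r by (rule wf_run)
  have run_halt: "run u (T - 2) = run u (T - 3)"
  proof -
    have "T - 2 = Suc (T - 3)" using T3 by simp
    then show ?thesis using halt(1) by (simp add: run_Suc step_def split: prod.splits) (auto simp: split_def)
  qed
  have x1_tile: "x1 r c \<in> tiles M" if "c < T" for r c
  proof -
    have "acc_tile (conf_tile M (run u (T - 3)) (z (1 + \<tau>))) \<in> tiles M"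
    proof -
      have "south (conf_tile M (run u (T - 3)) (z (1 + \<tau>))) = VC halt_state (map (\<lambda>t. fst t 0) (snd (run u (T - 3))))
          (map (\<lambda>t. snd t = 0) (snd (run u (T - 3))))"
        using halt(1) by (simp add: south_conf_tile conf_col_def z_def)
      moreover have "map (\<lambda>t. fst t 0) (snd (run u (T - 3))) ! 0 = 2" using halt(2) length_run k_pos by simp
      ultimately show ?thesis using conf_tile_in[OF wfr, of "T - 3" "z (1 + \<tau>)"] by (intro acc_tile_in)
    qed
    moreover have "conf_tile M (run u r) (z c) \<in> tiles M"
      using conf_tile_in[OF wfr, of r "z c"] by (rule run_tiles_in)
    moreover note scan_sym_lists[OF wfr, of r]
    ultimately show ?thesis by (auto simp: x1_def st_def) (auto simp: tiles_def)
  qed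
  have heads': "z 1 < snd t \<and> snd t < z (T - 2)" if "t \<in> set (snd (run u r))" for t r
    using heads[OF that] n0 by (auto simp: T_def z_def)
  have x1_adj: "east (x1 r c) = west (x1 r (Suc c))" if "Suc c < T" "r < T - 1" for r c
  proof -
    define W where "W r c = (if c = 0 then HW else west (conf_tile M (run u r) (z c)))" for r c
    have end1: "west (conf_tile M (run u r) (z 1)) = st r" for r
      unfolding st_def using heads'[of _ r] by (intro west_conf_tile_still length_run) (force simp: z_def)
    have end2: "west (conf_tile M (run u r) (z (T - 1))) = st r" for r
      unfolding st_def using heads'[of _ r] T3 by (intro west_conf_tile_still length_run) (force simp: z_def)
    have halted: "west (conf_tile M (run u (T - 2)) z') = st (T - 2)" for z'
      unfolding st_def using halt(1) run_halt by (intro west_conf_tile_halt length_run) simp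
    have e: "east (conf_tile M (run u r) (z c)) = west (conf_tile M (run u r) (z (Suc c)))"
      using east_conf_tile[OF length_run, of u r "z c"] by (simp add: z_def algebra_simps)
    have west: "west (x1 r c) = west (conf_tile M (run u r) (z c))" if "0 < c" for c
      using that end2[of r] halted[of "z c"] T3 by (auto simp: x1_def acc_tile_def)
    have "east (x1 r c) = west (conf_tile M (run u r) (z (Suc c)))"
      using that e end1[of r] halted[of "z (Suc c)"] T3 by (auto simp: x1_def acc_tile_def)
    then show ?thesis using west by simp
  qed
  have x0_adj: "east (x0 c) = west (x0 (Suc c))" for c
    by (simp add: x0_def)
  have ends: "east (x0 (T - 1)) = HW" "east (x1 r (T - 1)) = HW" "west (x1 r 0) = HW" for r
    using T3 by (auto simp: x0_def e0_def x1_def)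
  have x01: "north (x0 c) = south (x1 0 c)" if "c < T" for c
    using that tau T3 inp0 by (auto simp: x0_def x1_def acc_tile_def south_conf_tile T_def)
  have x11: "north (x1 r c) = south (x1 (Suc r) c)" if "c < T" "Suc r < T - 1" "Suc r = T - 2 \<longrightarrow> c \<noteq> 1 + \<tau>" for r c
    using that T3 north_conf_tile[OF wf wfr, of r "z c", folded run_Suc]
    by (auto simp: x1_def acc_tile_def south_conf_tile)
  have fin: "fin = (T - 1) * T + (1 + \<tau>)" by (simp add: fin_def)
  have c1: "1 + \<tau> < T - 1" using inp0 tau by (simp add: T_def)
  have "valid \<theta>" unfolding valid_def
  proof (intro allI impI)
    fix p assume p: "p < T * T"
    define r c where "r = p div T" and "c = p mod T"
    have rc: "p = r * T + c" "c < T" using Tpos by (simp_all add: r_def c_def)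
    have r: "r < T" using p Tpos unfolding r_def by (simp add: less_mult_imp_div_less)
    have eq: "\<theta> p = (if r = 0 then x0 c else x1 (r - 1) c)" unfolding rc(1) by (rule \<theta>[OF rc(2)])
    have "\<theta> p \<in> tiles M" using eq x0_tile[OF rc(2)] x1_tile[OF rc(2)] by simp
    moreover have "east (\<theta> (p - 1)) = west (\<theta> p)" if p0: "0 < p"
    proof (cases "c = 0")
      case True
      then obtain r' where r': "r = Suc r'" using p0 rc by (cases r) auto
      then have "p - 1 = r' * T + (T - 1)" using rc(1) True Tpos by simp
      then have "\<theta> (p - 1) = (if r' = 0 then x0 (T - 1) else x1 (r' - 1) (T - 1))" using \<theta>[of "T - 1" r'] Tpos by simp
      then show ?thesis using eq True r' ends by simp
    next
      case False
      then obtain c' where c': "c = Suc c'" by (cases c) auto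
      then have "p - 1 = r * T + c'" using rc(1) by simp
      then have "\<theta> (p - 1) = (if r = 0 then x0 c' else x1 (r - 1) c')" using \<theta>[of c' r] rc(2) c' by simp
      then show ?thesis using eq c' x0_adj x1_adj[of c' "r - 1"] rc(2) r by auto
    qed
    moreover have "if p < T then south (\<theta> p) = row ! p
      else if p = fin then north (\<theta> (p - T)) = VAcc \<and> south (\<theta> p) = VFin
      else north (\<theta> (p - T)) = south (\<theta> p)"
    proof (cases r)
      case 0
      then show ?thesis using rc eq by (simp add: x0_def)
    next
      case (Suc r')
      have pT: "p - T = r' * T + c" "\<not> p < T" using rc Suc by auto
      have eq': "\<theta> (p - T) = (if r' = 0 then x0 c else x1 (r' - 1) c)" unfolding pT(1) by (rule \<theta>[OF rc(2)])
      show ?thesis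
      proof (cases "r = T - 1 \<and> c = 1 + \<tau>")
        case True
        then have "p = fin" using rc fin by simp
        moreover have r': "r' - 1 = T - 3" "r' \<noteq> 0" "r - 1 = T - 2" "r \<noteq> 0" "T - 2 \<noteq> T - 3"
          using True Suc n0 tau by (auto simp: T_def)
        moreover have "\<theta> p = Tile (st (T - 2)) (st (T - 2)) VFin VL"
          using eq r'(3-5) True c1 by (simp add: x1_def)
        moreover have "\<theta> (p - T) = acc_tile (conf_tile M (run u (T - 3)) (z (1 + \<tau>)))"
          using eq' r'(1,2) True c1 unfolding x1_def by auto
        ultimately show ?thesis using pT by (simp add: acc_tile_def)
      next
        case False
        have "p \<noteq> fin"
        proof
          assume "p = fin"
          then have "r = fin div T" "c = fin mod T" by (simp_all add: r_def c_def)
          moreover have "fin div T = T - 1" "fin mod T = 1 + \<tau>"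
            unfolding fin using c1 Tpos by (simp_all add: div_mult_self3 del: One_nat_def)
          ultimately show False using False by simp
        qed
        moreover have "north (\<theta> (p - T)) = south (\<theta> p)"
        proof (cases r')
          case 0
          then show ?thesis using eq eq' Suc x01[OF rc(2)] by simp
        next
          case (Suc r'')
          then show ?thesis using eq eq' \<open>r = Suc r'\<close> x11[OF rc(2), of r''] False r by auto
        qed
        ultimately show ?thesis using pT by simp
      qed
    qed
    ultimately show "\<theta> p \<in> tiles M \<and> (0 < p \<longrightarrow> east (\<theta> (p - 1)) = west (\<theta> p)) \<and>
     (if p < T then south (\<theta> p) = row ! p
      else if p = fin then north (\<theta> (p - T)) = VAcc \<and> south (\<theta> p) = VFin
      else north (\<theta> (p - T)) = south (\<theta> p))" by blast
  qed
  then show ?thesis by blast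
qed

end

subsection \<open>Tilings with numbers\<close>

text \<open>The symbols of \<open>row_syms\<close>: 1 left wall, 2 blank, 3 and 4 bits of the input, 5 cell of the certificate,
  6 right wall, 7 cell of a later row, 8 the cell below which the run must have accepted. The parameters \<open>ws\<close> and
  \<open>so\<close> are added to the west and south colour requirements of a cell.\<close>

definition width :: "nat \<Rightarrow> nat \<Rightarrow> nat \<Rightarrow> nat" where
  "width t g l = 2 * t + 2 * l + g + 3"

definition row_syms :: "nat \<Rightarrow> nat \<Rightarrow> bool list \<Rightarrow> nat list" where
  "row_syms t g w = [1] @ replicate t 2 @ concat (map (\<lambda>b. [4, if b then 4 else 3]) w) @ [3] @ replicate g 5 @
     replicate t 2 @ [6] @ replicate (width t g (length w) * (width t g (length w) - 2) + 1 + t) 7 @ [8] @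
     replicate (t + 2 * length w + g + 1) 7"

record ntiles =
  count :: nat
  wn :: "nat \<Rightarrow> nat"
  en :: "nat \<Rightarrow> nat"
  sn :: "nat \<Rightarrow> nat"
  nn :: "nat \<Rightarrow> nat"
  ws :: "nat \<Rightarrow> nat"
  so :: "nat \<Rightarrow> nat"

text \<open>Missing neighbours count as colour 0, so the boundary conditions become additive
  constants that depend on the symbol of the cell, and all conditions are equations linear in the
  choice of tiles.\<close>

definition ntiling :: "ntiles \<Rightarrow> nat \<Rightarrow> nat list \<Rightarrow> (nat \<Rightarrow> nat) \<Rightarrow> bool" where
  "ntiling N T \<rho> \<theta> \<longleftrightarrow> (\<forall>p<T * T. \<theta> p < count N \<and>
     wn N (\<theta> p) = (if p = 0 then 0 else en N (\<theta> (p - 1))) + ws N (\<rho> ! p) \<and>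
     sn N (\<theta> p) = (if p < T then 0 else nn N (\<theta> (p - T))) + so N (\<rho> ! p))"

lemma frame_nth_syms:
  "concat (map (\<lambda>b. [4, if b then 4 else 3]) w) @ [3] = map (\<lambda>b. if b then 4 else (3 :: nat)) (frame w)"
  by (induction w) (auto simp: frame_def)

lemma length_frame [simp]: "length (frame w) = 2 * length w + 1"
  by (induction w) (auto simp: frame_def)

lemma length_row_syms: "length (row_syms t g w) = width t g (length w) * width t g (length w)"
proof -
  define T where "T = width t g (length w)"
  have "length (row_syms t g w) = 2 * t + 2 * length w + g + 3 + (T * (T - 2) + 1 + t) + 1 + (t + 2 * length w + g + 1)"
    unfolding row_syms_def T_def[symmetric]
    by (simp add: frame_nth_syms[of w, THEN arg_cong[of _ _ length], simplified] T_def[symmetric])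
  also have "\<dots> = T * (T - 2) + 2 * T" by (simp add: T_def width_def)
  also have "\<dots> = T * T"
  proof -
    obtain m where "T = Suc (Suc m)" unfolding T_def width_def by (metis add_Suc_right numeral_3_eq_3)
    then show ?thesis by simp
  qed
  finally show ?thesis by (simp add: T_def)
qed

fun vcol_of_sym :: "nat \<Rightarrow> vcol" where
  "vcol_of_sym s = (if s = 1 then VL else if s = 2 then VB else if s = 3 then VI False else if s = 4 then VI True
     else if s = 5 then VG else VR)"

context tableau
begin

lemma row_syms_spec:
  assumes "inp = frame w"
  shows "T = width \<tau> g (length w)"
    and "p < T \<Longrightarrow> row ! p = vcol_of_sym (row_syms \<tau> g w ! p) \<and> row_syms \<tau> g w ! p \<in> {1..6} \<and>
      (row_syms \<tau> g w ! p = 1 \<longleftrightarrow> p = 0)"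
    and "T \<le> p \<Longrightarrow> p < T * T \<Longrightarrow> row_syms \<tau> g w ! p = (if p = fin then 8 else 7)"
proof -
  show T: "T = width \<tau> g (length w)" 
  proof -
    have "length inp = 2 * length w + 1" using assms by simp
    then show ?thesis by (simp add: T_def width_def)
  qed
  define ini where "ini = (1 :: nat) # (replicate \<tau> 2 @ map (\<lambda>b. if b then 4 else 3) (frame w) @ replicate g 5 @
     replicate \<tau> 2 @ [6])"
  define rest where "rest = replicate (T * (T - 2) + 1 + \<tau>) 7 @ [8] @ replicate (\<tau> + 2 * length w + g + 1) (7::nat)"
  have eq: "row_syms \<tau> g w = ini @ rest"
    using frame_nth_syms[of w] by (simp add: row_syms_def ini_def rest_def T)
  have li: "length ini = T" by (simp add: ini_def T width_def)
  have "row = map vcol_of_sym ini"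
  proof -
    have "map VI inp = map (vcol_of_sym \<circ> (\<lambda>b. if b then 4 else 3)) (frame w)" using assms by simp
    then show ?thesis by (simp add: row_def ini_def)
  qed
  moreover have "set ini \<subseteq> {1..6}" "1 \<notin> set (tl ini)" by (auto simp: ini_def)
  ultimately show "row ! p = vcol_of_sym (row_syms \<tau> g w ! p) \<and> row_syms \<tau> g w ! p \<in> {1..6} \<and>
      (row_syms \<tau> g w ! p = 1 \<longleftrightarrow> p = 0)" if "p < T"
  proof -
    have "ini ! p \<in> {1..6}" using that li \<open>set ini \<subseteq> {1..6}\<close> by (metis nth_mem subsetD)
    moreover have "ini ! p = 1 \<longleftrightarrow> p = 0"
    proof (cases p)
      case (Suc p')
      then have "ini ! p = tl ini ! p'" "p' < length (tl ini)" using that li by (simp_all add: nth_tl)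
      then have "ini ! p \<in> set (tl ini)" by (metis nth_mem)
      then show ?thesis using Suc \<open>1 \<notin> set (tl ini)\<close> by auto
    qed (simp add: ini_def)
    ultimately show ?thesis using \<open>row = map vcol_of_sym ini\<close> that li
      by (auto simp: eq nth_append simp del: vcol_of_sym.simps)
  qed
  show "row_syms \<tau> g w ! p = (if p = fin then 8 else 7)" if "T \<le> p" "p < T * T"
  proof -
    obtain m where m: "T = Suc (Suc m)" unfolding T_def by auto
    have f: "fin = T + (T * (T - 2) + 1 + \<tau>)" by (simp add: fin_def m)
    have "length (row_syms \<tau> g w) = T * T" by (simp add: length_row_syms T)
    then have "p - T < length rest" using that li by (simp add: eq)
    then have "rest ! (p - T) = (if p - T = T * (T - 2) + 1 + \<tau> then 8 else 7)"
      unfolding rest_def by (auto simp: nth_append nth_Cons split: nat.splits)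
    moreover have "p - T = T * (T - 2) + 1 + \<tau> \<longleftrightarrow> p = fin" using that f by auto
    ultimately show ?thesis using that li by (simp add: eq nth_append)
  qed
qed

end

lemma tiles_VL: "x \<in> tiles M \<Longrightarrow> south x = VL \<Longrightarrow> west x = HW"
  by (auto simp: tiles_def acc_tile_def dest: run_tiles_south)

lemma finite_inj_pos:
  assumes "finite A"
  obtains f :: "'a \<Rightarrow> nat" and n where "inj_on f A" "\<And>x. x \<in> A \<Longrightarrow> 1 \<le> f x \<and> f x \<le> n"
proof -
  obtain f n where f: "f ` A = {i. i < (n :: nat)}" "inj_on f A"
    using finite_imp_inj_to_nat_seg[OF assms] by metis
  have "1 \<le> Suc (f x) \<and> Suc (f x) \<le> n" if "x \<in> A" for x
    using f(1) imageI[OF that, of f] by auto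
  moreover have "inj_on (\<lambda>x. Suc (f x)) A" using f(2) by (simp add: inj_on_def)
  ultimately show ?thesis by (rule that[rotated])
qed

text \<open>Colours are numbered from 1. That an east colour is never 0 will later force a tiled
  cell to have a tiled successor.\<close>

lemma numeric_tiles:
  obtains N where "\<And>i. i < count N \<Longrightarrow> 1 \<le> wn N i \<and> 1 \<le> en N i"
    "\<And>\<tau> g w. tableau M \<tau> (frame w) \<Longrightarrow> (\<exists>\<theta>. tableau.valid M \<tau> (frame w) g \<theta>) \<longleftrightarrow>
       (\<exists>\<theta>. ntiling N (width \<tau> g (length w)) (row_syms \<tau> g w) \<theta>)"
proof -
  obtain ts where ts: "set ts = tiles M" using finite_tiles finite_list by blast
  define Hs where "Hs = insert HW (west ` tiles M \<union> east ` tiles M)"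
  define Vs where "Vs = {VAcc} \<union> south ` tiles M \<union> north ` tiles M \<union> vcol_of_sym ` {1..6}"
  have "finite Hs" "finite Vs" by (simp_all add: Hs_def Vs_def finite_tiles)
  then obtain hn nh v0 C where hn: "inj_on hn Hs" "\<And>x. x \<in> Hs \<Longrightarrow> 1 \<le> hn x \<and> hn x \<le> (nh :: nat)"
    and v0: "inj_on v0 Vs" "\<And>x. x \<in> Vs \<Longrightarrow> 1 \<le> v0 x \<and> v0 x \<le> (C :: nat)"
    by (metis finite_inj_pos)
  text \<open>As \<open>vn VFin\<close> exceeds all other colours, adding \<open>C\<close> to the colour above a cell requires
    \<open>VAcc\<close> above and \<open>VFin\<close> below.\<close>
  define vn where "vn v = (if v = VFin then C + v0 VAcc else v0 v)" for v
  define N where "N = \<lparr>count = length ts, wn = (\<lambda>i. hn (west (ts ! i))), en = (\<lambda>i. hn (east (ts ! i))),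
    sn = (\<lambda>i. vn (south (ts ! i))), nn = (\<lambda>i. vn (north (ts ! i))),
    ws = (\<lambda>s. if s = 1 then hn HW else 0),
    so = (\<lambda>s. if s = 7 then 0 else if s = 8 then C else vn (vcol_of_sym s))\<rparr>"
  have ts_in: "ts ! i \<in> tiles M" if "i < length ts" for i using that ts nth_mem by blast
  have hH: "west x \<in> Hs" "east x \<in> Hs" if "x \<in> tiles M" for x using that by (auto simp: Hs_def)
  have vV: "south x \<in> Vs" "north x \<in> Vs" if "x \<in> tiles M" for x using that by (auto simp: Vs_def)
  have v_eq: "vn (south x) = vn v \<longleftrightarrow> south x = v" if "x \<in> tiles M" "v \<in> Vs" "v \<noteq> VFin" for x v
  proof -
    have "v0 v \<le> C" "1 \<le> v0 VAcc" using v0(2)[of v] v0(2)[of VAcc] that by (auto simp: Vs_def)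
    then show ?thesis using that v0(1) vV[of x] by (auto simp: vn_def inj_on_def)
  qed
  have fin_eq: "vn (south x) = vn (north y) + C \<longleftrightarrow> north y = VAcc \<and> south x = VFin"
    if "x \<in> tiles M" "y \<in> tiles M" for x y
  proof -
    have "VAcc \<in> Vs" by (simp add: Vs_def)
    then have "v0 (north y) = v0 VAcc \<longleftrightarrow> north y = VAcc" using v0(1) vV[OF that(2)] by (auto simp: inj_on_def)
    moreover have "v0 (south x) \<le> C" "1 \<le> v0 (north y)" using v0(2) vV that by auto
    ultimately show ?thesis using tiles_north_not_VFin[OF that(2)] by (auto simp: vn_def)
  qed
  show ?thesis
  proof (rule that[of N])
    show "1 \<le> wn N i \<and> 1 \<le> en N i" if "i < count N" for i
      using that ts_in hn(2) hH by (simp add: N_def)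
    fix \<tau> g w assume tab: "tableau M \<tau> (frame w)"
    interpret tableau M \<tau> "frame w" g by fact
    let ?\<rho> = "row_syms \<tau> g w"
    note rs = row_syms_spec[OF refl]
    have key: "valid (\<lambda>p. ts ! (\<theta> p)) \<longleftrightarrow> ntiling N T ?\<rho> \<theta>" if "\<And>p. p < T * T \<Longrightarrow> \<theta> p < length ts" for \<theta>
      unfolding valid_def ntiling_def
    proof (intro all_cong)
      fix p assume p: "p < T * T"
      let ?x = "\<lambda>p. ts ! (\<theta> p)"
      have xp: "?x p \<in> tiles M" using ts_in that p by blast
      have xq: "?x (p - q) \<in> tiles M" for q using ts_in[OF that[of "p - q"]] p by simp
      have "(0 < p \<longrightarrow> east (?x (p - 1)) = west (?x p)) \<and> (if p < T then south (?x p) = row ! p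
        else if p = fin then north (?x (p - T)) = VAcc \<and> south (?x p) = VFin else north (?x (p - T)) = south (?x p)) \<longleftrightarrow>
        hn (west (?x p)) = (if p = 0 then 0 else hn (east (?x (p - 1)))) + ws N (?\<rho> ! p) \<and>
        vn (south (?x p)) = (if p < T then 0 else vn (north (?x (p - T)))) + so N (?\<rho> ! p)"
        (is "?A \<and> ?B \<longleftrightarrow> ?A' \<and> ?B'")
      proof -
        have B: "?B \<longleftrightarrow> ?B'"
        proof (cases "p < T")
          case True
          let ?v = "vcol_of_sym (?\<rho> ! p)"
          from rs(2)[OF True] have s: "row ! p = ?v" "?\<rho> ! p \<in> {1..6}" by auto
          then have "?v \<in> Vs" "?v \<noteq> VFin" "?\<rho> ! p \<noteq> 7" "?\<rho> ! p \<noteq> 8" by (auto simp: Vs_def)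
          then have "so N (?\<rho> ! p) = vn ?v" by (simp add: N_def del: vcol_of_sym.simps)
          then show ?thesis using True s(1) v_eq[OF xp \<open>?v \<in> Vs\<close> \<open>?v \<noteq> VFin\<close>]
            by (simp del: vcol_of_sym.simps)
        next
          case False
          then have s: "?\<rho> ! p = (if p = fin then 8 else 7)" using rs(3) p by simp
          show ?thesis
          proof (cases "p = fin")
            case True
            then show ?thesis using False s fin_eq[OF xp xq[of T]] by (simp add: N_def)
          next
            case nf: False
            then show ?thesis using False s v_eq[OF xp vV(2)[OF xq[of T]] tiles_north_not_VFin[OF xq[of T]]]
              by (auto simp: N_def)
          qed
        qed
        \<comment> \<open>For \<open>p = 0\<close> the tiling does not constrain the west edge while
          the equation demands the number of \<open>HW\<close>. They agree because \<open>VL\<close>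
          below occurs only with \<open>HW\<close> to the west, which is why \<open>?B\<close> is
          assumed.\<close>
        have A: "?A \<longleftrightarrow> ?A'" if ?B
        proof (cases "p = 0")
          case True
          have "0 < T" by (simp add: T_def)
          then have "?\<rho> ! 0 = 1" "row ! 0 = VL" using rs(2)[of 0] row_nth(1) by auto
          then have "west (?x p) = HW" using tiles_VL[OF xp] that True \<open>0 < T\<close> by simp
          then show ?thesis using True \<open>?\<rho> ! 0 = 1\<close> by (simp add: N_def)
        next
          case False
          have "?\<rho> ! p \<noteq> 1" using rs(2)[of p] rs(3)[of p] False p by (cases "p < T") auto
          then have "ws N (?\<rho> ! p) = 0" by (simp add: N_def)
          moreover have "hn (west (?x p)) = hn (east (?x (p - 1))) \<longleftrightarrow> west (?x p) = east (?x (p - 1))"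
            using hn(1) hH[OF xp] hH[OF xq[of 1]] by (auto simp: inj_on_def)
          ultimately show ?thesis using False by auto
        qed
        show ?thesis using A B by blast
      qed
      then show "(ts ! \<theta> p \<in> tiles M \<and> (0 < p \<longrightarrow> east (?x (p - 1)) = west (?x p)) \<and>
        (if p < T then south (?x p) = row ! p else if p = fin then north (?x (p - T)) = VAcc \<and> south (?x p) = VFin
         else north (?x (p - T)) = south (?x p))) \<longleftrightarrow>
        (\<theta> p < count N \<and> wn N (\<theta> p) = (if p = 0 then 0 else en N (\<theta> (p - 1))) + ws N (?\<rho> ! p) \<and>
         sn N (\<theta> p) = (if p < T then 0 else nn N (\<theta> (p - T))) + so N (?\<rho> ! p))"
        using xp that[OF p] by (simp add: N_def)
    qed
    show "(\<exists>\<theta>. valid \<theta>) \<longleftrightarrow> (\<exists>\<theta>. ntiling N (width \<tau> g (length w)) ?\<rho> \<theta>)"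
    proof
      assume "\<exists>\<theta>. valid \<theta>"
      then obtain \<theta> where v: "valid \<theta>" by blast
      have "\<forall>p. \<exists>i. p < T * T \<longrightarrow> i < length ts \<and> ts ! i = \<theta> p"
        using validD(1)[OF v] ts by (metis in_set_conv_nth)
      then obtain \<theta>' where \<theta>': "\<And>p. p < T * T \<Longrightarrow> \<theta>' p < length ts \<and> ts ! (\<theta>' p) = \<theta> p" by metis
      have "valid (\<lambda>p. ts ! (\<theta>' p))"
        using v \<theta>' unfolding valid_def by (smt (verit) less_imp_diff_less)
      then show "\<exists>\<theta>. ntiling N (width \<tau> g (length w)) ?\<rho> \<theta>" using key[of \<theta>'] \<theta>' rs(1) by auto
    next
      assume "\<exists>\<theta>. ntiling N (width \<tau> g (length w)) ?\<rho> \<theta>"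
      then obtain \<theta> where t: "ntiling N T ?\<rho> \<theta>" using rs(1) by auto
      then have "\<theta> p < length ts" if "p < T * T" for p using that by (simp add: ntiling_def N_def)
      then show "\<exists>\<theta>. valid \<theta>" using key[of \<theta>] t by blast
    qed
  qed
qed

subsection \<open>Languages in NP as tiling problems\<close>

lemma act_head:
  assumes "wf_tm M" "wf_conf M cfg" "\<And>t. t \<in> set (snd cfg) \<Longrightarrow> \<bar>snd t\<bar> \<le> b"
    "t \<in> set (snd (step None M cfg))"
  shows "\<bar>snd t\<bar> \<le> b + 1"
proof -
  obtain q ts where c: "cfg = (q, ts)" by fastforce
  have q: "q < states M" "length ts = tapes M" using assms(2) by (auto simp: wf_conf_def c)
  have ss: "map scan ts \<in> sym_lists M" using scan_sym_lists[OF assms(2)] c by simp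
  note d = wf_delta'[OF assms(1) q(1) ss]
  obtain j where j: "j < tapes M" "t = act (snd (delta' M q (map scan ts)) ! j) (ts ! j)"
    using assms(4) q d(2) unfolding c step_delta' by (auto simp: set_zip)
  have "\<bar>snd (ts ! j)\<bar> \<le> b" using assms(3)[of "ts ! j"] j q c by simp
  then show ?thesis using j d(3)[OF j(1)] by (auto simp: act_def)
qed

lemma (in tableau) run_heads: "t \<in> set (snd (run u n)) \<Longrightarrow> \<bar>snd t\<bar> \<le> int n"
proof (induction n arbitrary: t)
  case 0
  then show ?case by (auto simp: run_0 init_config_def tape_of_def)
next
  case (Suc n)
  show ?case using act_head[OF wf wf_run[of u n] Suc.IH] Suc.prems by (fastforce simp: run_Suc)
qed

lemma (in tableau) run_halted:
  assumes "fst (run u m) = halt_state" "m \<le> n"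
  shows "run u n = run u m"
  using assms(2)
proof (induction n rule: dec_induct)
  case (step n)
  then show ?case using assms(1) by (cases "run u m") (simp add: run_Suc step_def)
qed simp

text \<open>Every \<open>\<tau>\<close> above the bound works, since a halted machine stays as it
  is. This freedom is used later to make the grid larger than the numbers of the instance.\<close>

lemma NP_tiling:
  assumes "in_NP L"
  obtains N g \<tau>0 where "\<And>i. i < count N \<Longrightarrow> 1 \<le> wn N i \<and> 1 \<le> en N i"
    "\<And>\<tau> w. poly \<tau>0 (length w) \<le> \<tau> \<Longrightarrow> w \<in> L \<longleftrightarrow>
       (\<exists>\<theta>. ntiling N (width \<tau> (poly g (length w)) (length w)) (row_syms \<tau> (poly g (length w)) w) \<theta>)"
proof -
  obtain V and g :: "nat poly" where V: "in_P V"
    and L: "\<And>w. w \<in> L \<longleftrightarrow> (\<exists>u. length u \<le> poly g (length w) \<and> frame w @ u \<in> V)"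
    using assms unfolding in_NP_def by blast
  obtain M and Q :: "nat poly" where M: "wf_tm M"
    and out: "\<And>x. outputs_within None M x (poly Q (length x)) [x \<in> V]"
    using V unfolding in_P_def polytime_def by blast
  obtain N where N: "\<And>i. i < count N \<Longrightarrow> 1 \<le> wn N i \<and> 1 \<le> en N i"
    "\<And>\<tau> g w. tableau M \<tau> (frame w) \<Longrightarrow> (\<exists>\<theta>. tableau.valid M \<tau> (frame w) g \<theta>) \<longleftrightarrow>
       (\<exists>\<theta>. ntiling N (width \<tau> g (length w)) (row_syms \<tau> g w) \<theta>)"
    using numeric_tiles[of M] by blast
  \<comment> \<open>The time of the verifier on \<open>frame w\<close> followed by a longest
    certificate, which has length \<open>2 * l + 1 + poly g l\<close> for
    \<open>l = length w\<close>, plus 1 for a strict inequality.\<close>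
  define \<tau>0 where "\<tau>0 = pcompose Q ([:1, 2:] + g) + 1"
  show ?thesis
  proof (rule that[OF N(1)])
    fix \<tau> and w :: "bool list" assume \<tau>: "poly \<tau>0 (length w) \<le> \<tau>"
    let ?g = "poly g (length w)"
    have \<tau>': "poly Q (2 * length w + 1 + ?g) + 1 \<le> \<tau>"
      using \<tau> by (simp add: \<tau>0_def poly_pcompose mult_2 mult_2_right ac_simps)
    interpret tableau M \<tau> "frame w" ?g
      by unfold_locales (use M \<tau>' in \<open>auto simp: frame_def\<close>)
    have halts: "\<exists>m<\<tau>. fst (run u m) = halt_state \<and> (fst (snd (run u m) ! 0) 0 = 2 \<longleftrightarrow> frame w @ u \<in> V)"
      if u: "length u \<le> ?g" for u
    proof -
      obtain m ts where m: "m \<le> poly Q (length (frame w @ u))"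
        "(step None M ^^ m) (init_config M (frame w @ u)) = (halt_state, ts)"
        "tape_string (ts ! 0) = [frame w @ u \<in> V]"
        using out[of "frame w @ u"] unfolding outputs_within_def by blast
      have "poly Q (length (frame w @ u)) \<le> poly Q (2 * length w + 1 + ?g)"
        using u by (intro poly_nat_mono) simp
      then have "m < \<tau>" using m(1) \<tau>' by simp
      moreover have "run u m = (halt_state, ts)" using m(2) by (simp add: run_def)
      \<comment> \<open>The output string has length 1, so the answer is decided by cell 0
        alone.\<close>
      moreover have "fst (ts ! 0) 0 = 2 \<longleftrightarrow> frame w @ u \<in> V"
      proof -
        obtain n where n: "tape_string (ts ! 0) = map (\<lambda>j. fst (ts ! 0) (int j) = 2) [0..<n]"
          unfolding tape_string_def by blast
        then have "n = 1" using m(3) by (metis length_Cons length_map length_upt list.size(3) minus_nat.diff_0 One_nat_def)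
        then show ?thesis using n m(3) by simp
      qed
      ultimately show ?thesis by auto
    qed
    have T: "\<tau> \<le> T - 3" by (simp add: T_def)
    have acc: "fst (run u (T - 3)) = halt_state" "fst (snd (run u (T - 3)) ! 0) 0 = 2 \<longleftrightarrow> frame w @ u \<in> V"
      and heads: "\<And>t tp. tp \<in> set (snd (run u t)) \<Longrightarrow> \<bar>snd tp\<bar> < int \<tau>" if u: "length u \<le> ?g" for u
    proof -
      obtain m where m: "m < \<tau>" "fst (run u m) = halt_state" "fst (snd (run u m) ! 0) 0 = 2 \<longleftrightarrow> frame w @ u \<in> V"
        using halts[OF u] by blast
      have "run u (T - 3) = run u m" using m(1) T by (intro run_halted m(2)) simp
      then show "fst (run u (T - 3)) = halt_state" "fst (snd (run u (T - 3)) ! 0) 0 = 2 \<longleftrightarrow> frame w @ u \<in> V"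
        using m by simp_all
      fix t tp assume tp: "tp \<in> set (snd (run u t))"
      show "\<bar>snd tp\<bar> < int \<tau>"
      proof (cases "m \<le> t")
        case True
        then have "tp \<in> set (snd (run u m))" using tp run_halted[OF m(2) True] by simp
        then show ?thesis using run_heads[of tp u m] m(1) by simp
      next
        case False
        then show ?thesis using run_heads[OF tp] m(1) by simp
      qed
    qed
    have "w \<in> L \<longleftrightarrow> (\<exists>\<theta>. valid \<theta>)"
    proof
      assume "w \<in> L"
      then obtain u where u: "length u \<le> ?g" "frame w @ u \<in> V" using L by blast
      show "\<exists>\<theta>. valid \<theta>" using complete[OF u(1) heads[OF u(1)]] acc[OF u(1)] u(2) by simp
    next
      assume "\<exists>\<theta>. valid \<theta>"
      then obtain \<theta> where "valid \<theta>" by blast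
      then have "\<exists>u. length u \<le> ?g \<and> fst (run u (T - 3)) = halt_state \<and> fst (snd (run u (T - 3)) ! 0) 0 = 2"
        by (rule sound) (rule heads)
      then obtain u where "length u \<le> ?g" "fst (snd (run u (T - 3)) ! 0) 0 = 2" by blast
      then show "w \<in> L" using acc(2) L by blast
    qed
    then show "w \<in> L \<longleftrightarrow> (\<exists>\<theta>. ntiling N (width \<tau> ?g (length w)) (row_syms \<tau> ?g w) \<theta>)"
      using N(2)[OF tableau_axioms, of ?g] by simp
  qed
qed

subsection \<open>Tilings as lattice points in the unit ball\<close>

text \<open>Each cell of the tiling has \<open>2 * q\<close> coordinates, where \<open>q = 4 * b\<^sup>2\<close>. The first \<open>q\<close> of them stand for 0/1
  variables: slot 0 says whether the grid is tiled at all, and slot \<open>i + 1\<close> whether tile \<open>i\<close> is used. These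
  coordinates are \<open>(m - 1/2) / k\<close> for an integer \<open>m\<close>, so already their contribution to the squared norm is at least 1,
  with equality if and only if all of them are \<open>\<plusminus>1/(2k)\<close>. All other coordinates of a point of the
  unit ball are therefore 0; three of them per cell express, modulo a large number, the constraints of the tiling.\<close>

datatype num = Num int | InvK | NegHalf

fun val :: "nat \<Rightarrow> num \<Rightarrow> rat" where
  "val k (Num z) = of_int z"
| "val k InvK = 1 / of_nat k"
| "val k NegHalf = - 1 / of_nat (2 * k)"

text \<open>Strictly larger than the absolute value of every residual of a 0/1 assignment. A
  residual that is a multiple of it is therefore 0.\<close>

definition modulus :: "ntiles \<Rightarrow> nat" where
  "modulus N = 3 + count N + (\<Sum>i<count N. wn N i + en N i + sn N i + nn N i) + (\<Sum>a\<le>8. ws N a + so N a)"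

text \<open>Entry \<open>s'\<close> of the block of a cell in the basis vector for slot \<open>s\<close> of another cell with symbol \<open>a\<close>: \<open>z\<close>
  tells how the first cell lies relative to the second (1 same cell, 2 next in the row, 3 above, otherwise unrelated).\<close>

definition entry :: "ntiles \<Rightarrow> nat \<Rightarrow> nat \<Rightarrow> nat \<Rightarrow> nat \<Rightarrow> nat \<Rightarrow> num" where
  "entry N q a z s s' =
    (if z = 1 then
       if s = s' then if s < q then InvK else Num (int (modulus N))
       else if s' = q \<and> s \<le> count N then Num (if s = 0 then -1 else 1)
       else if s' = q + 1 \<and> s \<le> count N then Num (if s = 0 then - int (ws N a) else int (wn N (s - 1)))
       else if s' = q + 2 \<and> s \<le> count N then Num (if s = 0 then - int (so N a) else int (sn N (s - 1)))
       else Num 0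
     else if z = 2 \<and> s' = q + 1 \<and> 1 \<le> s \<and> s \<le> count N then Num (- int (en N (s - 1)))
     else if z = 3 \<and> s' = q + 2 \<and> 1 \<le> s \<and> s \<le> count N then Num (- int (nn N (s - 1)))
     else Num 0)"

definition rel :: "nat \<Rightarrow> nat \<Rightarrow> nat \<Rightarrow> nat" where
  "rel T p p' = (if p' = p then 1 else if p' = p + 1 then 2 else if p' = p + T then 3 else 0)"

lemma sum_add_upper: "(\<Sum>i<a + (b::nat). f i) = (\<Sum>i<a. f i) + (\<Sum>i<b. f (a + i) :: 'a :: comm_monoid_add)"
  by (induction b) (auto simp: add.assoc)

lemma sum_blocks: "(\<Sum>i<P * (D::nat). f i) = (\<Sum>p<P. \<Sum>s<D. f (p * D + s) :: 'a :: comm_monoid_add)"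
proof (induction P)
  case (Suc P)
  have "(\<Sum>i<Suc P * D. f i) = (\<Sum>i<P * D + D. f i)" by (simp add: add.commute)
  then show ?case using Suc by (simp add: sum_add_upper)
qed simp

lemma sum_shift_range:
  assumes "m < n"
  shows "(\<Sum>s<n. if 1 \<le> s \<and> s \<le> m then f s else 0) = (\<Sum>i<m. f (Suc i) :: 'a :: comm_monoid_add)"
proof -
  have "(\<Sum>s<n. if 1 \<le> s \<and> s \<le> m then f s else 0) = sum f {s \<in> {..<n}. 1 \<le> s \<and> s \<le> m}"
    by (subst sum.inter_filter[symmetric]) auto
  also have "{s \<in> {..<n}. 1 \<le> s \<and> s \<le> m} = Suc ` {..<m}" using assms by (auto simp: image_Suc_lessThan)
  also have "sum f (Suc ` {..<m}) = (\<Sum>i<m. f (Suc i))" by (subst sum.reindex) auto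
  finally show ?thesis .
qed

locale lattice =
  fixes N :: ntiles and b T :: nat and \<rho> :: "nat list"
  assumes b: "1 \<le> b" and T: "2 \<le> T" and count: "count N < 4 * b * b"
    and pos: "\<And>i. i < count N \<Longrightarrow> 1 \<le> wn N i \<and> 1 \<le> en N i"
    and rho: "\<And>p. p < T * T \<Longrightarrow> \<rho> ! p \<le> 8"
begin

text \<open>The constants are balanced: there are \<open>T * T * q\<close> coordinates of absolute
  value at least \<open>1 / (2 * k)\<close>, and \<open>T * T * q / (4 * k * k) = 1\<close>.\<close>

definition q where "q = 4 * b * b"
definition D where "D = 2 * q"
definition k where "k = b * T"
definition dim where "dim = T * T * D"

definition Bas :: "nat \<Rightarrow> nat \<Rightarrow> rat" where
  "Bas i j = val k (entry N q (\<rho> ! (i div D)) (rel T (i div D) (j div D)) (i mod D) (j mod D))"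

definition Off :: "nat \<Rightarrow> rat" where
  "Off j = (if j mod D < q then val k NegHalf else 0)"

definition inst :: mitr where
  "inst = \<lparr>n_of = dim, p_of = dim, H_of = 0\<^sub>m dim dim, h_of = vec dim (\<lambda>i. if i = 0 then -1 else 0),
     c_of = vec dim Off, basis_of = map (\<lambda>i. vec dim (Bas i)) [0..<dim]\<rparr>"

lemma q_pos: "4 \<le> q"
  using b by (simp add: q_def)

lemma D_pos: "0 < D"
  using q_pos by (simp add: D_def)

lemma k_pos: "0 < k"
  using b T by (simp add: k_def)

lemma dim_pos: "0 < dim"
  using T D_pos by (simp add: dim_def)

lemma slot: "s < D \<Longrightarrow> (p * D + s) div D = p" "s < D \<Longrightarrow> (p * D + s) mod D = s"
  by auto

section \<open>Coordinates and norm of a lattice point\<close>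

definition point :: "(nat \<Rightarrow> nat \<Rightarrow> int) \<Rightarrow> nat \<Rightarrow> rat" where
  "point m j = (\<Sum>p<T * T. \<Sum>s<D. of_int (m p s) * Bas (p * D + s) j) + Off j"

text \<open>The equations of cell \<open>p\<close>, homogeneous thanks to slot 0: for
  \<open>r = 0\<close>, the number of chosen tiles equals slot 0; for \<open>r = 1\<close> and
  \<open>r = 2\<close>, the west and south colours match the neighbours.\<close>

definition resid :: "(nat \<Rightarrow> nat \<Rightarrow> int) \<Rightarrow> nat \<Rightarrow> nat \<Rightarrow> int" where
  "resid m p r =
    (if r = 0 then - m p 0 + (\<Sum>i<count N. m p (Suc i))
     else if r = 1 then - m p 0 * int (ws N (\<rho> ! p)) + (\<Sum>i<count N. m p (Suc i) * int (wn N i))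
       - (if p = 0 then 0 else \<Sum>i<count N. m (p - 1) (Suc i) * int (en N i))
     else if r = 2 then - m p 0 * int (so N (\<rho> ! p)) + (\<Sum>i<count N. m p (Suc i) * int (sn N i))
       - (if p < T then 0 else \<Sum>i<count N. m (p - T) (Suc i) * int (nn N i))
     else 0)"

lemma point_low:
  assumes "p < T * T" "s < q"
  shows "point m (p * D + s) = (of_int (m p s) - 1 / 2) / of_nat k"
proof -
  have s: "s < D" using assms by (simp add: D_def)
  have "(\<Sum>p'<T * T. \<Sum>s'<D. of_int (m p' s') * Bas (p' * D + s') (p * D + s)) =
     (\<Sum>p'<T * T. \<Sum>s'<D. if p' = p \<and> s' = s then of_int (m p s) / of_nat k else 0)"
  proof (intro sum.cong refl)
    fix p' s' assume "s' \<in> {..<D}"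
    then show "of_int (m p' s') * Bas (p' * D + s') (p * D + s) =
        (if p' = p \<and> s' = s then of_int (m p s) / of_nat k else 0)"
      using assms(2) s by (auto simp: Bas_def slot entry_def rel_def)
  qed
  also have "\<dots> = (\<Sum>p'<T * T. if p' = p then of_int (m p s) / of_nat k else 0)"
    using s by (intro sum.cong refl) auto
  also have "\<dots> = of_int (m p s) / of_nat k" using assms(1) by simp
  finally show ?thesis using assms(2) s k_pos by (simp add: point_def Off_def slot field_simps)
qed

lemma sum_slots:
  assumes "\<And>s. s < D \<Longrightarrow> f s = (if s = s' then A else 0) + (if s = 0 then B else 0) +
      (if 1 \<le> s \<and> s \<le> count N then g s else (0 :: rat))" "s' < D"
  shows "(\<Sum>s<D. f s) = A + B + (\<Sum>i<count N. g (Suc i))"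
proof -
  have cD: "count N < D" using count by (simp add: D_def q_def)
  have "(\<Sum>s<D. f s) = (\<Sum>s<D. (if s = s' then A else 0) + (if s = 0 then B else 0) +
      (if 1 \<le> s \<and> s \<le> count N then g s else 0))"
    using assms(1) by (intro sum.cong) auto
  also have "\<dots> = A + B + (\<Sum>i<count N. g (Suc i))"
    using assms(2) D_pos by (simp add: sum.distrib sum_shift_range[OF cD, simplified])
  finally show ?thesis .
qed

text \<open>Such a coordinate receives contributions from the vectors of the cell itself, of its
  predecessor in the chain and of the cell \<open>T\<close> places earlier.\<close>

lemma point_high:
  assumes p: "p < T * T" and r: "r < q"
  shows "point m (p * D + (q + r)) = of_int (int (modulus N) * m p (q + r) + resid m p r)"
proof -
  have s: "q + r < D" using r by (simp add: D_def)
  have cq: "count N < q" using count by (simp add: q_def)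
  define F where "F p' = (\<Sum>s'<D. of_int (m p' s') * Bas (p' * D + s') (p * D + (q + r)))" for p'
  define E where "E = (if r = 1 \<and> 1 \<le> p then - (\<Sum>i<count N. of_int (m (p - 1) (Suc i)) * of_nat (en N i)) else (0 :: rat))"
  define U where "U = (if r = 2 \<and> T \<le> p then - (\<Sum>i<count N. of_int (m (p - T) (Suc i)) * of_nat (nn N i)) else (0 :: rat))"
  define C where "C = of_nat (modulus N) * of_int (m p (q + r)) + (if r = 0 then - of_int (m p 0) + (\<Sum>i<count N. of_int (m p (Suc i)))
     else if r = 1 then - of_int (m p 0) * of_nat (ws N (\<rho> ! p)) + (\<Sum>i<count N. of_int (m p (Suc i)) * of_nat (wn N i))
     else if r = 2 then - of_int (m p 0) * of_nat (so N (\<rho> ! p)) + (\<Sum>i<count N. of_int (m p (Suc i)) * of_nat (sn N i))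
     else (0 :: rat))"
  have F1: "F p = C"
  proof -
    define g where "g s = (if r = 0 then of_int (m p s) else if r = 1 then of_int (m p s) * of_nat (wn N (s - 1))
       else if r = 2 then of_int (m p s) * of_nat (sn N (s - 1)) else (0 :: rat))" for s
    have "F p = of_nat (modulus N) * of_int (m p (q + r)) +
      (if r = 0 then - of_int (m p 0) else if r = 1 then - of_int (m p 0) * of_nat (ws N (\<rho> ! p))
       else if r = 2 then - of_int (m p 0) * of_nat (so N (\<rho> ! p)) else 0) + (\<Sum>i<count N. g (Suc i))"
      unfolding F_def
      by (rule sum_slots[OF _ s, where g = g]) (use s cq r q_pos in \<open>auto simp: Bas_def slot entry_def rel_def g_def\<close>)
    then show ?thesis by (simp add: C_def g_def)
  qed
  have F2: "F p' = E" if "p' + 1 = p" for p'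
  proof -
    define g where "g s = (if r = 1 then - of_int (m p' s) * of_nat (en N (s - 1)) else (0 :: rat))" for s
    have "F p' = 0 + 0 + (\<Sum>i<count N. g (Suc i))"
      unfolding F_def
      by (rule sum_slots[OF _ s, where g = g]) (use that s cq T in \<open>auto simp: Bas_def slot entry_def rel_def g_def\<close>)
    then show ?thesis using that by (auto simp: E_def g_def sum_negf)
  qed
  have F3: "F p' = U" if "p' + T = p" for p'
  proof -
    define g where "g s = (if r = 2 then - of_int (m p' s) * of_nat (nn N (s - 1)) else (0 :: rat))" for s
    have "F p' = 0 + 0 + (\<Sum>i<count N. g (Suc i))"
      unfolding F_def
      by (rule sum_slots[OF _ s, where g = g]) (use that s cq T in \<open>auto simp: Bas_def slot entry_def rel_def g_def\<close>)
    then show ?thesis using that by (auto simp: U_def g_def sum_negf)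
  qed
  have F0: "F p' = 0" if "p' \<noteq> p" "p' + 1 \<noteq> p" "p' + T \<noteq> p" for p'
    unfolding F_def
    by (rule sum.neutral) (use that s in \<open>auto simp: Bas_def slot entry_def rel_def\<close>)
  \<comment> \<open>The inner conditions guard against truncated subtraction, which would make
    \<open>p - 1\<close> or \<open>p - T\<close> a cell without this relation to
    \<open>p\<close>.\<close>
  have "(\<Sum>p'<T * T. F p') = (\<Sum>p'<T * T. (if p' = p then C else 0) +
     (if p' = p - 1 then if 1 \<le> p then E else 0 else 0) + (if p' = p - T then if T \<le> p then U else 0 else 0))"
  proof (intro sum.cong refl)
    fix p' assume "p' \<in> {..<T * T}"
    consider "p' = p" | "p' + 1 = p" | "p' + T = p" | "p' \<noteq> p" "p' + 1 \<noteq> p" "p' + T \<noteq> p" by blast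
    then show "F p' = (if p' = p then C else 0) +
     (if p' = p - 1 then if 1 \<le> p then E else 0 else 0) + (if p' = p - T then if T \<le> p then U else 0 else 0)"
      using T F0 F1 F2 F3 by cases auto
  qed
  also have "\<dots> = C + (if 1 \<le> p then E else 0) + (if T \<le> p then U else 0)"
    using p by (simp add: sum.distrib) linarith
  finally show ?thesis using s q_pos r
    by (auto simp: point_def F_def[symmetric] Off_def slot resid_def C_def E_def U_def sum_negf)
qed

definition sqnorm :: "(nat \<Rightarrow> nat \<Rightarrow> int) \<Rightarrow> rat" where
  "sqnorm m = (\<Sum>j<dim. (point m j)\<^sup>2)"

text \<open>The square of \<open>m - 1/2\<close> is \<open>1/4 + m * (m - 1)\<close>, and
  \<open>m * (m - 1)\<close> is nonnegative for integers and vanishes only at 0 and 1. So the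
  squared norm is 1 plus nonnegative terms, all of which must be 0.\<close>

lemma sqnorm_le_1:
  "sqnorm m \<le> 1 \<longleftrightarrow> (\<forall>p<T * T. (\<forall>s<q. m p s \<in> {0, 1}) \<and>
     (\<forall>r<q. int (modulus N) * m p (q + r) + resid m p r = 0))"
proof -
  define A where "A p s = (of_int (m p s * (m p s - 1)) :: rat) / (of_nat k)\<^sup>2" for p s
  define B where "B p r = (of_int (int (modulus N) * m p (q + r) + resid m p r) :: rat)\<^sup>2" for p r
  have A0: "0 \<le> A p s" and A_eq: "A p s = 0 \<longleftrightarrow> m p s \<in> {0, 1}" for p s
  proof -
    have "0 \<le> m p s * (m p s - 1)"
      by (cases "m p s \<le> 0") (auto intro: mult_nonpos_nonpos)
    then show "0 \<le> A p s" unfolding A_def by (intro divide_nonneg_nonneg) (auto simp: of_int_0_le_iff simp del: of_int_mult of_int_diff)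
    show "A p s = 0 \<longleftrightarrow> m p s \<in> {0, 1}" using k_pos by (auto simp: A_def)
  qed
  have "sqnorm m = (\<Sum>p<T * T. \<Sum>s<D. (point m (p * D + s))\<^sup>2)"
    unfolding sqnorm_def dim_def by (rule sum_blocks)
  also have "\<dots> = (\<Sum>p<T * T. (\<Sum>s<q. 1 / (4 * (of_nat k)\<^sup>2) + A p s) + (\<Sum>r<q. B p r))"
  proof (intro sum.cong refl)
    fix p assume p: "p \<in> {..<T * T}"
    have "(\<Sum>s<D. (point m (p * D + s))\<^sup>2) =
        (\<Sum>s<q. (point m (p * D + s))\<^sup>2) + (\<Sum>r<q. (point m (p * D + (q + r)))\<^sup>2)"
      using sum_add_upper[of "\<lambda>s. (point m (p * D + s))\<^sup>2" q q] by (simp add: D_def mult_2)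
    also have "(\<Sum>s<q. (point m (p * D + s))\<^sup>2) = (\<Sum>s<q. 1 / (4 * (of_nat k)\<^sup>2) + A p s)"
    proof (intro sum.cong refl)
      fix s assume "s \<in> {..<q}"
      then have "point m (p * D + s) = (of_int (m p s) - 1 / 2) / of_nat k" using p by (simp add: point_low)
      moreover have "((of_int (m p s) - 1 / 2) / of_nat k)\<^sup>2 = 1 / (4 * (of_nat k)\<^sup>2) + A p s"
        using k_pos by (simp add: A_def field_simps power2_eq_square)
      ultimately show "(point m (p * D + s))\<^sup>2 = 1 / (4 * (of_nat k)\<^sup>2) + A p s" by simp
    qed
    also have "(\<Sum>r<q. (point m (p * D + (q + r)))\<^sup>2) = (\<Sum>r<q. B p r)"
      using p by (intro sum.cong refl) (simp add: point_high B_def)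
    finally show "(\<Sum>s<D. (point m (p * D + s))\<^sup>2) = (\<Sum>s<q. 1 / (4 * (of_nat k)\<^sup>2) + A p s) + (\<Sum>r<q. B p r)" .
  qed
  also have "\<dots> = 1 + (\<Sum>p<T * T. (\<Sum>s<q. A p s) + (\<Sum>r<q. B p r))"
  proof -
    have "of_nat (T * T) * (of_nat q * (1 / (4 * (of_nat k)\<^sup>2))) = (1 :: rat)"
      using b T by (simp add: q_def k_def power2_eq_square field_simps)
    then show ?thesis using T q_pos by (simp add: sum.distrib add.assoc)
  qed
  finally have "sqnorm m \<le> 1 \<longleftrightarrow> (\<Sum>p<T * T. (\<Sum>s<q. A p s) + (\<Sum>r<q. B p r)) \<le> 0" by simp
  also have "\<dots> \<longleftrightarrow> (\<Sum>p<T * T. (\<Sum>s<q. A p s) + (\<Sum>r<q. B p r)) = 0"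
    using A0 by (auto intro!: antisym sum_nonneg add_nonneg_nonneg simp: B_def)
  also have "\<dots> \<longleftrightarrow> (\<forall>p<T * T. (\<Sum>s<q. A p s) + (\<Sum>r<q. B p r) = 0)"
    using A0 by (subst sum_nonneg_eq_0_iff) (auto intro!: sum_nonneg add_nonneg_nonneg simp: B_def)
  also have "\<dots> \<longleftrightarrow> (\<forall>p<T * T. (\<Sum>s<q. A p s) = 0 \<and> (\<Sum>r<q. B p r) = 0)"
    using A0 by (subst add_nonneg_eq_0_iff) (auto intro!: sum_nonneg simp: B_def)
  also have "\<dots> \<longleftrightarrow> (\<forall>p<T * T. (\<forall>s<q. A p s = 0) \<and> (\<forall>r<q. B p r = 0))"
    using A0 by (subst (1 2) sum_nonneg_eq_0_iff) (auto simp: B_def)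
  finally show ?thesis unfolding A_eq B_def zero_eq_power2 of_int_eq_0_iff .
qed

lemma resid_small:
  assumes m: "\<And>p s. p < T * T \<Longrightarrow> s < q \<Longrightarrow> m p s \<in> {0, 1}" and p: "p < T * T"
  shows "\<bar>resid m p r\<bar> < int (modulus N)"
proof -
  have cq: "Suc i < q" if "i < count N" for i using that count by (simp add: q_def)
  have m0: "m p 0 \<in> {0, 1}" using m[OF p, of 0] q_pos by simp
  have bound: "0 \<le> (\<Sum>i<count N. m p' (Suc i) * int (f i)) \<and> (\<Sum>i<count N. m p' (Suc i) * int (f i)) \<le> int (\<Sum>i<count N. f i)"
    if "p' < T * T" for p' f
  proof
    have "m p' (Suc i) \<in> {0, 1}" if "i < count N" for i using m[OF \<open>p' < T * T\<close> cq[OF that]] .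
    then have "0 \<le> m p' (Suc i) * int (f i) \<and> m p' (Suc i) * int (f i) \<le> int (f i)" if "i < count N" for i
      using that by fastforce
    then show "0 \<le> (\<Sum>i<count N. m p' (Suc i) * int (f i))" "(\<Sum>i<count N. m p' (Suc i) * int (f i)) \<le> int (\<Sum>i<count N. f i)"
      by (auto intro!: sum_nonneg sum_mono)
  qed
  have bound1: "0 \<le> (\<Sum>i<count N. m p (Suc i)) \<and> (\<Sum>i<count N. m p (Suc i)) \<le> int (count N)"
    using bound[OF p, of "\<lambda>_. 1"] by simp
  define Wn En Sn Nn Ws So where "Wn = (\<Sum>i<count N. wn N i)" and "En = (\<Sum>i<count N. en N i)"
    and "Sn = (\<Sum>i<count N. sn N i)" and "Nn = (\<Sum>i<count N. nn N i)"
    and "Ws = (\<Sum>a\<le>8. ws N a)" and "So = (\<Sum>a\<le>8. so N a)"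
  have sy: "ws N (\<rho> ! p) \<le> Ws" "so N (\<rho> ! p) \<le> So"
    using rho[OF p] unfolding Ws_def So_def by (auto intro!: member_le_sum)
  have w: "int (modulus N) = 3 + int (count N) + (int Wn + int En + int Sn + int Nn) + (int Ws + int So)"
    by (simp add: modulus_def sum.distrib Wn_def En_def Sn_def Nn_def Ws_def So_def)
  have mw: "0 \<le> m p 0 * int x \<and> m p 0 * int x \<le> int x" for x using m0 by auto
  consider "r = 0" | "r = 1" | "r = 2" | "r > 2" by linarith
  then show ?thesis
  proof cases
    case 1
    then show ?thesis using bound1 m0 w by (auto simp: resid_def)
  next
    case 2
    define X where "X = (if p = 0 then 0 else \<Sum>i<count N. m (p - 1) (Suc i) * int (en N i))"
    define Y where "Y = (\<Sum>i<count N. m p (Suc i) * int (wn N i))"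
    have "0 \<le> X" "X \<le> int En" using bound[of "p - 1" "en N"] p by (auto simp: X_def En_def)
    moreover have "0 \<le> Y" "Y \<le> int Wn" using bound[OF p, of "wn N"] by (auto simp: Y_def Wn_def)
    moreover have "resid m p r = - (m p 0 * int (ws N (\<rho> ! p))) + Y - X" using 2 by (simp add: resid_def X_def Y_def)
    ultimately show ?thesis using mw[of "ws N (\<rho> ! p)"] sy(1) w by linarith
  next
    case 3
    define X where "X = (if p < T then 0 else \<Sum>i<count N. m (p - T) (Suc i) * int (nn N i))"
    define Y where "Y = (\<Sum>i<count N. m p (Suc i) * int (sn N i))"
    have "0 \<le> X" "X \<le> int Nn" using bound[of "p - T" "nn N"] p by (auto simp: X_def Nn_def)
    moreover have "0 \<le> Y" "Y \<le> int Sn" using bound[OF p, of "sn N"] by (auto simp: Y_def Sn_def)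
    moreover have "resid m p r = - (m p 0 * int (so N (\<rho> ! p))) + Y - X" using 3 by (simp add: resid_def X_def Y_def)
    ultimately show ?thesis using mw[of "so N (\<rho> ! p)"] sy(2) w by linarith
  next
    case 4
    have "0 < modulus N" by (simp add: modulus_def)
    then show ?thesis using 4 by (simp add: resid_def)
  qed
qed

lemma sqnorm_resid:
  assumes "sqnorm m \<le> 1" "p < T * T" "r < q"
  shows "resid m p r = 0"
proof -
  have eq: "int (modulus N) * m p (q + r) + resid m p r = 0"
    and m: "\<And>p s. p < T * T \<Longrightarrow> s < q \<Longrightarrow> m p s \<in> {0, 1}"
    using assms unfolding sqnorm_le_1 by blast+
  have "int (modulus N) dvd resid m p r" using eq by (metis add.commute add_eq_0_iff dvd_minus_iff dvd_triv_left)
  then show ?thesis using resid_small[OF m assms(2), where r = r] zdvd_imp_le[of "int (modulus N)" "\<bar>resid m p r\<bar>"] by force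
qed

lemma sum_one_hot:
  assumes "finite A" "\<And>i. i \<in> A \<Longrightarrow> f i \<in> {0, 1 :: int}" "sum f A = 1"
  obtains i where "i \<in> A" "\<And>g. (\<Sum>j\<in>A. f j * g j) = g i"
proof -
  have "\<exists>i\<in>A. f i = 1"
  proof (rule ccontr)
    assume "\<not> (\<exists>i\<in>A. f i = 1)"
    then have "sum f A = 0" using assms(2) by (intro sum.neutral) blast
    then show False using assms(3) by simp
  qed
  then obtain i where i: "i \<in> A" "f i = 1" by blast
  have "sum f A = f i + sum f (A - {i})" using assms(1) i(1) by (rule sum.remove)
  then have "sum f (A - {i}) = 0" using assms(3) i(2) by simp
  then have z: "f j = 0" if "j \<in> A - {i}" for j
    using sum_nonneg_eq_0_iff[of "A - {i}" f] assms(1,2) that by fastforce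
  have "(\<Sum>j\<in>A. f j * g j) = g i" for g
  proof -
    have "(\<Sum>j\<in>A. f j * g j) = f i * g i + (\<Sum>j\<in>A - {i}. f j * g j)" using assms(1) i(1) by (rule sum.remove)
    then show ?thesis using i(2) z by simp
  qed
  then show ?thesis using that i(1) by blast
qed

text \<open>Slot 0 of the first cell alone says that the grid is tiled. The value 1 spreads along
  the chain of cells, and since the end of each row is glued to the next one, it reaches all of
  them.\<close>

lemma tiling_of_point:
  assumes n: "sqnorm m \<le> 1" and m1: "m 0 0 = 1"
  shows "\<exists>\<theta>. ntiling N T \<rho> \<theta>"
proof -
  have m01: "m p s \<in> {0, 1}" if "p < T * T" "s < q" for p s
    using n that unfolding sqnorm_le_1 by blast
  have R: "resid m p r = 0" if "p < T * T" "r < 3" for p r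
    using sqnorm_resid[OF n that(1), of r] that(2) q_pos by simp
  have cq: "Suc i < q" if "i < count N" for i using that count by (simp add: q_def)
  have hot: "\<exists>i<count N. \<forall>g. (\<Sum>j<count N. m p (Suc j) * g j) = g i" if "p < T * T" "m p 0 = 1" for p
  proof -
    have "(\<Sum>j<count N. m p (Suc j)) = 1" using R[OF that(1), of 0] that(2) by (simp add: resid_def)
    from sum_one_hot[OF _ _ this] m01[OF that(1)] cq show ?thesis by (metis finite_lessThan lessThan_iff)
  qed
  \<comment> \<open>If cell \<open>p\<close> has a tile and cell \<open>p + 1\<close> does not, the
    horizontal equation of cell \<open>p + 1\<close> reads \<open>en = 0\<close>, but east colours
    are positive.\<close>
  have all1: "p < T * T \<Longrightarrow> m p 0 = 1" for p
  proof (induction p)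
    case (Suc p)
    then obtain i where i: "i < count N" "\<And>g. (\<Sum>j<count N. m p (Suc j) * g j) = g i" using hot[of p] by auto
    show ?case
    proof (rule ccontr)
      assume "m (Suc p) 0 \<noteq> 1"
      then have z: "m (Suc p) 0 = 0" using m01[OF Suc.prems, of 0] q_pos by auto
      then have "(\<Sum>j<count N. m (Suc p) (Suc j)) = 0" using R[OF Suc.prems, of 0] by (simp add: resid_def)
      moreover have "m (Suc p) (Suc j) \<in> {0, 1}" if "j < count N" for j using m01[OF Suc.prems] cq that by blast
      ultimately have "m (Suc p) (Suc j) = 0" if "j < count N" for j
        using sum_nonneg_eq_0_iff[of "{..<count N}" "\<lambda>j. m (Suc p) (Suc j)"] that by fastforce
      then have "int (en N i) = 0" using R[OF Suc.prems, of 1] z i(2)[of "\<lambda>j. int (en N j)"] by (simp add: resid_def)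
      then show False using pos[OF i(1)] by simp
    qed
  qed (use m1 in simp)
  obtain \<theta> where \<theta>: "\<And>p. p < T * T \<Longrightarrow> \<theta> p < count N"
    "\<And>p g. p < T * T \<Longrightarrow> (\<Sum>j<count N. m p (Suc j) * g j) = g (\<theta> p)"
    using hot all1 by metis
  have "ntiling N T \<rho> \<theta>" unfolding ntiling_def
  proof (intro allI impI conjI)
    fix p assume p: "p < T * T"
    show "\<theta> p < count N" by (rule \<theta>(1)[OF p])
    have "int (wn N (\<theta> p)) = int ((if p = 0 then 0 else en N (\<theta> (p - 1))) + ws N (\<rho> ! p))"
      using R[OF p, of 1] all1[OF p] \<theta>(2)[OF p, of "\<lambda>j. int (wn N j)"] \<theta>(2)[of "p - 1" "\<lambda>j. int (en N j)"] p
      by (auto simp: resid_def)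
    then show "wn N (\<theta> p) = (if p = 0 then 0 else en N (\<theta> (p - 1))) + ws N (\<rho> ! p)" by (simp only: of_nat_eq_iff)
    have "int (sn N (\<theta> p)) = int ((if p < T then 0 else nn N (\<theta> (p - T))) + so N (\<rho> ! p))"
      using R[OF p, of 2] all1[OF p] \<theta>(2)[OF p, of "\<lambda>j. int (sn N j)"] \<theta>(2)[of "p - T" "\<lambda>j. int (nn N j)"] p
      by (auto simp: resid_def)
    then show "sn N (\<theta> p) = (if p < T then 0 else nn N (\<theta> (p - T))) + so N (\<rho> ! p)" by (simp only: of_nat_eq_iff)
  qed
  then show ?thesis by blast
qed

lemma point_of_tiling:
  assumes t: "ntiling N T \<rho> \<theta>"
  shows "\<exists>m. sqnorm m \<le> 1 \<and> m 0 0 = 1"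
proof -
  define m where "m p s = (if s = 0 \<or> s = Suc (\<theta> p) then 1 else 0 :: int)" for p s
  have th: "\<theta> p < count N" "wn N (\<theta> p) = (if p = 0 then 0 else en N (\<theta> (p - 1))) + ws N (\<rho> ! p)"
    "sn N (\<theta> p) = (if p < T then 0 else nn N (\<theta> (p - T))) + so N (\<rho> ! p)" if "p < T * T" for p
    using t that unfolding ntiling_def by blast+
  have cq: "Suc i < q" if "i < count N" for i using that count by (simp add: q_def)
  have sm: "(\<Sum>j<count N. m p (Suc j) * g j) = g (\<theta> p)" if "p < T * T" for p and g :: "nat \<Rightarrow> int"
  proof -
    have "(\<Sum>j<count N. m p (Suc j) * g j) = (\<Sum>j<count N. if j = \<theta> p then g j else 0)"
      by (intro sum.cong) (auto simp: m_def)
    then show ?thesis using th(1)[OF that] by simp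
  qed
  have s1: "(\<Sum>j<count N. m p (Suc j)) = 1" if "p < T * T" for p
    using sm[OF that, of "\<lambda>_. 1"] by simp
  have "resid m p r = 0" if p: "p < T * T" for p r
  proof -
    have "p - 1 < T * T" "p - T < T * T" using p by auto
    note eqs = sm[OF p] s1[OF p] sm[OF this(1)] sm[OF this(2)] th(2,3)[OF p]
    show ?thesis using eqs by (cases "p = 0") (simp_all add: resid_def m_def[of _ 0])
  qed
  moreover have "m p (q + r) = 0" if "p < T * T" for p r
    using cq[OF th(1)[OF that]] q_pos by (simp add: m_def)
  moreover have "m p s \<in> {0, 1}" for p s by (simp add: m_def)
  ultimately have "sqnorm m \<le> 1" unfolding sqnorm_le_1 by simp
  then show ?thesis by (intro exI[of _ m]) (simp add: m_def)
qed

text \<open>The trivial solution of the homogeneous equations; it makes every instance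
  feasible.\<close>

lemma sqnorm_0: "sqnorm (\<lambda>_ _. 0) \<le> 1"
  unfolding sqnorm_le_1 by (simp add: resid_def)

section \<open>The instance: independence of its basis, feasible points and objective values\<close>

lemma inst_simps [simp]: "n_of inst = dim" "p_of inst = dim" "H_of inst = 0\<^sub>m dim dim"
  "h_of inst = vec dim (\<lambda>i. if i = 0 then -1 else 0)" "c_of inst = vec dim Off"
  "basis_of inst = map (\<lambda>i. vec dim (Bas i)) [0..<dim]"
  by (simp_all add: inst_def)

text \<open>A basis vector reaches only its own cell and later ones. Within its own block, entries
  off the diagonal come from slots up to \<open>count N\<close>, which are below \<open>q\<close>,
  and lie in the slots \<open>q\<close>, \<open>q + 1\<close> and \<open>q + 2\<close>.\<close>

lemma Bas_triangular:
  assumes "j < i"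
  shows "Bas i j = 0"
proof -
  have le: "j div D \<le> i div D" using assms by (intro div_le_mono) simp
  show ?thesis
  proof (cases "j div D = i div D")
    case True
    then have "j mod D < i mod D" using assms by (metis mod_div_mult_eq nat_add_left_cancel_less add.commute)
    then show ?thesis using True count by (auto simp: Bas_def rel_def entry_def q_def)
  next
    case False
    then show ?thesis using le T by (auto simp: Bas_def rel_def entry_def)
  qed
qed

lemma Bas_diag: "Bas i i \<noteq> 0"
proof -
  have "modulus N \<noteq> 0" by (simp add: modulus_def)
  then show ?thesis using k_pos by (simp add: Bas_def rel_def entry_def)
qed

lemma inst_MITR: "inst \<in> MITR"
proof -
  define A where "A = mat dim dim (\<lambda>(i, j). real_of_rat (Bas i j))"
  have A: "A \<in> carrier_mat dim dim" by (simp add: A_def)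
  have rows: "rows A = map real_vec (basis_of inst)"
    by (rule nth_equalityI) (auto simp: A_def)
  have tri: "upper_triangular A" by (rule upper_triangularI) (auto simp: A_def Bas_triangular)
  have diag: "0 \<notin> set (diag_mat A)" by (auto simp: diag_mat_def A_def Bas_diag)
  have "lin_indpt_vecs dim (map real_vec (basis_of inst))"
    unfolding lin_indpt_vecs_def rows[symmetric]
    using upper_triangular_imp_distinct[OF A tri diag] idom_vec.upper_triangular_imp_lin_indpt_rows[OF A tri diag]
    by blast
  then show ?thesis using dim_pos by (auto simp: MITR_def)
qed

lemma point_sum: "(\<Sum>i<dim. of_int (m (i div D) (i mod D)) * Bas i j) + Off j = point m j"
  unfolding dim_def sum_blocks point_def by (simp add: slot)

text \<open>All coefficients are integers because \<open>p_of inst = n_of inst\<close>; they are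
  merely regrouped by cell \<open>i div D\<close> and slot \<open>i mod D\<close>.\<close>

lemma feasible_eq: "mitr_feasible inst = {real_vec (vec dim (point m)) | m. sqnorm m \<le> 1}"
proof -
  have norm: "real_vec (vec dim (point m)) \<bullet> real_vec (vec dim (point m)) \<le> 1 \<longleftrightarrow> sqnorm m \<le> 1" for m
  proof -
    have "real_vec (vec dim (point m)) \<bullet> real_vec (vec dim (point m)) = of_rat (sqnorm m)"
      by (simp add: scalar_prod_def sqnorm_def of_rat_sum of_rat_mult power2_eq_square atLeast0LessThan)
    then show ?thesis by (simp add: of_rat_le_1_iff)
  qed
  have lat: "vec dim (\<lambda>j. \<Sum>i<dim. \<mu> i * map real_vec (basis_of inst) ! i $ j) + real_vec (c_of inst) =
      real_vec (vec dim (point m))" if "\<And>i. i < dim \<Longrightarrow> \<mu> i = of_int (m (i div D) (i mod D))" for \<mu> m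
  proof (rule eq_vecI)
    fix j assume "j < dim_vec (real_vec (vec dim (point m)))"
    then have j: "j < dim" by simp
    have "(\<Sum>i<dim. \<mu> i * map real_vec (basis_of inst) ! i $ j) =
        (\<Sum>i<dim. of_rat (of_int (m (i div D) (i mod D)) * Bas i j))"
      using j that by (intro sum.cong) (auto simp: of_rat_mult)
    then show "(vec dim (\<lambda>j. \<Sum>i<dim. \<mu> i * map real_vec (basis_of inst) ! i $ j) + real_vec (c_of inst)) $ j =
        real_vec (vec dim (point m)) $ j"
      using j by (simp add: point_sum[symmetric] of_rat_add of_rat_sum)
  qed simp
  show ?thesis
  proof (intro subset_antisym subsetI)
    fix x assume "x \<in> mitr_feasible inst"
    then obtain \<mu> where x: "x = vec dim (\<lambda>j. \<Sum>i<dim. \<mu> i * map real_vec (basis_of inst) ! i $ j) + real_vec (c_of inst)"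
      "x \<bullet> x \<le> 1" "\<And>i. i < dim \<Longrightarrow> \<mu> i \<in> \<int>"
      by (auto simp: mitr_feasible_def mixed_lattice_def)
    define m where "m p s = \<lfloor>\<mu> (p * D + s)\<rfloor>" for p s
    have "x = real_vec (vec dim (point m))" unfolding x(1)
      by (rule lat) (use x(3) in \<open>auto simp: m_def elim: Ints_cases\<close>)
    then show "x \<in> {real_vec (vec dim (point m)) | m. sqnorm m \<le> 1}" using x(2) norm by auto
  next
    fix x assume "x \<in> {real_vec (vec dim (point m)) | m. sqnorm m \<le> 1}"
    then obtain m where m: "x = real_vec (vec dim (point m))" "sqnorm m \<le> 1" by blast
    define \<mu> where "\<mu> i = real_of_int (m (i div D) (i mod D))" for i
    have "x = vec dim (\<lambda>j. \<Sum>i<dim. \<mu> i * map real_vec (basis_of inst) ! i $ j) + real_vec (c_of inst)"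
      unfolding m(1) by (rule lat[symmetric]) (simp add: \<mu>_def)
    moreover have "vec dim (\<lambda>j. \<Sum>i<dim. \<mu> i * map real_vec (basis_of inst) ! i $ j) \<in>
        mixed_lattice dim dim (map real_vec (basis_of inst))"
      unfolding mixed_lattice_def by (auto simp: \<mu>_def)
    moreover have "x \<bullet> x \<le> 1" "x \<in> carrier_vec dim" using m norm by simp_all
    ultimately show "x \<in> mitr_feasible inst" unfolding mitr_feasible_def inst_simps by blast
  qed
qed

definition height :: real where "height = 1 / (2 * real k)"

lemma height_pos: "0 < height"
  using k_pos by (simp add: height_def)

lemma point_0: "real_of_rat (point m 0) = (2 * real_of_int (m 0 0) - 1) * height"
proof -
  have "point m 0 = (of_int (m 0 0) - 1 / 2) / of_nat k"
    using point_low[of 0 0 m] T q_pos by simp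
  then have "real_of_rat (point m 0) = (real_of_int (m 0 0) - 1 / 2) / real k"
    by (simp add: of_rat_divide of_rat_diff)
  then show ?thesis using k_pos by (simp add: height_def field_simps)
qed

lemma objective: "mitr_objective inst (real_vec (vec dim (point m))) = - real_of_rat (point m 0)"
proof -
  have "real_vec (h_of inst) \<bullet> real_vec (vec dim (point m)) =
      (\<Sum>i<dim. if i = 0 then - real_of_rat (point m 0) else 0)"
    unfolding scalar_prod_def by (intro sum.cong) (auto simp: of_rat_minus)
  also have "\<dots> = - real_of_rat (point m 0)" using dim_pos by simp
  finally have "real_vec (h_of inst) \<bullet> real_vec (vec dim (point m)) = - real_of_rat (point m 0)" .
  moreover have "real_mat (H_of inst) *\<^sub>v real_vec (vec dim (point m)) = 0\<^sub>v dim"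
    by (rule eq_vecI) (auto simp: scalar_prod_def)
  ultimately show ?thesis by (simp add: mitr_objective_def)
qed

lemma feasible_values:
  assumes "sqnorm m \<le> 1"
  shows "m 0 0 = 1 \<or> m 0 0 = 0"
  using assms T q_pos unfolding sqnorm_le_1 by fastforce

lemma inst_pure: "inst \<in> MITR_pure_feasible"
  using inst_MITR sqnorm_0 by (auto simp: MITR_pure_feasible_def feasible_eq)

lemma low_value_iff:
  "(\<exists>x\<in>mitr_feasible inst. mitr_objective inst x \<le> real_of_rat (val k NegHalf)) \<longleftrightarrow> (\<exists>\<theta>. ntiling N T \<rho> \<theta>)"
proof -
  have v: "real_of_rat (val k NegHalf) = - height"
    by (simp add: height_def of_rat_divide of_rat_minus of_rat_mult)
  have "mitr_objective inst (real_vec (vec dim (point m))) \<le> - height \<longleftrightarrow> m 0 0 = 1" if "sqnorm m \<le> 1" for m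
    using feasible_values[OF that] height_pos by (auto simp: objective point_0)
  then have "(\<exists>x\<in>mitr_feasible inst. mitr_objective inst x \<le> - height) \<longleftrightarrow> (\<exists>m. sqnorm m \<le> 1 \<and> m 0 0 = 1)"
    unfolding feasible_eq by blast
  then show ?thesis unfolding v using tiling_of_point point_of_tiling by blast
qed

text \<open>The objective is the negative of coordinate 0, which is \<open>height\<close> or
  \<open>- height\<close> according to slot 0 of the first cell. The origin of the integer variables
  always gives the larger value, and the smaller one requires a tiling.\<close>

lemma objective_range:
  "mitr_objective inst ` mitr_feasible inst = (if \<exists>\<theta>. ntiling N T \<rho> \<theta> then {height, - height} else {height})"
proof -
  have "mitr_objective inst ` mitr_feasible inst = (\<lambda>m. - ((2 * real_of_int (m 0 0) - 1) * height)) ` {m. sqnorm m \<le> 1}"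
  proof -
    have "mitr_feasible inst = (\<lambda>m. real_vec (vec dim (point m))) ` {m. sqnorm m \<le> 1}"
      unfolding feasible_eq by auto
    then show ?thesis by (simp only: image_image objective point_0)
  qed
  also have "\<dots> = (if \<exists>m. sqnorm m \<le> 1 \<and> m 0 0 = 1 then {height, - height} else {height})"
  proof -
    have "(\<lambda>m. - ((2 * real_of_int (m 0 0) - 1) * height)) ` {m. sqnorm m \<le> 1} =
        (\<lambda>m. if m 0 0 = 1 then - height else height) ` {m. sqnorm m \<le> 1}"
      using feasible_values by (intro image_cong) fastforce+
    moreover have "\<exists>m. sqnorm m \<le> 1 \<and> m 0 0 \<noteq> 1" using sqnorm_0 by fastforce
    ultimately show ?thesis by (auto simp: image_iff)
  qed
  finally show ?thesis using tiling_of_point point_of_tiling by (smt (verit, best))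
qed

text \<open>An oracle is bound to answer correctly only where an answer exists. The objective takes
  finitely many values, so the infimum is attained, and at a rational point.\<close>

lemma approx_exists:
  assumes "0 \<le> \<epsilon>"
  shows "\<exists>x. approx_solution (mitr_objective inst) (mitr_feasible inst) \<epsilon> (real_vec x)"
proof -
  have "Inf (mitr_objective inst ` mitr_feasible inst) \<in> mitr_objective inst ` mitr_feasible inst"
    using height_pos unfolding objective_range by (auto simp: cInf_eq_Min)
  then obtain m where m: "sqnorm m \<le> 1"
    "mitr_objective inst (real_vec (vec dim (point m))) = Inf (mitr_objective inst ` mitr_feasible inst)"
    unfolding feasible_eq by auto
  moreover have "Inf (mitr_objective inst ` mitr_feasible inst) \<le> Sup (mitr_objective inst ` mitr_feasible inst)"
    using height_pos unfolding objective_range by (auto simp: cInf_eq_Min cSup_eq_Max)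
  ultimately have "approx_solution (mitr_objective inst) (mitr_feasible inst) \<epsilon> (real_vec (vec dim (point m)))"
    using assms by (auto simp: approx_solution_def feasible_eq)
  then show ?thesis by blast
qed

text \<open>If both values occur, a point of the larger value misses the optimum by the whole range,
  which no \<open>\<epsilon> < 1\<close> tolerates. So the sign of coordinate 0 answers the
  question.\<close>

lemma approx_sign:
  assumes e: "\<epsilon> < 1" and x: "approx_solution (mitr_objective inst) (mitr_feasible inst) \<epsilon> (real_vec x)"
  shows "dim_vec x = dim" "x $ 0 < 0 \<longleftrightarrow> \<not> (\<exists>\<theta>. ntiling N T \<rho> \<theta>)"
proof -
  from x obtain m where m: "sqnorm m \<le> 1" "real_vec x = real_vec (vec dim (point m))"
    by (auto simp: approx_solution_def feasible_eq)
  show dim: "dim_vec x = dim" using arg_cong[OF m(2), of dim_vec] by simp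
  have "real_of_rat (x $ 0) = real_of_rat (point m 0)"
    using arg_cong[OF m(2), of "\<lambda>v. v $ 0"] dim dim_pos by simp
  moreover have "x $ 0 < 0 \<longleftrightarrow> real_of_rat (x $ 0) < 0" by simp
  ultimately have neg: "x $ 0 < 0 \<longleftrightarrow> m 0 0 = 0"
    using feasible_values[OF m(1)] height_pos point_0[of m] by auto
  show "x $ 0 < 0 \<longleftrightarrow> \<not> (\<exists>\<theta>. ntiling N T \<rho> \<theta>)"
  proof
    assume "x $ 0 < 0"
    then have m0: "m 0 0 = 0" using neg by simp
    show "\<not> (\<exists>\<theta>. ntiling N T \<rho> \<theta>)"
    proof
      assume t: "\<exists>\<theta>. ntiling N T \<rho> \<theta>"
      have "mitr_objective inst (real_vec x) = height" using m m0 by (simp add: objective point_0)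
      moreover have "Inf (mitr_objective inst ` mitr_feasible inst) = - height"
        "Sup (mitr_objective inst ` mitr_feasible inst) = height"
        using height_pos t unfolding objective_range by (auto simp: cInf_eq_Min cSup_eq_Max)
      ultimately have "height + height \<le> \<epsilon> * (height + height)" using x by (simp add: approx_solution_def)
      then show False using e height_pos by simp
    qed
  next
    assume "\<not> (\<exists>\<theta>. ntiling N T \<rho> \<theta>)"
    then have "m 0 0 \<noteq> 1" using tiling_of_point[OF m(1)] by blast
    then show "x $ 0 < 0" using neg feasible_values[OF m(1)] by blast
  qed
qed

end

section \<open>Tapes and symbols used by the program constructs\<close>

lemma wf_switch: "x < k \<Longrightarrow> (\<And>s. s \<le> n \<Longrightarrow> wf_com k G (f s)) \<Longrightarrow> wf_com k G (switch x n f)"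
  by (induction n) auto

lemma wf_rewind [simp]: "wf_com k G (rewind x) \<longleftrightarrow> x < k"
  by (auto simp: rewind_def)

lemma wf_repeat: "0 < k \<Longrightarrow> wf_com k G c \<Longrightarrow> wf_com k G (repeat n c)"
  by (induction n) auto

lemma wf_forpoly: "b + length as \<le> k \<Longrightarrow> 0 < k \<Longrightarrow> wf_com k G c \<Longrightarrow> wf_com k G (forpoly as b c)"
  by (induction as arbitrary: b) (auto simp: wf_repeat)

lemma wf_emit: "x < k \<Longrightarrow> set ss \<subseteq> {..<G} \<Longrightarrow> wf_com k G (emit x ss)"
  by (induction ss) auto

lemma wf_foreach [simp]: "wf_com k G (foreach y c) \<longleftrightarrow> y < k \<and> wf_com k G c"
  by (auto simp: foreach_def)

lemma wf_inc [simp]: "wf_com k G (inc x) \<longleftrightarrow> x < k \<and> 2 < G"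
  by (auto simp: inc_def)

lemma vars_switch: "x \<in> A \<Longrightarrow> (\<And>s. s \<le> n \<Longrightarrow> vars (f s) \<subseteq> A) \<Longrightarrow> vars (switch x n f) \<subseteq> A"
  by (induction n) auto

lemma vars_rewind [simp]: "vars (rewind x) = {x}"
  by (auto simp: rewind_def)

lemma vars_repeat: "vars c \<subseteq> A \<Longrightarrow> vars (repeat n c) \<subseteq> A"
  by (induction n) auto

lemma vars_emit: "vars (emit x ss) \<subseteq> {x}"
  by (induction ss) auto

lemma vars_foreach [simp]: "vars (foreach y c) = insert y (vars c)"
  by (auto simp: foreach_def)

lemma vars_inc [simp]: "vars (inc x) = {x}"
  by (auto simp: inc_def)

primrec seqs :: "com list \<Rightarrow> com" where
  "seqs [] = Skip"
| "seqs (c # cs) = Seq c (seqs cs)"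

lemma wf_seqs: "0 < k \<Longrightarrow> (\<And>c. c \<in> set cs \<Longrightarrow> wf_com k G c) \<Longrightarrow> wf_com k G (seqs cs)"
  by (induction cs) auto

lemma vars_seqs: "(\<And>c. c \<in> set cs \<Longrightarrow> vars c \<subseteq> A) \<Longrightarrow> vars (seqs cs) \<subseteq> A"
  by (induction cs) auto

lemma emitter_seqs:
  assumes "\<And>y. y \<in> set xs \<Longrightarrow> emitter sz D x (f y) S (ss y)"
  shows "emitter sz D x (seqs (map f xs)) S (\<lambda>i. concat (map (\<lambda>y. ss y i) xs))"
  using assms by (induction xs) (auto intro!: emitter_Skip intro: emitter_Seq)

lemma emitter_repeat:
  assumes "emitter sz D x c S s" "\<And>i. i \<in> D \<Longrightarrow> ss i = concat (replicate n (s i))"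
  shows "emitter sz D x (repeat n c) S ss"
  using assms(2)
proof (induction n arbitrary: ss)
  case 0
  then show ?case by (auto intro: emitter_Skip)
next
  case (Suc n)
  show ?case using Suc.prems by (auto intro!: emitter_Seq[OF assms(1) Suc.IH[OF refl]])
qed

subsection \<open>Encodings\<close>

definition enc_syms :: "bool list \<Rightarrow> nat list" where
  "enc_syms = map bsym"

lemma frame_append: "frame (xs @ ys) = concat (map (\<lambda>b. [True, b]) xs) @ frame ys"
  by (simp add: frame_def)

text \<open>With the least significant digit first, a factor \<open>2 ^ e\<close> is a fixed prefix.
  This is why the scaling factor is a power of 2: its multiples of \<open>T\<close> are written
  without arithmetic.\<close>

lemma bits_pow2: "0 < x \<Longrightarrow> bits_of_nat (2 ^ e * x) = replicate e False @ bits_of_nat x"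
  by (induction e) (auto simp: bits_pos mult.assoc)

lemma enc_nat_pow2: "0 < x \<Longrightarrow> enc_nat (2 ^ e * x) = concat (replicate e [True, False]) @ frame (bits_of_nat x)"
  by (simp add: enc_nat_def bits_pow2 frame_append map_replicate_const)

lemma quotient_of_inverse:
  assumes "0 < n"
  shows "quotient_of (1 / of_nat n) = (1, int n)" "quotient_of (- 1 / of_nat n) = (-1, int n)"
proof -
  have "quotient_of (Rat.Fract 1 (int n)) = (1, int n)" "quotient_of (Rat.Fract (-1) (int n)) = (-1, int n)"
    using assms by (auto simp: quotient_of_Fract normalize_def Let_def)
  moreover have "1 / of_nat n = Rat.Fract 1 (int n)" "- 1 / of_nat n = Rat.Fract (-1) (int n)"
    by (simp_all add: Fract_of_int_quotient)
  ultimately show "quotient_of (1 / of_nat n) = (1, int n)" "quotient_of (- 1 / of_nat n) = (-1, int n)" by simp_all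
qed

lemma enc_val:
  assumes "0 < T"
  shows "enc_rat (val (2 ^ e * T) InvK) = enc_int 1 @ concat (replicate e [True, False]) @ frame (bits_of_nat T)"
    "enc_rat (val (2 ^ e * T) NegHalf) = enc_int (-1) @ concat (replicate (Suc e) [True, False]) @ frame (bits_of_nat T)"
proof -
  show "enc_rat (val (2 ^ e * T) InvK) = enc_int 1 @ concat (replicate e [True, False]) @ frame (bits_of_nat T)"
    using assms quotient_of_inverse(1)[of "2 ^ e * T"] by (simp add: enc_rat_def enc_nat_pow2[symmetric] nat_mult_distrib nat_power_eq)
  have "2 * (2 ^ e * T) = 2 ^ Suc e * T" by simp
  then show "enc_rat (val (2 ^ e * T) NegHalf) = enc_int (-1) @ concat (replicate (Suc e) [True, False]) @ frame (bits_of_nat T)"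
    using assms quotient_of_inverse(2)[of "2 * (2 ^ e * T)"] enc_nat_pow2[OF assms, of "Suc e"]
    by (simp add: enc_rat_def mult.assoc del: of_nat_mult)
qed

subsection \<open>The program computing the reduction\<close>

text \<open>Tapes: 0 input, 1 query, 2 copy of the input, 3 row symbols, 4 relative position of cells, 5 and 6 the numbers
  \<open>T\<close> and \<open>T * T\<close> in binary, from 7 on copies of the input in unary. The output goes to tape \<open>out\<close>.\<close>

definition emit_frame :: "nat \<Rightarrow> nat \<Rightarrow> com" where
  "emit_frame y x = Seq (foreach y (switch y 2 (\<lambda>a. emit x [2, a]))) (emit x [1])"

lemma emitter_frame:
  assumes "y \<noteq> x" "\<And>i. i \<in> D \<Longrightarrow> S i y = tp (enc_syms (bs i)) 0" "pbd sz D (\<lambda>i. length (bs i))"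
    "\<And>i. i \<in> D \<Longrightarrow> ss i = enc_syms (frame (bs i))"
  shows "emitter sz D x (emit_frame y x) S ss"
  unfolding emit_frame_def
proof (rule emitter_Seq)
  show "emitter sz D x (foreach y (switch y 2 (\<lambda>a. emit x [2, a]))) S (\<lambda>i. concat (map (\<lambda>a. [2, a]) (enc_syms (bs i))))"
    using assms(1-3) by (intro emitter_foreach_sym[where xs = "\<lambda>i. enc_syms (bs i)" and f = "\<lambda>a. [2, a]"]) (auto simp: enc_syms_def bsym_def)
  show "emitter sz D x (emit x [1]) S (\<lambda>i. [1])" by (rule emitter_emit) simp
  show "ss i = concat (map (\<lambda>a. [2, a]) (enc_syms (bs i))) @ [1]" if "i \<in> D" for i
    using assms(4)[OF that] by (simp add: enc_syms_def frame_def map_concat comp_def)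
qed

lemma wf_emit_frame: "y < k \<Longrightarrow> x < k \<Longrightarrow> 3 \<le> G \<Longrightarrow> wf_com k G (emit_frame y x)"
  by (auto simp: emit_frame_def intro!: wf_switch)

lemma vars_emit_frame: "vars (emit_frame y x) \<subseteq> {x, y}"
  by (auto simp: emit_frame_def dest: subsetD[OF vars_switch[of y "{x, y}"], rotated 2])

definition emit_num :: "nat \<Rightarrow> nat \<Rightarrow> num \<Rightarrow> com" where
  "emit_num e x v = (case v of
      Num z \<Rightarrow> emit x (enc_syms (enc_rat (of_int z)))
    | InvK \<Rightarrow> Seq (emit x (enc_syms (enc_int 1 @ concat (replicate e [True, False])))) (emit_frame 5 x)
    | NegHalf \<Rightarrow> Seq (emit x (enc_syms (enc_int (-1) @ concat (replicate (Suc e) [True, False])))) (emit_frame 5 x))"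

lemma emitter_num:
  assumes "x \<noteq> 5" "\<And>i. i \<in> D \<Longrightarrow> S i 5 = tp (enc_syms (bits_of_nat (T i))) 0 \<and> 0 < T i" "pbd sz D T"
    "\<And>i. i \<in> D \<Longrightarrow> ss i = enc_syms (enc_rat (val (2 ^ e * T i) v))"
  shows "emitter sz D x (emit_num e x v) S ss"
proof -
  have len: "pbd sz D (\<lambda>i. length (bits_of_nat (T i)))"
    using assms(3) by (rule pbd_le) (rule length_bits)
  have fr: "emitter sz D x (emit_frame 5 x) S (\<lambda>i. enc_syms (frame (bits_of_nat (T i))))"
    using assms(1,2) by (intro emitter_frame[OF _ _ len]) auto
  show ?thesis
  proof (cases v)
    case (Num z)
    then show ?thesis using assms(4) by (auto simp: emit_num_def intro!: emitter_emit)
  next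
    case InvK
    show ?thesis unfolding emit_num_def InvK num.case
      by (rule emitter_Seq[OF emitter_emit[OF refl] fr])
        (use assms(2,4) InvK enc_val(1) in \<open>simp add: enc_syms_def\<close>)
  next
    case NegHalf
    show ?thesis unfolding emit_num_def NegHalf num.case
      by (rule emitter_Seq[OF emitter_emit[OF refl] fr])
        (use assms(2,4) NegHalf enc_val(2) in \<open>simp add: enc_syms_def\<close>)
  qed
qed

lemma enc_syms_lt: "a \<in> set (enc_syms bs) \<Longrightarrow> 3 \<le> G \<Longrightarrow> a < G"
  by (auto simp: enc_syms_def bsym_def)

lemma wf_emit_num: "5 < k \<Longrightarrow> x < k \<Longrightarrow> 3 \<le> G \<Longrightarrow> wf_com k G (emit_num e x v)"
  by (auto simp: emit_num_def wf_emit_frame intro!: wf_emit intro: enc_syms_lt split: num.split)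

lemma vars_emit_num: "vars (emit_num e x v) \<subseteq> {x, 5}"
  using vars_emit[of x] vars_emit_frame[of 5 x] by (auto simp: emit_num_def split: num.split)

lemma emitter_Seq': "emitter sz D x c1 S s1 \<Longrightarrow> emitter sz D x c2 S s2 \<Longrightarrow> emitter sz D x (Seq c1 c2) S (\<lambda>i. s1 i @ s2 i)"
  by (rule emitter_Seq) auto

lemma map_upt_blocks: "map f [0..<P * D] = concat (map (\<lambda>p. map (\<lambda>s. f (p * D + s)) [0..<D]) [0..<P])"
proof (induction P)
  case (Suc P)
  have "[0..<Suc P * D] = [0..<P * D] @ map (\<lambda>s. P * D + s) [0..<D]"
    using upt_add_eq_append[of 0 "P * D" D] by (simp add: add.commute map_add_upt[symmetric, of "P * D" D])
  then show ?case using Suc by simp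
qed simp

lemma concat_map_concat: "concat (map f (concat xss)) = concat (map (\<lambda>xs. concat (map f xs)) xss)"
  by (induction xss) auto

text \<open>The last assumption makes the side of the grid at least as large as
  \<open>modulus N\<close>, so that all numbers of the instance are bounded by its
  dimension.\<close>

locale generator =
  fixes N :: ntiles and g \<tau> :: "nat poly" and e :: nat
  assumes count: "count N < 4 * 2 ^ e * 2 ^ e"
    and pos: "\<And>i. i < count N \<Longrightarrow> 1 \<le> wn N i \<and> 1 \<le> en N i"
    and tau: "\<And>l. modulus N \<le> poly \<tau> l"
begin

abbreviation b :: nat where "b \<equiv> 2 ^ e"
definition q where "q = 4 * b * b"
definition D where "D = 2 * q"

text \<open>\<open>T\<close>, \<open>T - 1\<close> and \<open>T - 2\<close> as functions of the
  input length; polynomials over the naturals do not allow the subtraction itself.\<close>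

definition P_T where "P_T = [:3, 2:] + Polynomial.smult 2 \<tau> + g"
definition P_T1 where "P_T1 = [:2, 2:] + Polynomial.smult 2 \<tau> + g"
definition P_T2 where "P_T2 = [:1, 2:] + Polynomial.smult 2 \<tau> + g"
definition P_TT where "P_TT = P_T * P_T"
definition P_plain where "P_plain = P_T * P_T2 + 1 + \<tau>"
definition P_rest where "P_rest = [:1, 2:] + \<tau> + g"
definition P_H where "P_H = Polynomial.smult (D * D) (P_TT * P_TT)"
text \<open>The number of zeros in \<open>h\<close> behind its first entry: with
  \<open>D * (T - 1) * (T + 1) + (D - 1) = D * T * T - 1\<close>, it is the dimension minus
  1.\<close>

definition P_h where "P_h = Polynomial.smult D (P_T1 * (P_T1 + 2)) + [:D - 1:]"

definition polys where "polys = [\<tau>, g, P_T, P_T2, P_TT, P_plain, P_rest, P_H, P_h]"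
text \<open>A loop over a polynomial needs one unary tape per coefficient. The loops restore these
  tapes and can share them, so the total number of coefficients is enough.\<close>

definition m where "m = sum_list (map (length \<circ> coeffs) polys)"

definition fp :: "nat poly \<Rightarrow> com \<Rightarrow> com" where
  "fp P c = forpoly (coeffs P) 7 c"

definition T where "T w = poly P_T (length w)" for w :: "bool list"
definition \<rho> where "\<rho> w = row_syms (poly \<tau> (length w)) (poly g (length w)) w"
text \<open>Cell \<open>p' - p\<close> of this tape tells how \<open>p'\<close> lies relative to
  \<open>p\<close>: 1 at distance 0, 2 at distance 1, 3 at distance \<open>T\<close>. The distances
  in between carry 4 instead of a blank so that the tape can be rewound.\<close>

definition Z where "Z w = [1, 2] @ replicate (T w - 2) 4 @ [3 :: nat]"

lemma T_width: "T w = width (poly \<tau> (length w)) (poly g (length w)) (length w)"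
  by (simp add: T_def P_T_def width_def mult_2_right)

lemma T_ge: "3 \<le> T w"
  by (simp add: T_width width_def)

lemma poly_T: "poly P_T (length w) = T w" "poly P_T1 (length w) = T w - 1" "poly P_T2 (length w) = T w - 2"
  "poly P_TT (length w) = T w * T w"
  by (simp_all add: T_def P_T_def P_T1_def P_T2_def P_TT_def)

lemma coeffs_le: "P \<in> set polys \<Longrightarrow> length (coeffs P) \<le> m"
  unfolding m_def by (intro member_le_sum_list) auto

lemma in_polys: "\<tau> \<in> set polys" "g \<in> set polys" "P_T \<in> set polys" "P_T2 \<in> set polys" "P_TT \<in> set polys"
  "P_plain \<in> set polys" "P_rest \<in> set polys" "P_H \<in> set polys" "P_h \<in> set polys"
  by (simp_all add: polys_def)

lemma wf_fp: "P \<in> set polys \<Longrightarrow> wf_com (7 + m) G c \<Longrightarrow> wf_com (7 + m) G (fp P c)"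
  unfolding fp_def using coeffs_le[of P] by (intro wf_forpoly) auto

definition marked :: "'i set \<Rightarrow> ('i \<Rightarrow> store) \<Rightarrow> ('i \<Rightarrow> nat) \<Rightarrow> bool" where
  "marked A S l \<longleftrightarrow> (\<forall>i\<in>A. \<forall>y. 7 \<le> y \<longrightarrow> y < 7 + m \<longrightarrow> S i y = tp (replicate (l i) 1) 0)"

lemma emitter_fp:
  assumes "P \<in> set polys" "vars c \<subseteq> {..<7}" "x < 7" "emitter sz A x c S s" "marked A S l" "pbd sz A l"
    "\<And>i. i \<in> A \<Longrightarrow> ss i = concat (replicate (poly P (l i)) (s i))"
  shows "emitter sz A x (fp P c) S ss"
  unfolding fp_def
proof (rule emitter_forpoly[OF assms(2-4) _ assms(6)])
  show "S i y = tp (replicate (l i) 1) 0" if "i \<in> A" "7 \<le> y" "y < 7 + length (coeffs P)" for i y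
    using assms(5) that coeffs_le[OF assms(1)] by (auto simp: marked_def)
qed (simp add: assms(7) pval_coeffs)

lemma pex_fp:
  assumes "P \<in> set polys" "vars c \<subseteq> {..<7}"
    and "pex (\<lambda>(i, j). sz i) {(i, j). i \<in> A \<and> j < poly P (l i)} c (\<lambda>(i, j). S i j) (\<lambda>(i, j). S i (Suc j))"
    and "\<And>j. marked A (\<lambda>i. S i j) l" and "pbd sz A l"
    and "\<And>i. i \<in> A \<Longrightarrow> R i = S i 0" "\<And>i. i \<in> A \<Longrightarrow> R' i = S i (poly P (l i))"
  shows "pex sz A (fp P c) R R'"
  unfolding fp_def
proof (rule pex_forpoly[OF assms(2), where S = S and l = l])
  show "S i j y = tp (replicate (l i) 1) 0" if "i \<in> A" "7 \<le> y" "y < 7 + length (coeffs P)" for i j y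
    using assms(4)[of j] that coeffs_le[OF assms(1)] by (auto simp: marked_def)
qed (use assms in \<open>simp_all add: pval_coeffs\<close>)

definition base :: "bool list \<Rightarrow> store" where
  "base w = (\<lambda>i. if i = 2 then tp (enc_syms w) 0 else if 7 \<le> i \<and> i < 7 + m then tp (replicate (length w) 1) 0 else tp [] 0)"

definition stage1 where "stage1 w = (base w)(3 := tp (\<rho> w) 0)"
definition stage2 where "stage2 w = (stage1 w)(4 := tp (Z w) 0)"
definition stage3 where "stage3 w = (stage2 w)(5 := tp (enc_syms (bits_of_nat (T w))) 0)"
definition stage4 where "stage4 w = (stage3 w)(6 := tp (enc_syms (bits_of_nat (T w * T w))) 0)"

lemma marked_stages: "marked UNIV base length" "marked UNIV stage1 length" "marked UNIV stage2 length"
  "marked UNIV stage3 length" "marked UNIV stage4 length"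
  by (simp_all add: marked_def base_def stage1_def stage2_def stage3_def stage4_def)

lemma pbd_poly_length: "pbd length A (\<lambda>w. poly P (length w))" for P :: "nat poly"
  by (intro pbd_poly pbd_sz)

lemma pbd_T: "pbd length A T"
  unfolding T_def[abs_def] by (rule pbd_poly_length)

definition row_prog where
  "row_prog = Seq (emit 3 [1]) (Seq (fp \<tau> (emit 3 [2])) (Seq (foreach 2 (switch 2 2 (\<lambda>a. emit 3 [4, if a = 2 then 4 else 3])))
     (Seq (emit 3 [3]) (Seq (fp g (emit 3 [5])) (Seq (fp \<tau> (emit 3 [2])) (Seq (emit 3 [6])
     (Seq (fp P_plain (emit 3 [7])) (Seq (emit 3 [8]) (fp P_rest (emit 3 [7]))))))))))"

lemma emitter_fp_sym:
  assumes "P \<in> set polys" "x < 7" "marked A S length"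
  shows "emitter length A x (fp P (emit x [s])) S (\<lambda>w. replicate (poly P (length w)) s)"
  by (rule emitter_fp[OF assms(1) _ assms(2) emitter_emit[of A "\<lambda>_. [s]"] assms(3)])
    (use assms(2) vars_emit[of x "[s]"] in \<open>auto simp: concat_replicate_single\<close>)

lemma row_prog: "emitter length UNIV 3 row_prog base \<rho>"
proof -
  have w: "emitter length UNIV 3 (foreach 2 (switch 2 2 (\<lambda>a. emit 3 [4, if a = 2 then 4 else 3]))) base
      (\<lambda>w. concat (map (\<lambda>a. [4, if a = 2 then 4 else 3]) (enc_syms w)))"
    by (rule emitter_foreach_sym[where xs = enc_syms]) (auto simp: base_def enc_syms_def bsym_def intro: pbd_sz)
  have e: "emitter length UNIV 3 (emit 3 [s]) base (\<lambda>_. [s])" for s by (rule emitter_emit) simp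
  note f = emitter_fp_sym[OF _ _ marked_stages(1), of _ 3]
  have 1: "concat (map (\<lambda>a. [4, if a = 2 then 4 else 3]) (enc_syms w)) = concat (map (\<lambda>b. [4, if b then 4 else 3]) w)" for w
    by (induction w) (auto simp: enc_syms_def)
  have 2: "poly P_plain (length w) = T w * (T w - 2) + 1 + poly \<tau> (length w)"
    "poly P_rest (length w) = poly \<tau> (length w) + 2 * length w + poly g (length w) + 1" for w
    by (simp_all add: P_plain_def P_rest_def poly_T)
  show ?thesis unfolding row_prog_def
    by (rule emitter_cong[OF emitter_Seq'[OF e emitter_Seq'[OF f emitter_Seq'[OF w emitter_Seq'[OF e emitter_Seq'[OF f
          emitter_Seq'[OF f emitter_Seq'[OF e emitter_Seq'[OF f emitter_Seq'[OF e f]]]]]]]]]])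
      (simp_all add: in_polys \<rho>_def row_syms_def 1 2 T_width)
qed

lemma length_\<rho>: "length (\<rho> w) = T w * T w"
  by (simp add: \<rho>_def length_row_syms T_width)

lemma \<rho>_range: "set (\<rho> w) \<subseteq> {1..8}"
  by (auto simp: \<rho>_def row_syms_def)

lemma \<rho>_nth: "p < T w * T w \<Longrightarrow> \<rho> w ! p \<in> {1..8}"
  using \<rho>_range[of w] nth_mem[of p "\<rho> w"] length_\<rho>[of w] by (metis subsetD)

definition Z_prog where
  "Z_prog = Seq (emit 4 [1, 2]) (Seq (fp P_T2 (emit 4 [4])) (emit 4 [3]))"

lemma Z_prog: "emitter length UNIV 4 Z_prog stage1 Z"
proof -
  have e: "emitter length UNIV 4 (emit 4 s) stage1 (\<lambda>_. s)" for s by (rule emitter_emit) simp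
  note f = emitter_fp_sym[OF _ _ marked_stages(2), of _ 4]
  show ?thesis unfolding Z_prog_def
    by (rule emitter_cong[OF emitter_Seq'[OF e emitter_Seq'[OF f e]]])
      (simp_all add: in_polys Z_def poly_T)
qed

text \<open>Binary values are obtained by counting: the counter is incremented once per round of a
  loop over the polynomial.\<close>

lemma pex_count:
  fixes S :: "bool list \<Rightarrow> store"
  assumes "P \<in> set polys" "marked UNIV S length" "x < 7" "\<And>w. S w x = tp [] 0"
    "\<And>w. S' w = (S w)(x := tp (enc_syms (bits_of_nat (poly P (length w)))) 0)"
  shows "pex length UNIV (fp P (inc x)) S S'"
proof (rule pex_fp[OF assms(1), where l = length and S = "\<lambda>w j. (S w)(x := tp (enc_syms (bits_of_nat j)) 0)"])
  show "vars (inc x) \<subseteq> {..<7}" using assms(3) by simp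
  show "pex (\<lambda>(i, j). length i) {(i, j). i \<in> UNIV \<and> j < poly P (length i)} (inc x)
     (\<lambda>(i, j). (S i)(x := tp (enc_syms (bits_of_nat j)) 0))
     (\<lambda>(i, j). (S i)(x := tp (enc_syms (bits_of_nat (Suc j))) 0))"
  proof (rule pexI)
    show "pbd (\<lambda>(i, j). length i) {(i, j). i \<in> UNIV \<and> j < poly P (length i)} (\<lambda>(i :: bool list, j :: nat). 6 * poly P (length i) + 12)"
      unfolding pbd_def by (rule exI[of _ "Polynomial.smult 6 P + [:12:]"]) auto
    fix i assume "i \<in> {(i :: bool list, j). i \<in> UNIV \<and> j < poly P (length i)}"
    then obtain w j where i: "i = (w, j)" "j < poly P (length w)" by auto
    from big_inc[of "(S w)(x := tp (enc_syms (bits_of_nat j)) 0)" x j] obtain t where t: "t \<le> 6 * j + 12"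
      "big (inc x) ((S w)(x := tp (enc_syms (bits_of_nat j)) 0)) t ((S w)(x := tp (enc_syms (bits_of_nat (Suc j))) 0))"
      by (auto simp: enc_syms_def)
    then show "\<exists>t\<le>(case i of (i, j) \<Rightarrow> 6 * poly P (length i) + 12).
        big (inc x) (case i of (i, j) \<Rightarrow> (S i)(x := tp (enc_syms (bits_of_nat j)) 0)) t
          (case i of (i, j) \<Rightarrow> (S i)(x := tp (enc_syms (bits_of_nat (Suc j))) 0))"
      using i by (intro exI[of _ t]) auto
  qed
  show "marked UNIV (\<lambda>i. (S i)(x := tp (enc_syms (bits_of_nat j)) 0)) length" for j
    using assms(2,3) by (simp add: marked_def)
  show "S w = (S w)(x := tp (enc_syms (bits_of_nat 0)) 0)" for w
    using assms(4)[of w] by (simp add: enc_syms_def fun_upd_idem)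
qed (use assms(5) in \<open>auto intro: pbd_sz\<close>)

definition prep_prog where
  "prep_prog = Seq row_prog (Seq (rewind 3) (Seq Z_prog (Seq (rewind 4) (Seq (fp P_T (inc 5)) (fp P_TT (inc 6))))))"

lemma pex_prep: "pex length UNIV prep_prog base stage4"
  unfolding prep_prog_def
proof (intro pex_Seq)
  show "pex length UNIV row_prog base (\<lambda>w. (base w)(3 := tp (\<rho> w) (int (length (\<rho> w)))))"
    by (rule emitter_pex[OF row_prog]) (simp add: base_def)
  show "pex length UNIV (rewind 3) (\<lambda>w. (base w)(3 := tp (\<rho> w) (int (length (\<rho> w))))) stage1"
  proof (rule pex_rewind[where h = "\<lambda>w. length (\<rho> w)" and xs = \<rho>])
    show "pbd length UNIV (\<lambda>w. length (\<rho> w))" unfolding length_\<rho> by (intro pbd_mult pbd_T)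
    show "((base w)(3 := tp (\<rho> w) (int (length (\<rho> w))))) 3 = tp (\<rho> w) (int (length (\<rho> w))) \<and>
        length (\<rho> w) \<le> length (\<rho> w) \<and> 0 \<notin> set (\<rho> w)" for w
      using \<rho>_range[of w] by auto
  qed (simp add: stage1_def)
  show "pex length UNIV Z_prog stage1 (\<lambda>w. (stage1 w)(4 := tp (Z w) (int (length (Z w)))))"
    by (rule emitter_pex[OF Z_prog]) (simp add: stage1_def base_def)
  show "pex length UNIV (rewind 4) (\<lambda>w. (stage1 w)(4 := tp (Z w) (int (length (Z w))))) stage2"
  proof (rule pex_rewind[where h = "\<lambda>w. length (Z w)" and xs = Z])
    have "length (Z w) = T w + 1" for w using T_ge[of w] by (simp add: Z_def)
    then show "pbd length UNIV (\<lambda>w. length (Z w))" by (simp add: pbd_T pbd_Suc)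
    show "((stage1 w)(4 := tp (Z w) (int (length (Z w))))) 4 = tp (Z w) (int (length (Z w))) \<and>
        length (Z w) \<le> length (Z w) \<and> 0 \<notin> set (Z w)" for w by (simp add: Z_def)
  qed (simp add: stage2_def)
  show "pex length UNIV (fp P_T (inc 5)) stage2 stage3"
    by (rule pex_count[OF in_polys(3) marked_stages(3)]) (simp_all add: stage3_def poly_T stage2_def stage1_def base_def)
  show "pex length UNIV (fp P_TT (inc 6)) stage3 stage4"
    by (rule pex_count[OF in_polys(5) marked_stages(4)])
      (simp_all add: stage4_def poly_T stage3_def stage2_def stage1_def base_def)
qed

subsection \<open>Loading the input\<close>

primrec marks :: "nat \<Rightarrow> com" where
  "marks 0 = Skip"
| "marks (Suc n) = Seq (marks n) (Wr (7 + n) 1 1)"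

primrec rewinds :: "nat \<Rightarrow> com" where
  "rewinds 0 = Skip"
| "rewinds (Suc n) = Seq (rewinds n) (rewind (7 + n))"

lemma pex_marks: "pex sz A (marks n) S (\<lambda>i x. if 7 \<le> x \<and> x < 7 + n then act (1, 1) (S i x) else S i x)"
proof (induction n)
  case 0
  show ?case unfolding marks.simps rewinds.simps by (rule pex_Skip) (auto simp: fun_eq_iff)
next
  case (Suc n)
  show ?case unfolding marks.simps
    by (rule pex_Seq[OF Suc pex_Wr]) (auto simp: fun_eq_iff less_Suc_eq)
qed

lemma pex_rewinds:
  assumes "pbd sz A l" "\<And>i x. i \<in> A \<Longrightarrow> 7 \<le> x \<Longrightarrow> x < 7 + n \<Longrightarrow> S i x = tp (replicate (l i) 1) (int (l i))"
  shows "pex sz A (rewinds n) S (\<lambda>i x. if 7 \<le> x \<and> x < 7 + n then tp (replicate (l i) 1) 0 else S i x)"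
  using assms(2)
proof (induction n)
  case 0
  show ?case unfolding marks.simps rewinds.simps by (rule pex_Skip) (auto simp: fun_eq_iff)
next
  case (Suc n)
  have "pex sz A (rewinds n) S (\<lambda>i x. if 7 \<le> x \<and> x < 7 + n then tp (replicate (l i) 1) 0 else S i x)"
    using Suc.prems by (intro Suc.IH) auto
  moreover have "pex sz A (rewind (7 + n)) (\<lambda>i x. if 7 \<le> x \<and> x < 7 + n then tp (replicate (l i) 1) 0 else S i x)
     (\<lambda>i x. if 7 \<le> x \<and> x < 7 + Suc n then tp (replicate (l i) 1) 0 else S i x)"
    by (rule pex_rewind[OF assms(1), where xs = "\<lambda>i. replicate (l i) 1"])
      (use Suc.prems in \<open>auto simp: fun_eq_iff less_Suc_eq\<close>)
  ultimately show ?case unfolding rewinds.simps by (rule pex_Seq)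
qed

text \<open>Tape 0 is erased while it is read because it may become the output tape. Being blank, it
  offers no mark for the way back, so its head returns in step with that of the copy on tape
  2.\<close>

definition load where
  "load = Seq (Loop 0 (\<lambda>s. s \<noteq> 0) (Seq (switch 0 2 (\<lambda>s. Wr 2 s 1)) (Seq (marks m) (Wr 0 0 1))))
     (Seq (rewinds m) (Seq (Mv 2 (-1)) (Seq (Loop 2 (\<lambda>s. s \<noteq> 0) (Seq (Mv 2 (-1)) (Mv 0 (-1)))) (Mv 2 1))))"

definition loading :: "bool list \<Rightarrow> nat \<Rightarrow> store" where
  "loading w j = (\<lambda>i. if i = 0 then tp (replicate j 0 @ enc_syms (drop j w)) (int j)
     else if i = 2 then tp (enc_syms (take j w)) (int j)
     else if 7 \<le> i \<and> i < 7 + m then tp (replicate j 1) (int j) else tp [] 0)"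

lemma tp_zeros: "tp (replicate n 0) h = tp [] h"
  by (auto simp: tp_def fun_eq_iff nat_less_iff)

lemma load: "pex length UNIV load init_store base"
  unfolding load_def
proof (rule pex_Seq, rule_tac [2] pex_Seq, rule_tac [3] pex_Seq, rule_tac [4] pex_Seq)
  show "pex length UNIV (Loop 0 (\<lambda>s. s \<noteq> 0) (Seq (switch 0 2 (\<lambda>s. Wr 2 s 1)) (Seq (marks m) (Wr 0 0 1))))
     init_store (\<lambda>w. loading w (length w))"
  proof (rule pex_Loop[where S = loading and n = length])
    let ?A = "{(w :: bool list, j). w \<in> UNIV \<and> j < length w}"
    let ?S1 = "\<lambda>(w, j). (loading w j)(2 := tp (enc_syms (take (Suc j) w)) (int (Suc j)))"
    let ?S2 = "\<lambda>(w, j) x. if 7 \<le> x \<and> x < 7 + m then act (1, 1) (?S1 (w, j) x) else ?S1 (w, j) x"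
    have sc: "scan (loading w j 0) = bsym (w ! j)" if "j < length w" for w j
      using that by (simp add: loading_def nth_append enc_syms_def)
    show "pex (\<lambda>(i, j). length i) ?A (Seq (switch 0 2 (\<lambda>s. Wr 2 s 1)) (Seq (marks m) (Wr 0 0 1)))
       (\<lambda>(i, j). loading i j) (\<lambda>(i, j). loading i (Suc j))"
    proof (rule pex_Seq, rule_tac [2] pex_Seq)
      show "pex (\<lambda>(i, j). length i) ?A (switch 0 2 (\<lambda>s. Wr 2 s 1)) (\<lambda>(i, j). loading i j) ?S1"
      proof (rule pex_switch)
        show "scan ((case i of (i, j) \<Rightarrow> loading i j) 0) \<le> 2" if "i \<in> ?A" for i
          using that sc by (auto simp: bsym_def)
        fix s :: nat
        show "pex (\<lambda>(i, j). length i) {i \<in> ?A. scan ((case i of (i, j) \<Rightarrow> loading i j) 0) = s} (Wr 2 s 1)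
            (\<lambda>(i, j). loading i j) ?S1"
        proof (rule pex_Wr)
          fix i assume "i \<in> {i \<in> ?A. scan ((case i of (i, j) \<Rightarrow> loading i j) 0) = s}"
          then obtain w j where i: "i = (w, j)" "j < length w" "scan (loading w j 0) = s" by auto
          have "loading w j 2 = tp (enc_syms (take j w)) (int (length (enc_syms (take j w))))"
            using i by (simp add: loading_def enc_syms_def)
          then have "act (s, 1) (loading w j 2) = tp (enc_syms (take (Suc j) w)) (int (Suc j))"
            using i sc[OF i(2)] act_tp_end[of s 1 "enc_syms (take j w)"]
            by (simp add: enc_syms_def take_Suc_conv_app_nth add.commute)
          then show "?S1 i = (case i of (i, j) \<Rightarrow> loading i j)(2 := act (s, 1) ((case i of (i, j) \<Rightarrow> loading i j) 2))"
            using i by simp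
        qed
      qed
      show "pex (\<lambda>(i, j). length i) ?A (marks m) ?S1 ?S2"
        by (rule pex_cong[OF pex_marks]) auto
      show "pex (\<lambda>(i, j). length i) ?A (Wr 0 0 1) ?S2 (\<lambda>(i, j). loading i (Suc j))"
      proof (rule pex_Wr)
        fix i assume "i \<in> ?A"
        then obtain w j where i: "i = (w, j)" "j < length w" by auto
        have "enc_syms (drop j w) = bsym (w ! j) # enc_syms (drop (Suc j) w)"
          using i(2) by (simp add: enc_syms_def Cons_nth_drop_Suc[symmetric])
        then have "act (0, 1) (loading w j 0) = tp (replicate (Suc j) 0 @ enc_syms (drop (Suc j) w)) (int (Suc j))"
          using act_tp_mid[of 0 1 "replicate j 0" "bsym (w ! j)" "enc_syms (drop (Suc j) w)"]
          by (simp add: loading_def add.commute replicate_app_Cons_same)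
        moreover have "act (1, 1) (tp (replicate j 1) (int j)) = tp (replicate (Suc j) 1) (int (Suc j))"
          using act_tp_end[of 1 1 "replicate j 1"] by (simp add: add.commute replicate_append_same)
        ultimately show "(case i of (i, j) \<Rightarrow> loading i (Suc j)) = (?S2 i)(0 := act (0, 1) (?S2 i 0))"
          using i by (auto simp: fun_eq_iff loading_def)
      qed
    qed
    show "init_store w = loading w 0" for w
      by (auto simp: fun_eq_iff init_store_def loading_def tape_of_tp enc_syms_def)
    show "scan (loading w j 0) \<noteq> 0" if "j < length w" for w j
      using sc[OF that] by (simp add: bsym_def)
    show "\<not> scan (loading w (length w) 0) \<noteq> 0" for w by (simp add: loading_def enc_syms_def)
  qed (auto intro: pbd_sz)
  let ?R = "\<lambda>w h2 h0 x. if x = 2 then tp (enc_syms w) h2 else if x = 0 then tp [] h0 else base w x"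
  show "pex length UNIV (rewinds m) (\<lambda>w. loading w (length w)) (\<lambda>w. ?R w (int (length w)) (int (length w)))"
    by (rule pex_cong[OF pex_rewinds[OF pbd_sz, where S = "\<lambda>w. loading w (length w)"]])
      (auto simp: loading_def base_def fun_eq_iff enc_syms_def tp_zeros)
  show "pex length UNIV (Mv 2 (- 1)) (\<lambda>w. ?R w (int (length w)) (int (length w))) (\<lambda>w. ?R w (int (length w) - 1) (int (length w)))"
    by (rule pex_Mv) (auto simp: fun_eq_iff)
  show "pex length UNIV (Loop 2 (\<lambda>s. s \<noteq> 0) (Seq (Mv 2 (-1)) (Mv 0 (-1)))) (\<lambda>w. ?R w (int (length w) - 1) (int (length w)))
     (\<lambda>w. ?R w (- 1) 0)"
  proof (rule pex_Loop[where S = "\<lambda>w j. ?R w (int (length w) - 1 - int j) (int (length w) - int j)" and n = length])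
    show "pex (\<lambda>(i, j). length i) {(i, j). i \<in> UNIV \<and> j < length i} (Seq (Mv 2 (-1)) (Mv 0 (-1)))
      (\<lambda>(w, j). ?R w (int (length w) - 1 - int j) (int (length w) - int j))
      (\<lambda>(w, j). ?R w (int (length w) - 1 - int (Suc j)) (int (length w) - int (Suc j)))"
    proof (rule pex_Seq)
      show "pex (\<lambda>(i, j). length i) {(i, j). i \<in> UNIV \<and> j < length i} (Mv 2 (-1))
       (\<lambda>(w, j). ?R w (int (length w) - 1 - int j) (int (length w) - int j))
       (\<lambda>(w, j). ?R w (int (length w) - 1 - int (Suc j)) (int (length w) - int j))"
        by (rule pex_Mv) (auto simp: fun_eq_iff algebra_simps)
      show "pex (\<lambda>(i, j). length i) {(i, j). i \<in> UNIV \<and> j < length i} (Mv 0 (-1))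
       (\<lambda>(w, j). ?R w (int (length w) - 1 - int (Suc j)) (int (length w) - int j))
       (\<lambda>(w, j). ?R w (int (length w) - 1 - int (Suc j)) (int (length w) - int (Suc j)))"
        by (rule pex_Mv) (auto simp: fun_eq_iff algebra_simps)
    qed
    fix w :: "bool list" and j assume j: "j < length w"
    then have h: "int (length w) - 1 - int j = int (length w - 1 - j)" by simp
    show "scan (?R w (int (length w) - 1 - int j) (int (length w) - int j) 2) \<noteq> 0"
      unfolding h if_P[OF refl] scan_tp using j by (simp add: enc_syms_def bsym_def)
  qed (auto intro: pbd_sz)
  show "pex length UNIV (Mv 2 1) (\<lambda>w. ?R w (- 1) 0) base"
    by (rule pex_Mv) (auto simp: fun_eq_iff base_def)
qed

subsection \<open>Writing the instance\<close>

lemma stage4_simps: "stage4 w 0 = tp [] 0" "stage4 w 1 = tp [] 0" "stage4 w 3 = tp (\<rho> w) 0" "stage4 w 4 = tp (Z w) 0"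
  "stage4 w 5 = tp (enc_syms (bits_of_nat (T w))) 0" "stage4 w 6 = tp (enc_syms (bits_of_nat (T w * T w))) 0"
  by (simp_all add: stage4_def stage3_def stage2_def stage1_def base_def)

definition encv :: "bool list \<Rightarrow> num \<Rightarrow> nat list" where
  "encv w v = enc_syms (enc_rat (val (b * T w) v))"

definition block :: "bool list \<Rightarrow> nat \<Rightarrow> nat \<Rightarrow> nat \<Rightarrow> nat list" where
  "block w p p' s = concat (map (\<lambda>s'. encv w (entry N q (\<rho> w ! p) (rel (T w) p p') s s')) [0..<D])"

text \<open>The symbol \<open>a\<close> and the slots \<open>s\<close> and \<open>s'\<close> range
  over sets that do not depend on the input. They are resolved in the text of the program, so all
  entries are constants except for the digits of \<open>T\<close>.\<close>

definition cell_prog :: "nat \<Rightarrow> nat \<Rightarrow> nat \<Rightarrow> com" where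
  "cell_prog out a s = switch 4 4 (\<lambda>z. seqs (map (\<lambda>s'. emit_num e out (entry N q a z s s')) [0..<D]))"

text \<open>For a vector of cell \<open>p\<close> the head on tape 4 starts at \<open>- p\<close>
  and advances with \<open>p'\<close>, thus standing at \<open>p' - p\<close>; afterwards it goes
  back for the next slot.\<close>

definition vec_prog :: "nat \<Rightarrow> nat \<Rightarrow> nat \<Rightarrow> com" where
  "vec_prog out a s = Seq (fp P_TT (Seq (cell_prog out a s) (Mv 4 1))) (fp P_TT (Mv 4 (-1)))"

definition basis_prog :: "nat \<Rightarrow> com" where
  "basis_prog out = Loop 3 (\<lambda>s. s \<noteq> 0) (Seq (switch 3 8 (\<lambda>a. seqs (map (vec_prog out a) [0..<D]))) (Seq (Mv 4 (-1)) (Mv 3 1)))"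

definition bstore :: "bool list \<times> nat \<Rightarrow> nat \<Rightarrow> store" where
  "bstore wp p' = (stage4 (fst wp))(3 := tp (\<rho> (fst wp)) (int (snd wp)), 4 := tp (Z (fst wp)) (int p' - int (snd wp)))"

text \<open>The scanned symbol is not literally \<open>rel\<close>: between the marks it is 4
  instead of 0. Both mean unrelated to \<open>entry\<close>.\<close>

lemma scan_Z:
  "entry N q a (scan (tp (Z w) (int p' - int p))) s s' = entry N q a (rel (T w) p p') s s'"
  "scan (tp (Z w) h) \<le> 4"
proof -
  have T: "T w = Suc (Suc (T w - 2))" using T_ge[of w] by simp
  have Z: "scan (tp (Z w) (int d)) = (if d = 0 then 1 else if d = 1 then 2 else if d < T w then 4 else if d = T w then 3 else 0)" for d
    unfolding scan_tp using T_ge[of w] by (auto simp: Z_def nth_append nth_Cons split: nat.splits)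
  show "scan (tp (Z w) h) \<le> 4"
    by (cases "h < 0") (use Z[of "nat h"] in auto)
  show "entry N q a (scan (tp (Z w) (int p' - int p))) s s' = entry N q a (rel (T w) p p') s s'"
  proof (cases "p \<le> p'")
    case True
    then have "int p' - int p = int (p' - p)" by simp
    then show ?thesis using Z[of "p' - p"] True T_ge[of w] by (auto simp: rel_def entry_def)
  next
    case False
    then show ?thesis by (auto simp: rel_def entry_def)
  qed
qed

lemma marked_bstore: "marked A (\<lambda>i. bstore (f i) (h i)) (\<lambda>i. length (fst (f i)))"
  using marked_stages(5) by (simp add: marked_def bstore_def)

lemma pbd_T': "pbd (\<lambda>i. length (f i)) A (\<lambda>i. T (f i))"
  unfolding T_def[abs_def] by (intro pbd_poly pbd_sz)

lemma vars_cell: "vars (cell_prog out a s) \<subseteq> {out, 4, 5}"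
  unfolding cell_prog_def
proof (intro vars_switch vars_seqs)
  fix z c assume "c \<in> set (map (\<lambda>s'. emit_num e out (entry N q a z s s')) [0..<D])"
  then obtain v where "c = emit_num e out v" by auto
  then show "vars c \<subseteq> {out, 4, 5}" using vars_emit_num[of e out v] by auto
qed simp

lemma cell_prog:
  assumes out: "out < 2"
  shows "emitter (\<lambda>i. length (fst (f i))) A out (cell_prog out (a :: nat) s)
      (\<lambda>i. bstore (f i) (h i))
      (\<lambda>i. concat (map (\<lambda>s'. encv (fst (f i)) (entry N q a (rel (T (fst (f i))) (snd (f i)) (h i)) s s')) [0..<D]))"
  unfolding cell_prog_def
proof (rule emitter_switch)
  show "scan (bstore (f i) (h i) 4) \<le> 4" for i by (simp add: bstore_def scan_Z(2))
  show "4 \<noteq> out" using out by simp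
  fix z assume "z \<le> (4 :: nat)"
  let ?A = "{i \<in> A. scan (bstore (f i) (h i) 4) = z}"
  have "emitter (\<lambda>i. length (fst (f i))) ?A out (seqs (map (\<lambda>s'. emit_num e out (entry N q a z s s')) [0..<D]))
      (\<lambda>i. bstore (f i) (h i)) (\<lambda>i. concat (map (\<lambda>s'. encv (fst (f i)) (entry N q a z s s')) [0..<D]))"
  proof (rule emitter_seqs)
    fix s'
    show "emitter (\<lambda>i. length (fst (f i))) ?A out (emit_num e out (entry N q a z s s')) (\<lambda>i. bstore (f i) (h i))
       (\<lambda>i. encv (fst (f i)) (entry N q a z s s'))"
    proof (rule emitter_num[where T = "\<lambda>i. T (fst (f i))"])
      show "bstore (f i) (h i) 5 = tp (enc_syms (bits_of_nat (T (fst (f i))))) 0 \<and> 0 < T (fst (f i))" for i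
        using T_ge[of "fst (f i)"] by (simp add: bstore_def stage4_simps)
    qed (use out in \<open>auto simp: encv_def intro: pbd_T'\<close>)
  qed
  then show "emitter (\<lambda>i. length (fst (f i))) ?A out (seqs (map (\<lambda>s'. emit_num e out (entry N q a z s s')) [0..<D]))
      (\<lambda>i. bstore (f i) (h i))
      (\<lambda>i. concat (map (\<lambda>s'. encv (fst (f i)) (entry N q a (rel (T (fst (f i))) (snd (f i)) (h i)) s s')) [0..<D]))"
  proof (rule emitter_cong)
    fix i assume "i \<in> ?A"
    then have "z = scan (tp (Z (fst (f i))) (int (h i) - int (snd (f i))))" by (auto simp: bstore_def)
    then show "concat (map (\<lambda>s'. encv (fst (f i)) (entry N q a z s s')) [0..<D]) =
      concat (map (\<lambda>s'. encv (fst (f i)) (entry N q a (rel (T (fst (f i))) (snd (f i)) (h i)) s s')) [0..<D])"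
      by (simp add: scan_Z(1))
  qed
qed

lemma vec_prog:
  assumes out: "out < 2" and A: "\<And>w p. (w, p) \<in> A \<Longrightarrow> \<rho> w ! p = a"
  shows "emitter (\<lambda>wp. length (fst wp)) A out (vec_prog out a s) (\<lambda>wp. bstore wp 0)
      (\<lambda>wp. concat (map (\<lambda>p'. block (fst wp) (snd wp) p' s) [0..<T (fst wp) * T (fst wp)]))"
  unfolding vec_prog_def emitter_def
proof (rule pex_Seq)
  let ?TT = "\<lambda>wp. T (fst wp) * T (fst wp)"
  let ?out = "\<lambda>wp ys. app (ys @ concat (map (\<lambda>p'. block (fst wp) (snd wp) p' s) [0..<?TT wp])) (bstore wp 0 out)"
  let ?mid = "\<lambda>(wp, ys). (bstore wp (?TT wp))(out := ?out wp ys)"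
  have o4: "out \<noteq> 4" "out < 7" using out by simp_all
  have pTT: "poly P_TT (length (fst wp)) = ?TT wp" for wp :: "bool list \<times> nat" by (simp add: poly_T)
  show "pex (\<lambda>(wp, ys). length (fst wp)) (A \<times> UNIV) (fp P_TT (Seq (cell_prog out a s) (Mv 4 1)))
     (\<lambda>(wp, ys). (bstore wp 0)(out := app ys (bstore wp 0 out))) ?mid"
    unfolding fp_def
  proof (rule emitter_forpoly_family[where S = bstore and ss = "\<lambda>wp p'. block (fst wp) (snd wp) p' s" and l = "\<lambda>wp. length (fst wp)"])
    show "vars (Seq (cell_prog out a s) (Mv 4 1)) \<subseteq> {..<7}" using vars_cell[of out a s] out by auto
    show "out < 7" by fact
    show "bstore i j x = tp (replicate (length (fst i)) 1) 0" if "i \<in> A" "7 \<le> x" "x < 7 + length (coeffs P_TT)" for i j x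
      using marked_bstore[of A id "\<lambda>_. j"] that coeffs_le[OF in_polys(5)] by (simp add: marked_def)
    show "pex (\<lambda>((i, j), ys). length (fst i)) ({(i, j). i \<in> A \<and> j < pval (coeffs P_TT) (length (fst i))} \<times> UNIV)
       (Seq (cell_prog out a s) (Mv 4 1)) (\<lambda>((i, j), ys). (bstore i j)(out := app ys (bstore i 0 out)))
       (\<lambda>((i, j), ys). (bstore i (Suc j))(out := app (ys @ block (fst i) (snd i) j s) (bstore i 0 out)))"
    proof (rule pex_Seq)
      have b0: "bstore i j out = stage4 (fst i) out" for i j using out by (simp add: bstore_def)
      show "pex (\<lambda>((i, j), ys). length (fst i)) ({(i, j). i \<in> A \<and> j < pval (coeffs P_TT) (length (fst i))} \<times> UNIV)
         (cell_prog out a s) (\<lambda>((i, j), ys). (bstore i j)(out := app ys (bstore i 0 out)))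
         (\<lambda>((i, j), ys). (bstore i j)(out := app (ys @ block (fst i) (snd i) j s) (bstore i 0 out)))"
        by (rule pex_sub[OF cell_prog[OF out, of fst UNIV a s snd, unfolded emitter_def], where g = id])
          (auto simp: A block_def b0)
      show "pex (\<lambda>((i, j), ys). length (fst i)) ({(i, j). i \<in> A \<and> j < pval (coeffs P_TT) (length (fst i))} \<times> UNIV)
         (Mv 4 1) (\<lambda>((i, j), ys). (bstore i j)(out := app (ys @ block (fst i) (snd i) j s) (bstore i 0 out)))
         (\<lambda>((i, j), ys). (bstore i (Suc j))(out := app (ys @ block (fst i) (snd i) j s) (bstore i 0 out)))"
        by (rule pex_Mv) (use o4 in \<open>auto simp: bstore_def fun_eq_iff algebra_simps\<close>)
    qed
    show "pbd (\<lambda>wp. length (fst wp)) A (\<lambda>wp. length (fst wp))" by (rule pbd_sz)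
  qed (auto simp: pval_coeffs pTT)
  show "pex (\<lambda>(wp, ys). length (fst wp)) (A \<times> UNIV) (fp P_TT (Mv 4 (- 1))) ?mid
     (\<lambda>(wp, ys). (bstore wp 0)(out := ?out wp ys))"
  proof (rule pex_fp[OF in_polys(5), where l = "\<lambda>(wp, ys). length (fst wp)" and
        S = "\<lambda>(wp, ys) j. (bstore wp 0)(4 := tp (Z (fst wp)) (int (?TT wp) - int (snd wp) - int j), out := ?out wp ys)"])
    show "pex (\<lambda>(i, j). case i of (wp, ys) \<Rightarrow> length (fst wp))
       {(i, j). i \<in> A \<times> UNIV \<and> j < poly P_TT (case i of (wp, ys) \<Rightarrow> length (fst wp))} (Mv 4 (- 1))
       (\<lambda>(i, j). (case i of (wp, ys) \<Rightarrow> \<lambda>j. (bstore wp 0)(4 := tp (Z (fst wp)) (int (?TT wp) - int (snd wp) - int j), out := ?out wp ys)) j)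
       (\<lambda>(i, j). (case i of (wp, ys) \<Rightarrow> \<lambda>j. (bstore wp 0)(4 := tp (Z (fst wp)) (int (?TT wp) - int (snd wp) - int j), out := ?out wp ys)) (Suc j))"
      by (rule pex_Mv) (use o4 in \<open>auto simp: fun_eq_iff algebra_simps\<close>)
    show "marked (A \<times> UNIV) (\<lambda>i. (case i of (wp, ys) \<Rightarrow> \<lambda>j. (bstore wp 0)(4 := tp (Z (fst wp)) (int (?TT wp) - int (snd wp) - int j), out := ?out wp ys)) j)
       (\<lambda>(wp, ys). length (fst wp))" for j
      using marked_bstore[of A id "\<lambda>_. 0"] o4 by (auto simp: marked_def)
    show "pbd (\<lambda>(wp, ys). length (fst wp)) (A \<times> UNIV) (\<lambda>(wp, ys). length (fst wp))" by (rule pbd_sz)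
  qed (use o4 in \<open>auto simp: bstore_def fun_eq_iff poly_T\<close>)
qed

end

lemma concat_replicate_replicate: "concat (replicate n (replicate m x)) = replicate (n * m) x"
  by (induction n) (auto simp: replicate_add)

context generator
begin

definition cells :: "bool list \<Rightarrow> nat \<Rightarrow> nat list" where
  "cells w p = concat (map (\<lambda>s. concat (map (\<lambda>p'. block w p p' s) [0..<T w * T w])) [0..<D])"

definition basis_out :: "bool list \<Rightarrow> nat list" where
  "basis_out w = concat (map (cells w) [0..<T w * T w])"

lemma pbd_TT: "pbd length A (\<lambda>w. T w * T w)"
  by (intro pbd_mult pbd_T)

lemma basis_prog:
  assumes out: "out < 2"
  shows "pex (\<lambda>(w, ys). length w) UNIV (basis_prog out) (\<lambda>(w, ys). (stage4 w)(out := app ys (stage4 w out)))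
    (\<lambda>(w, ys). (bstore (w, T w * T w) 0)(out := app (ys @ basis_out w) (stage4 w out)))"
proof -
  have o: "out \<noteq> 3" "out \<noteq> 4" using out by simp_all
  let ?U = "\<lambda>(w, ys) j. (bstore (w, j) 0)(out := app (ys @ concat (map (cells w) [0..<j])) (stage4 w out))"
  let ?V = "\<lambda>((w, ys), j). (bstore (w, j) 0)(out := app (ys @ concat (map (cells w) [0..<Suc j])) (stage4 w out))"
  let ?W = "\<lambda>((w, ys), j). (?V ((w, ys), j))(4 := tp (Z w) (- int (Suc j)))"
  let ?n = "\<lambda>(w, ys :: nat list). T w * T w"
  have stage3: "stage4 w 3 = tp (\<rho> w) 0" "stage4 w 4 = tp (Z w) 0" for w by (simp_all add: stage4_simps)
  show ?thesis unfolding basis_prog_def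
  proof (rule pex_Loop[where S = ?U and n = ?n])
    let ?A = "{(i, j). i \<in> UNIV \<and> j < ?n i}"
    show "pex (\<lambda>(i, j). case i of (w, ys) \<Rightarrow> length w) ?A
       (Seq (switch 3 8 (\<lambda>a. seqs (map (vec_prog out a) [0..<D]))) (Seq (Mv 4 (-1)) (Mv 3 1)))
       (\<lambda>(i, j). ?U i j) (\<lambda>(i, j). ?U i (Suc j))"
    proof (rule pex_Seq, rule_tac [2] pex_Seq)
      have sc: "scan (?U (w, ys) j 3) = \<rho> w ! j" if "j < T w * T w" for w ys j
        using that o by (simp add: bstore_def length_\<rho>)
      have sc': "scan (bstore (w, j) 0 3) = \<rho> w ! j" if "j < T w * T w" for w j
        using that by (simp add: bstore_def length_\<rho>)
      show "pex (\<lambda>(i, j). case i of (w, ys) \<Rightarrow> length w) ?A (switch 3 8 (\<lambda>a. seqs (map (vec_prog out a) [0..<D])))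
         (\<lambda>(i, j). ?U i j) ?V"
      proof (rule pex_switch)
        show "scan ((case i of (i, j) \<Rightarrow> ?U i j) 3) \<le> 8" if "i \<in> ?A" for i
        proof -
          from that obtain w ys j where i: "i = ((w, ys), j)" "j < T w * T w" by auto
          show ?thesis using sc[OF i(2), of ys] \<rho>_nth[OF i(2)] i(1) by simp
        qed
        fix a :: nat
        have em: "emitter (\<lambda>wp. length (fst wp)) {wp. \<rho> (fst wp) ! snd wp = a} out (seqs (map (vec_prog out a) [0..<D]))
          (\<lambda>wp. bstore wp 0) (\<lambda>wp. cells (fst wp) (snd wp))"
          unfolding cells_def by (rule emitter_seqs) (rule vec_prog[OF out], simp)
        have b0: "bstore wp 0 out = stage4 (fst wp) out" for wp using o by (simp add: bstore_def)
        show "pex (\<lambda>(i, j). case i of (w, ys) \<Rightarrow> length w) {i \<in> ?A. scan ((case i of (i, j) \<Rightarrow> ?U i j) 3) = a}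
          (seqs (map (vec_prog out a) [0..<D])) (\<lambda>(i, j). ?U i j) ?V"
          by (rule pex_sub[OF em[unfolded emitter_def], where g = "\<lambda>((w, ys), j). ((w, j), ys @ concat (map (cells w) [0..<j]))"])
            (use o sc' in \<open>auto simp: b0\<close>)
      qed
      have ar: "- 1 - int j = - int j - 1" for j by simp
      show "pex (\<lambda>(i, j). case i of (w, ys) \<Rightarrow> length w) ?A (Mv 4 (-1)) ?V ?W"
        by (rule pex_Mv) (use o in \<open>auto simp: bstore_def fun_eq_iff ar\<close>)
      show "pex (\<lambda>(i, j). case i of (w, ys) \<Rightarrow> length w) ?A (Mv 3 1) ?W (\<lambda>(i, j). ?U i (Suc j))"
        by (rule pex_Mv) (use o in \<open>auto simp: bstore_def fun_eq_iff algebra_simps\<close>)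
    qed
    show "pbd (\<lambda>(w, ys). length w) UNIV ?n" using pbd_TT[of UNIV] unfolding pbd_def by fastforce
    show "scan (?U i j 3) \<noteq> 0" if "j < ?n i" for i j
    proof -
      obtain w ys where i: "i = (w, ys)" by fastforce
      then have "j < T w * T w" using that by simp
      then show ?thesis using \<rho>_nth[of j w] o i by (auto simp: bstore_def length_\<rho>)
    qed
    show "\<not> scan (?U i (?n i) 3) \<noteq> 0" for i
    proof -
      obtain w ys where i: "i = (w, ys)" by fastforce
      have "int (T w) * int (T w) = int (T w * T w)" by simp
      then show ?thesis using o i by (simp add: bstore_def length_\<rho> del: of_nat_mult)
    qed
    show "(case i of (w, ys) \<Rightarrow> (stage4 w)(out := app ys (stage4 w out))) = ?U i 0" for i
      by (cases i) (use stage3 o in \<open>auto simp: bstore_def fun_eq_iff\<close>)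
    show "(case i of (w, ys) \<Rightarrow> (bstore (w, T w * T w) 0)(out := app (ys @ basis_out w) (stage4 w out))) = ?U i (?n i)" for i
      by (cases i) (simp add: basis_out_def)
  qed
qed

text \<open>The dimension is \<open>2 ^ (2 * e + 3) * (T * T)\<close>, and \<open>[2, 1]\<close> is
  the framed digit False. The digits of \<open>T * T\<close> are on tape 6.\<close>

definition dim_prog :: "nat \<Rightarrow> com" where
  "dim_prog out = Seq (emit out (concat (replicate (2 * e + 3) [2, 1]))) (emit_frame 6 out)"

definition head_prog :: "nat \<Rightarrow> com" where
  "head_prog out = (let num = emit_num e out in
     Seq (dim_prog out) (Seq (dim_prog out) (Seq (fp P_H (num (Num 0))) (Seq (num (Num (-1))) (Seq (fp P_h (num (Num 0)))
       (fp P_TT (Seq (repeat q (num NegHalf)) (repeat q (num (Num 0))))))))))"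

text \<open>With \<open>dec\<close> the threshold \<open>- 1 / (2 * k)\<close>, the smaller of the
  two objective values, is appended.\<close>

definition gen_prog :: "bool \<Rightarrow> nat \<Rightarrow> com" where
  "gen_prog dec out = Seq (head_prog out) (Seq (basis_prog out) (if dec then emit_num e out NegHalf else Skip))"

definition dim where "dim w = T w * T w * D" for w

lemma dim_pow: "dim w = 2 ^ (2 * e + 3) * (T w * T w)"
proof -
  have "b * b = 2 ^ (2 * e)" by (simp add: power_add[symmetric] mult_2)
  then have "D = 8 * 2 ^ (2 * e)" by (simp add: D_def q_def mult.assoc)
  then show ?thesis by (simp add: dim_def power_add)
qed

lemma T_pos: "0 < T w * T w"
  using T_ge[of w] by simp

lemma poly_H: "poly P_H (length w) = dim w * dim w"
  by (simp add: P_H_def poly_T dim_def)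

lemma D_pos: "0 < D"
  by (simp add: D_def q_def)

lemma poly_h: "Suc (poly P_h (length w)) = dim w"
proof -
  obtain t where t: "T w = Suc t" using T_ge[of w] by (cases "T w") auto
  obtain d where d: "D = Suc d" using D_pos by (cases D) auto
  show ?thesis by (simp add: P_h_def poly_T dim_def t d algebra_simps)
qed

definition head_out :: "bool list \<Rightarrow> nat list" where
  "head_out w = enc_syms (enc_nat (dim w)) @ enc_syms (enc_nat (dim w)) @ concat (replicate (dim w * dim w) (encv w (Num 0))) @
     encv w (Num (-1)) @ concat (replicate (dim w - 1) (encv w (Num 0))) @
     concat (replicate (T w * T w) (concat (replicate q (encv w NegHalf)) @ concat (replicate q (encv w (Num 0)))))"

lemma emitter_encv:
  assumes "out < 2" "\<And>w. S w 5 = tp (enc_syms (bits_of_nat (T w))) 0"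
  shows "emitter length UNIV out (emit_num e out v) S (\<lambda>w. encv w v)"
  by (rule emitter_num[where T = T]) (use assms T_ge in \<open>auto simp: encv_def pbd_T intro: less_le_trans[of 0 3]\<close>)

lemma vars_num: "out < 2 \<Longrightarrow> vars (emit_num e out v) \<subseteq> {..<7}"
  using vars_emit_num[of e out v] by auto

lemma head_prog:
  assumes out: "out < 2"
  shows "emitter length UNIV out (head_prog out) stage4 head_out"
proof -
  have num: "emitter length UNIV out (emit_num e out v) stage4 (\<lambda>w. encv w v)" for v
    using out by (intro emitter_encv) (simp_all add: stage4_simps)
  have dims: "emitter length UNIV out (dim_prog out) stage4 (\<lambda>w. enc_syms (enc_nat (dim w)))"
    unfolding dim_prog_def
  proof (rule emitter_Seq[OF emitter_emit[OF refl] emitter_frame[OF _ _ _ refl]])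
    show "6 \<noteq> out" using out by simp
    show "stage4 w 6 = tp (enc_syms (bits_of_nat (T w * T w))) 0" for w by (simp add: stage4_simps)
    show "pbd length UNIV (\<lambda>w. length (bits_of_nat (T w * T w)))"
      by (rule pbd_le[OF pbd_TT]) (rule length_bits)
    show "enc_syms (enc_nat (dim w)) = concat (replicate (2 * e + 3) [2, 1]) @ enc_syms (frame (bits_of_nat (T w * T w)))" for w
      unfolding dim_pow enc_nat_pow2[OF T_pos] by (simp add: enc_syms_def map_concat map_replicate)
  qed
  have fpn: "emitter length UNIV out (fp P (emit_num e out v)) stage4 (\<lambda>w. concat (replicate (poly P (length w)) (encv w v)))"
    if "P \<in> set polys" for P v
    by (rule emitter_fp[OF that vars_num[OF out] _ num marked_stages(5)]) (use out in \<open>auto intro: pbd_sz\<close>)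
  have c: "emitter length UNIV out (Seq (repeat q (emit_num e out NegHalf)) (repeat q (emit_num e out (Num 0)))) stage4
     (\<lambda>w. concat (replicate q (encv w NegHalf)) @ concat (replicate q (encv w (Num 0))))"
    by (intro emitter_Seq' emitter_repeat[OF num] refl)
  have fpc: "emitter length UNIV out (fp P_TT (Seq (repeat q (emit_num e out NegHalf)) (repeat q (emit_num e out (Num 0))))) stage4
     (\<lambda>w. concat (replicate (T w * T w) (concat (replicate q (encv w NegHalf)) @ concat (replicate q (encv w (Num 0))))))"
    by (rule emitter_fp[OF in_polys(5) _ _ c marked_stages(5)])
      (use out vars_repeat[OF vars_num[OF out]] in \<open>auto intro: pbd_sz simp: poly_T\<close>)
  have h: "poly P_h (length w) = dim w - 1" for w using poly_h[of w] by simp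
  show ?thesis unfolding head_prog_def Let_def
    by (rule emitter_cong[OF emitter_Seq'[OF dims emitter_Seq'[OF dims emitter_Seq'[OF fpn[OF in_polys(8)] emitter_Seq'[OF num
        emitter_Seq'[OF fpn[OF in_polys(9)] fpc]]]]]])
      (simp add: head_out_def poly_H h)
qed

definition code :: "bool \<Rightarrow> bool list \<Rightarrow> nat list" where
  "code dec w = head_out w @ basis_out w @ (if dec then encv w NegHalf else [])"

lemma gen_prog:
  assumes out: "out < 2"
  shows "pex length UNIV (gen_prog dec out) stage4
    (\<lambda>w. (bstore (w, T w * T w) 0)(out := tp (code dec w) (int (length (code dec w)))))"
  unfolding gen_prog_def
proof (rule pex_Seq, rule_tac [2] pex_Seq)
  have s4: "stage4 w out = tp [] 0" for w using out stage4_simps(1,2)[of w] by (metis less_2_cases_iff One_nat_def)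
  show "pex length UNIV (head_prog out) stage4 (\<lambda>w. (stage4 w)(out := app (head_out w) (stage4 w out)))"
    by (rule emitter_pex[OF head_prog[OF out]]) simp
  let ?S = "\<lambda>w. (bstore (w, T w * T w) 0)(out := app (head_out w @ basis_out w) (stage4 w out))"
  show "pex length UNIV (basis_prog out) (\<lambda>w. (stage4 w)(out := app (head_out w) (stage4 w out))) ?S"
    by (rule pex_sub[OF basis_prog[OF out], where g = "\<lambda>w. (w, head_out w)"]) auto
  let ?R = "\<lambda>w. (bstore (w, T w * T w) 0)(out := tp (code dec w) (int (length (code dec w))))"
  show "pex length UNIV (if dec then emit_num e out NegHalf else Skip) ?S ?R"
  proof (cases dec)
    case True
    have "emitter length UNIV out (emit_num e out NegHalf) ?S (\<lambda>w. encv w NegHalf)"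
      using out by (intro emitter_encv) (simp_all add: bstore_def stage4_simps)
    then have "pex length UNIV (emit_num e out NegHalf) ?S ?R"
    proof (rule emitter_pex)
      fix w
      show "?R w = (?S w)(out := app (encv w NegHalf) (?S w out))"
        using app_tp[of "encv w NegHalf" "head_out w @ basis_out w"] by (simp add: s4 code_def True add.assoc)
    qed
    then show ?thesis using True by simp
  next
    case False
    then show ?thesis by (auto intro!: pex_Skip simp: s4 code_def)
  qed
qed

sublocale inst: lattice N b "T w" "\<rho> w" for w
proof
  show "1 \<le> b" by simp
  show "2 \<le> T w" using T_ge[of w] by simp
  show "count N < 4 * b * b" by (rule count)
  show "\<rho> w ! p \<le> 8" if "p < T w * T w" for p using \<rho>_nth[OF that] by simp
qed (rule pos)

lemma inst_eqs: "inst.q = q" "inst.D = D" "inst.k w = b * T w" "inst.dim w = dim w"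
  by (simp_all add: inst.q_def q_def inst.D_def D_def inst.k_def inst.dim_def dim_def)

end

subsection \<open>The encoding of instances is injective\<close>

lemma frame_simps: "frame [] = [False]" "frame (b # bs) = True # b # frame bs"
  by (simp_all add: frame_def)

lemma frame_inj: "frame xs @ r = frame ys @ r' \<Longrightarrow> xs = ys \<and> r = r'"
proof (induction xs arbitrary: ys)
  case Nil
  then show ?case by (cases ys) (auto simp: frame_simps)
next
  case (Cons x xs)
  then show ?case by (cases ys) (auto simp: frame_simps)
qed

lemma bits_inj: "bits_of_nat n = bits_of_nat n' \<Longrightarrow> n = n'"
proof (induction n arbitrary: n' rule: less_induct)
  case (less n)
  show ?case
  proof (cases "n = 0 \<or> n' = 0")
    case True
    then show ?thesis using less.prems by (cases "n = 0"; cases "n' = 0") (auto simp: bits_pos)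
  next
    case False
    then have "odd n = odd n'" "bits_of_nat (n div 2) = bits_of_nat (n' div 2)"
      using less.prems by (simp_all add: bits_pos)
    then have "n div 2 = n' div 2" "n mod 2 = n' mod 2"
      using False less.IH[of "n div 2" "n' div 2"] by (auto simp: odd_iff_mod_2_eq_one even_iff_mod_2_eq_zero)
    then show ?thesis by (metis div_mult_mod_eq)
  qed
qed

lemma enc_nat_inj: "enc_nat n @ r = enc_nat n' @ r' \<Longrightarrow> n = n' \<and> r = r'"
  unfolding enc_nat_def using frame_inj bits_inj by blast

lemma enc_int_inj: "enc_int z @ r = enc_int z' @ r' \<Longrightarrow> z = z' \<and> r = r'"
proof -
  assume "enc_int z @ r = enc_int z' @ r'"
  then have "(z < 0) = (z' < 0)" "nat \<bar>z\<bar> = nat \<bar>z'\<bar>" "r = r'"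
    unfolding enc_int_def using frame_inj bits_inj by blast+
  then show ?thesis by (auto split: if_splits)
qed

lemma enc_rat_inj: "enc_rat x @ r = enc_rat x' @ r' \<Longrightarrow> x = x' \<and> r = r'"
proof -
  assume e: "enc_rat x @ r = enc_rat x' @ r'"
  obtain a b a' b' where q: "quotient_of x = (a, b)" "quotient_of x' = (a', b')" by fastforce
  have "0 < b" "0 < b'" using q quotient_of_denom_pos by blast+
  moreover have "a = a' \<and> nat b = nat b' \<and> r = r'"
    using e q enc_int_inj[of a "enc_nat (nat b) @ r" a' "enc_nat (nat b') @ r'"] enc_nat_inj[of "nat b" r "nat b'" r']
    by (simp add: enc_rat_def)
  ultimately show ?thesis using q by (metis eq_nat_nat_iff less_imp_le quotient_of_inject)
qed

lemma enc_int_Cons: "\<exists>r. enc_int z = True # (z < 0) # r"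
  by (simp add: enc_int_def frame_simps)

lemma enc_rat_nonempty [simp]: "enc_rat x \<noteq> []"
  by (cases "quotient_of x") (simp add: enc_rat_def enc_int_def frame_simps)

lemma enc_rats_inj: "concat (map enc_rat xs) = concat (map enc_rat ys) \<Longrightarrow> xs = ys"
proof (induction xs arbitrary: ys)
  case Nil
  then show ?case by (cases ys) auto
next
  case (Cons x xs)
  show ?case
  proof (cases ys)
    case Nil
    then show ?thesis using Cons.prems by simp
  next
    case (Cons y ys')
    then show ?thesis using Cons.prems Cons.IH enc_rat_inj[of x _ y] by auto
  qed
qed

lemma vecs_inj:
  assumes "concat (map list_of_vec vs) = concat (map list_of_vec vs')" "length vs = length vs'"
    "set vs \<subseteq> carrier_vec n" "set vs' \<subseteq> carrier_vec n"
  shows "vs = vs'"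
proof -
  have "map list_of_vec vs = map list_of_vec vs'"
  proof (rule concat_injective[OF assms(1)])
    show "\<forall>(x, y) \<in> set (zip (map list_of_vec vs) (map list_of_vec vs')). length x = length y"
    proof (intro ballI, clarify)
      fix x y assume "(x, y) \<in> set (zip (map list_of_vec vs) (map list_of_vec vs'))"
      then obtain v v' where v: "x = list_of_vec v" "v \<in> set vs" "y = list_of_vec v'" "v' \<in> set vs'"
        using set_zip_leftD[of x y] set_zip_rightD[of x y] by fastforce
      then have "v \<in> carrier_vec n" "v' \<in> carrier_vec n" using assms(3,4) by blast+
      then show "length x = length y" using v by simp
    qed
  qed (simp add: assms(2))
  then have "map vec_of_list (map list_of_vec vs) = map vec_of_list (map list_of_vec vs')" by (rule arg_cong)
  then show ?thesis by (simp only: map_map comp_def vec_list map_ident)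
qed

text \<open>An oracle answer is a solution of some instance with the queried code; injectivity
  identifies this instance with the intended one.\<close>

lemma enc_mitr_inj:
  assumes "I \<in> MITR" "J \<in> MITR" "enc_mitr I = enc_mitr J"
  shows "I = J"
proof -
  let ?n = "n_of I"
  have e: "n_of I = n_of J" "p_of I = p_of J" "mitr_nums I = mitr_nums J"
    using enc_nat_inj[OF assms(3)[unfolded enc_mitr_def]] enc_nat_inj[of "p_of I" _ "p_of J"]
      enc_rats_inj[of "mitr_nums I" "mitr_nums J"] by metis+
  have I: "H_of I \<in> carrier_mat ?n ?n" "h_of I \<in> carrier_vec ?n" "c_of I \<in> carrier_vec ?n"
    "length (basis_of I) = ?n" "set (basis_of I) \<subseteq> carrier_vec ?n"
    and J: "H_of J \<in> carrier_mat ?n ?n" "h_of J \<in> carrier_vec ?n" "c_of J \<in> carrier_vec ?n"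
    "length (basis_of J) = ?n" "set (basis_of J) \<subseteq> carrier_vec ?n"
    using assms(1,2) e(1) by (auto simp: MITR_def)
  \<comment> \<open>The dimension is decoded first and fixes the number of entries of each part, so
    the flat list of numbers can be cut in only one way.\<close>
  have len: "length (concat (map list_of_vec (rows A))) = ?n * ?n" if "A \<in> carrier_mat ?n ?n" for A :: "rat mat"
    using that by (simp add: length_concat comp_def rows_def sum_list_triv)
  have parts: "concat (map list_of_vec (rows (H_of I))) = concat (map list_of_vec (rows (H_of J)))"
    "list_of_vec (h_of I) = list_of_vec (h_of J)" "list_of_vec (c_of I) = list_of_vec (c_of J)"
    "concat (map list_of_vec (basis_of I)) = concat (map list_of_vec (basis_of J))"
    using e(3) len[OF I(1)] len[OF J(1)] I(2,3) J(2,3) by (auto simp: mitr_nums_def)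
  have "rows (H_of I) = rows (H_of J)"
    using I(1) J(1) by (intro vecs_inj[OF parts(1), of ?n]) (auto simp: rows_def)
  then have "H_of I = H_of J" using I(1) J(1) by (metis carrier_matD(2) mat_of_rows_rows)
  moreover have "h_of I = h_of J" "c_of I = c_of J" using parts(2,3) by (metis vec_list)+
  moreover have "basis_of I = basis_of J" using I(4,5) J(4,5) by (intro vecs_inj[OF parts(4), of ?n]) auto
  ultimately show ?thesis using e by (intro mitr.equality) auto
qed

lemma length_enc_rats: "length xs \<le> length (concat (map enc_rat xs))"
proof (induction xs)
  case (Cons x xs)
  have "1 \<le> length (enc_rat x)" by (simp add: Suc_le_eq)
  then show ?case using Cons by simp
qed simp

text \<open>The code of a nonempty vector starts with the frame of the first numerator, whose
  leading bit is its sign. The machine can thus read the decision from the second bit of the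
  answer.\<close>

lemma enc_vec_sign:
  assumes "0 < dim_vec x"
  shows "1 < length (enc_vec x)" "enc_vec x ! 1 \<longleftrightarrow> x $ 0 < 0"
proof -
  obtain xs where xs: "list_of_vec x = x $ 0 # xs"
    using assms by (metis Cons_nth_drop_Suc drop0 length_list_of_vec list_of_vec_index)
  obtain a b where q: "quotient_of (x $ 0) = (a, b)" by fastforce
  obtain r where r: "enc_int a = True # (a < 0) # r" using enc_int_Cons by blast
  have "enc_vec x = True # (a < 0) # r @ enc_nat (nat b) @ concat (map enc_rat xs)"
    by (simp add: enc_vec_def xs enc_rat_def q r)
  moreover have "a < 0 \<longleftrightarrow> x $ 0 < 0"
    using quotient_of_denom_pos[OF q] quotient_of_div[OF q] by (simp add: divide_less_0_iff)
  ultimately show "1 < length (enc_vec x)" "enc_vec x ! 1 \<longleftrightarrow> x $ 0 < 0" by simp_all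
qed

context generator
begin

subsection \<open>Correctness of the generated code\<close>

lemma encs: "enc_syms (concat (map enc_rat xs)) = concat (map (\<lambda>x. enc_syms (enc_rat x)) xs)"
  by (simp add: enc_syms_def map_concat comp_def)

lemma enc_syms_append: "enc_syms (xs @ ys) = enc_syms xs @ enc_syms ys"
  by (simp add: enc_syms_def)

text \<open>The program writes the entries cell by cell and slot by slot; cutting the index range
  into blocks of \<open>D\<close> gives the same order as in the encoding.\<close>

lemma code_inst: "code dec w = enc_syms (enc_mitr (inst.inst w) @ (if dec then enc_rat (val (b * T w) NegHalf) else []))"
proof -
  let ?d = "dim w" and ?E = "\<lambda>xs. concat (map (\<lambda>x. enc_syms (enc_rat x)) xs)"
  have Dq: "[0..<D] = [0..<q] @ [q..<q + q]" using upt_add_eq_append[of 0 q q] by (simp add: D_def mult_2)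
  have "concat (map list_of_vec (rows (0\<^sub>m ?d ?d))) = replicate (?d * ?d) (0 :: rat)"
  proof -
    have "map list_of_vec (rows (0\<^sub>m ?d ?d)) = replicate ?d (replicate ?d (0 :: rat))"
      by (rule nth_equalityI) auto
    then show ?thesis by (simp add: concat_replicate_replicate)
  qed
  then have H: "?E (concat (map list_of_vec (rows (0\<^sub>m ?d ?d)))) = concat (replicate (?d * ?d) (encv w (Num 0)))"
    by (simp add: encv_def map_replicate)
  have "length [0..<?d] = Suc (?d - 1)" using poly_h[of w] by simp
  then have "map (\<lambda>i. if i = 0 then -1 else 0) [0..<?d] = -1 # replicate (?d - 1) (0 :: rat)"
    by (intro nth_equalityI) (auto simp: nth_Cons split: nat.splits)
  then have h: "?E (map (\<lambda>i. if i = 0 then -1 else 0) [0..<?d]) = encv w (Num (-1)) @ concat (replicate (?d - 1) (encv w (Num 0)))"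
    by (simp add: encv_def map_replicate)
  have "map (\<lambda>s. inst.Off w (p * D + s)) [0..<D] = replicate q (val (b * T w) NegHalf) @ replicate q 0" for p
  proof -
    have "map (\<lambda>s. inst.Off w (p * D + s)) [0..<q] = replicate q (val (b * T w) NegHalf)"
      by (rule nth_equalityI) (auto simp: inst.Off_def inst_eqs D_def simp del: val.simps)
    moreover have "map (\<lambda>s. inst.Off w (p * D + s)) [q..<q + q] = replicate q 0"
      by (rule nth_equalityI) (auto simp: inst.Off_def inst_eqs D_def simp del: val.simps)
    ultimately show ?thesis by (simp add: Dq del: val.simps)
  qed
  then have "map (inst.Off w) [0..<?d] = concat (replicate (T w * T w) (replicate q (val (b * T w) NegHalf) @ replicate q 0))"
    by (simp only: dim_def map_upt_blocks map_replicate_const length_upt diff_zero)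
  then have c: "?E (map (inst.Off w) [0..<?d]) =
      concat (replicate (T w * T w) (concat (replicate q (encv w NegHalf)) @ concat (replicate q (encv w (Num 0)))))"
    by (simp add: concat_map_concat encv_def map_replicate)
  have "map (inst.Bas w (p * D + s)) [0..<?d] = concat (map (\<lambda>p'. map (\<lambda>s'.
      val (b * T w) (entry N q (\<rho> w ! p) (rel (T w) p p') s s')) [0..<D]) [0..<T w * T w])" if "s < D" for p s
    unfolding dim_def map_upt_blocks
    using that by (intro arg_cong[of _ _ concat] map_cong refl) (simp add: inst.Bas_def inst_eqs)
  then have row: "?E (map (inst.Bas w (p * D + s)) [0..<?d]) = concat (map (\<lambda>p'. block w p p' s) [0..<T w * T w])"
    if "s < D" for p s
    using that by (simp add: concat_map_concat block_def encv_def comp_def)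
  have "?E (concat (map (\<lambda>i. map (inst.Bas w i) [0..<?d]) [0..<?d])) = basis_out w"
  proof -
    have "?E (concat (map (\<lambda>i. map (inst.Bas w i) [0..<?d]) [0..<?d])) =
        concat (map (\<lambda>i. ?E (map (inst.Bas w i) [0..<?d])) [0..<T w * T w * D])"
      by (simp add: concat_map_concat comp_def) (simp add: dim_def)
    also have "\<dots> = concat (map (\<lambda>p. concat (map (\<lambda>s. ?E (map (inst.Bas w (p * D + s)) [0..<?d])) [0..<D])) [0..<T w * T w])"
      unfolding map_upt_blocks by (simp add: concat_map_concat[where f = id, simplified] comp_def)
    also have "\<dots> = basis_out w"
      unfolding basis_out_def cells_def
      by (intro arg_cong[of _ _ concat] map_cong refl row) simp
    finally show ?thesis .
  qed
  moreover have "mitr_nums (inst.inst w) = concat (map list_of_vec (rows (0\<^sub>m ?d ?d))) @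
      map (\<lambda>i. if i = 0 then -1 else 0) [0..<?d] @ map (inst.Off w) [0..<?d] @
      concat (map (\<lambda>i. map (inst.Bas w i) [0..<?d]) [0..<?d])"
    by (simp add: mitr_nums_def inst_eqs comp_def)
  ultimately have "enc_syms (concat (map enc_rat (mitr_nums (inst.inst w)))) =
      concat (replicate (?d * ?d) (encv w (Num 0))) @ (encv w (Num (-1)) @ concat (replicate (?d - 1) (encv w (Num 0)))) @
      concat (replicate (T w * T w) (concat (replicate q (encv w NegHalf)) @ concat (replicate q (encv w (Num 0))))) @
      basis_out w"
    unfolding encs by (simp only: map_append concat_append H h c)
  moreover have "enc_syms [] = []" by (simp add: enc_syms_def)
  ultimately show ?thesis
    by (simp add: code_def head_out_def enc_mitr_def inst_eqs enc_syms_append encv_def del: val.simps)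
qed

subsection \<open>The machines\<close>

definition prog :: "bool \<Rightarrow> nat \<Rightarrow> com" where
  "prog dec out = Seq load (Seq prep_prog (gen_prog dec out))"

lemma pex_prog:
  assumes "out < 2"
  shows "pex length UNIV (prog dec out) init_store
    (\<lambda>w. (bstore (w, T w * T w) 0)(out := tp (code dec w) (int (length (code dec w)))))"
  unfolding prog_def by (rule pex_Seq[OF load pex_Seq[OF pex_prep gen_prog[OF assms]]])

lemma wf_marks: "n \<le> m \<Longrightarrow> wf_com (7 + m) 9 (marks n) \<and> wf_com (7 + m) 9 (rewinds n)"
  by (induction n) auto

lemma wf_num: "out < 2 \<Longrightarrow> wf_com (7 + m) 9 (emit_num e out v)"
  by (intro wf_emit_num) auto

text \<open>The alphabet has 9 symbols: the blank and the row symbols 1 to 8.\<close>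

lemma wf_prog: "out < 2 \<Longrightarrow> wf_com (7 + m) 9 (prog dec out)"
proof -
  assume out: "out < 2"
  have e: "wf_com (7 + m) 9 (emit x ss)" if "x < 7" "set ss \<subseteq> {..<9}" for x ss
    using that by (intro wf_emit) auto
  have "wf_com (7 + m) 9 load"
    using wf_marks[of m] by (auto simp: load_def intro!: wf_switch)
  moreover have "wf_com (7 + m) 9 prep_prog"
    by (auto simp: prep_prog_def row_prog_def Z_prog_def in_polys intro!: wf_fp e wf_switch)
  moreover have "wf_com (7 + m) 9 (vec_prog out a s)" for a s
    using wf_num[OF out] by (auto simp: vec_prog_def cell_prog_def in_polys intro!: wf_fp wf_switch wf_seqs)
  then have "wf_com (7 + m) 9 (basis_prog out)"
    by (auto simp: basis_prog_def intro!: wf_switch wf_seqs)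
  moreover have "wf_com (7 + m) 9 (head_prog out)"
    using out wf_num[OF out]
    by (auto simp: head_prog_def Let_def dim_prog_def in_polys intro!: wf_fp wf_repeat e wf_emit_frame split: if_splits)
  ultimately show ?thesis using wf_num[OF out] by (auto simp: prog_def gen_prog_def)
qed

lemma prog_neq_Skip: "prog dec out \<noteq> Skip"
  by (simp add: prog_def)

lemma polytime_code: "polytime (\<lambda>w. enc_mitr (inst.inst w) @ (if dec then enc_rat (val (b * T w) NegHalf) else []))"
proof -
  have wf1: "wf_com (7 + m) 9 (prog dec 0)" by (rule wf_prog) simp
  \<comment> \<open>A dummy second phase: the compiled machine has a part behind the query state,
    which without an oracle is passed idly.\<close>
  have wf2: "wf_com (7 + m) 9 (Mv 0 0)" by simp
  obtain P where P: "\<And>w. \<exists>t \<le> poly P (length w). big (prog dec 0) (init_store w) t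
      ((bstore (w, T w * T w) 0)(0 := tp (code dec w) (int (length (code dec w)))))"
    using pex_prog[of 0 dec] unfolding pex_def by auto
  show ?thesis
  proof (rule program_tm[OF wf1 wf2 _ _ prog_neq_Skip])
    fix M assume M: "wf_tm M" "\<And>orc w t1 \<sigma>1 t2 \<sigma>2. big (prog dec 0) (init_store w) t1 \<sigma>1 \<Longrightarrow>
       big (Mv 0 0) (case orc of None \<Rightarrow> \<sigma>1 | Some F \<Rightarrow> \<sigma>1(1 := tape_of (F (tape_string (\<sigma>1 1))))) t2 \<sigma>2 \<Longrightarrow>
       outputs_within orc M w (t1 + 1 + t2) (tape_string (\<sigma>2 0))"
    have "outputs_within None M w (poly (P + 2) (length w))
      (enc_mitr (inst.inst w) @ (if dec then enc_rat (val (b * T w) NegHalf) else []))" for w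
    proof -
      obtain t where t: "t \<le> poly P (length w)" "big (prog dec 0) (init_store w) t
          ((bstore (w, T w * T w) 0)(0 := tp (code dec w) (int (length (code dec w)))))" using P by blast
      have "outputs_within None M w (t + 1 + Suc 0) (tape_string (tp (code dec w) (int (length (code dec w)) + 0)))"
        using M(2)[OF t(2), of None] big_Mv[of 0 0 "(bstore (w, T w * T w) 0)(0 := tp (code dec w) (int (length (code dec w))))"]
        by fastforce
      then have "outputs_within None M w (t + 1 + Suc 0)
          (enc_mitr (inst.inst w) @ (if dec then enc_rat (val (b * T w) NegHalf) else []))"
        unfolding code_inst enc_syms_def tape_string_tp .
      moreover have "t + 1 + Suc 0 \<le> poly (P + 2) (length w)" using t(1) by simp
      ultimately show ?thesis unfolding outputs_within_def by (meson order_trans)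
    qed
    then show ?thesis using M(1) unfolding polytime_def by blast
  qed auto
qed

text \<open>A negative first coordinate means that there is no tiling, so the machine outputs the
  negation of the sign bit in the answer.\<close>

lemma search_machine:
  obtains M and P :: "nat poly" where "wf_tm M"
    "\<And>F w. 1 < length (F (enc_mitr (inst.inst w))) \<Longrightarrow>
      outputs_within (Some F) M w (poly P (length w)) [\<not> F (enc_mitr (inst.inst w)) ! 1]"
proof -
  \<comment> \<open>Tape 0 was left blank with its head at 0, so the single symbol written is the
    whole output.\<close>
  define c2 where "c2 = Seq (Mv 1 1) (Cond 1 (\<lambda>s. s = 2) (Wr 0 1 0) (Wr 0 2 0))"
  have wf1: "wf_com (7 + m) 9 (prog False 1)" by (rule wf_prog) simp
  have wf2: "wf_com (7 + m) 9 c2" by (simp add: c2_def)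
  let ?\<sigma> = "\<lambda>w. (bstore (w, T w * T w) 0)(1 := tp (code False w) (int (length (code False w))))"
  obtain P where P: "\<And>w. \<exists>t \<le> poly P (length w). big (prog False 1) (init_store w) t (?\<sigma> w)"
    using pex_prog[of 1 False] unfolding pex_def by auto
  show ?thesis
  proof (rule program_tm[OF wf1 wf2 _ _ prog_neq_Skip])
    show "c2 \<noteq> Skip" by (simp add: c2_def)
    fix M assume M: "wf_tm M" "\<And>orc w t1 \<sigma>1 t2 \<sigma>2. big (prog False 1) (init_store w) t1 \<sigma>1 \<Longrightarrow>
       big c2 (case orc of None \<Rightarrow> \<sigma>1 | Some F \<Rightarrow> \<sigma>1(1 := tape_of (F (tape_string (\<sigma>1 1))))) t2 \<sigma>2 \<Longrightarrow>
       outputs_within orc M w (t1 + 1 + t2) (tape_string (\<sigma>2 0))"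
    have "outputs_within (Some F) M w (poly (P + 10) (length w)) [\<not> F (enc_mitr (inst.inst w)) ! 1]"
      if len: "1 < length (F (enc_mitr (inst.inst w)))" for F w
    proof -
      let ?y = "F (enc_mitr (inst.inst w))"
      obtain t where t: "t \<le> poly P (length w)" "big (prog False 1) (init_store w) t (?\<sigma> w)" using P by blast
      have str: "tape_string (?\<sigma> w 1) = enc_mitr (inst.inst w)"
        by (simp add: code_inst enc_syms_def)
      define \<sigma>1 where "\<sigma>1 = (?\<sigma> w)(1 := tape_of ?y)"
      have \<sigma>1: "\<sigma>1 0 = tp [] 0" "\<sigma>1 1 = tp (map bsym ?y) 0"
        by (simp_all add: \<sigma>1_def bstore_def stage4_simps tape_of_tp)
      define \<sigma>2 where "\<sigma>2 = \<sigma>1(1 := tp (map bsym ?y) 1)"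
      have m: "big (Mv 1 1) \<sigma>1 (Suc 0) \<sigma>2" using big_Mv[of 1 1 \<sigma>1] unfolding \<sigma>1(2) \<sigma>2_def by simp
      have sc: "scan (\<sigma>2 1) = bsym (?y ! 1)" using scan_tp[of "map bsym ?y" 1] len by (simp add: \<sigma>2_def)
      have wr: "big (Wr 0 s 0) \<sigma>2 (Suc 0) (\<sigma>2(0 := tp [s] 0))" for s
        using big_Wr[of 0 s 0 \<sigma>2] act_tp_end[of s 0 "[]"] by (simp add: \<sigma>2_def \<sigma>1)
      have "\<exists>t' \<le> 4. big c2 \<sigma>1 t' (\<sigma>2(0 := tp [bsym (\<not> ?y ! 1)] 0))"
      proof (cases "?y ! 1")
        case True
        then show ?thesis unfolding c2_def using big_Seq[OF m big_CondT[OF _ wr]] sc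
          by (intro exI[of _ "Suc (Suc 0 + Suc (Suc 0))"]) auto
      next
        case False
        then show ?thesis unfolding c2_def using big_Seq[OF m big_CondF[OF _ wr]] sc
          by (intro exI[of _ "Suc (Suc 0 + Suc (Suc 0))"]) auto
      qed
      then obtain t' where t': "t' \<le> 4" "big c2 \<sigma>1 t' (\<sigma>2(0 := tp [bsym (\<not> ?y ! 1)] 0))" by blast
      have "(case Some F of None \<Rightarrow> ?\<sigma> w | Some F \<Rightarrow> (?\<sigma> w)(1 := tape_of (F (tape_string (?\<sigma> w 1))))) = \<sigma>1"
        unfolding option.case str \<sigma>1_def ..
      then have "outputs_within (Some F) M w (t + 1 + t') (tape_string ((\<sigma>2(0 := tp [bsym (\<not> ?y ! 1)] 0)) 0))"
        using M(2)[OF t(2)] t'(2) by metis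
      moreover have "tape_string (tp [bsym (\<not> ?y ! 1)] 0) = [\<not> ?y ! 1]"
        using tape_string_tp[of "[\<not> ?y ! 1]" 0] by simp
      moreover have "t + 1 + t' \<le> poly (P + 10) (length w)" using t(1) t'(1) by simp
      ultimately show ?thesis unfolding outputs_within_def by (metis (no_types, lifting) fun_upd_same order_trans)
    qed
    then show ?thesis using that M(1) by blast
  qed auto
qed

end

subsection \<open>Hardness\<close>

lemma rat_magnitude_val: "0 < k \<Longrightarrow> rat_magnitude (val k (Num z)) = max (nat \<bar>z\<bar>) 1"
  "0 < k \<Longrightarrow> rat_magnitude (val k InvK) = k" "0 < k \<Longrightarrow> rat_magnitude (val k NegHalf) = 2 * k"
  using quotient_of_inverse(1)[of k] quotient_of_inverse(2)[of "2 * k"]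
  by (auto simp: rat_magnitude_def simp del: of_nat_mult)

lemma modulus_ge:
  "i < count N \<Longrightarrow> wn N i \<le> modulus N \<and> en N i \<le> modulus N \<and> sn N i \<le> modulus N \<and> nn N i \<le> modulus N"
  "a \<le> 8 \<Longrightarrow> ws N a \<le> modulus N \<and> so N a \<le> modulus N"
proof -
  assume "i < count N"
  then have "wn N i + en N i + sn N i + nn N i \<le> (\<Sum>i<count N. wn N i + en N i + sn N i + nn N i)"
    by (intro member_le_sum[of i "{..<count N}"]) auto
  then show "wn N i \<le> modulus N \<and> en N i \<le> modulus N \<and> sn N i \<le> modulus N \<and> nn N i \<le> modulus N"
    unfolding modulus_def by linarith
next
  assume "a \<le> 8"
  then have "ws N a + so N a \<le> (\<Sum>a\<le>8. ws N a + so N a)"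
    by (intro member_le_sum[of a "{..8}"]) auto
  then show "ws N a \<le> modulus N \<and> so N a \<le> modulus N" unfolding modulus_def by linarith
qed

text \<open>Integer entries are at most \<open>modulus N\<close>, hence at most \<open>T\<close>,
  and denominators at most \<open>2 * k\<close>. Both are bounded by the dimension, and the encoding
  lists at least that many numbers of at least one bit each.\<close>

lemma (in lattice) nums_bounded:
  assumes "modulus N \<le> T" "r \<in> set (mitr_nums inst) \<union> {val k NegHalf}"
  shows "rat_magnitude r \<le> length (enc_mitr inst)"
proof -
  have T_dim: "T \<le> dim" "2 * k \<le> dim"
  proof -
    have "k = b * T" "dim = T * T * (2 * (4 * b * b))" by (simp_all add: k_def dim_def D_def q_def)
    then have d: "dim = 2 * k * (4 * b * T)" by (simp add: mult.commute mult.left_commute)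
    moreover have "1 \<le> 4 * b * T" using b T by (simp add: Suc_le_eq)
    ultimately show "2 * k \<le> dim" by (metis mult_le_mono2 mult_1_right)
    moreover have "T \<le> 2 * k" using b by (simp add: k_def)
    ultimately show "T \<le> dim" by simp
  qed
  have m1: "1 \<le> modulus N" by (simp add: modulus_def)
  have entry: "rat_magnitude (val k (entry N q a z s s')) \<le> dim" if "a \<le> 8" for a z s s'
  proof -
    have "\<exists>y. entry N q a z s s' = Num y \<and> nat \<bar>y\<bar> \<le> modulus N \<or> entry N q a z s s' = InvK"
      using modulus_ge(1)[of "s - 1" N] modulus_ge(2)[OF that, of N] m1
      by (auto simp: entry_def)
    then show ?thesis using assms(1) m1 T_dim k_pos rat_magnitude_val[of k] by fastforce
  qed
  have "rat_magnitude r \<le> dim"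
  proof -
    have int_mag: "rat_magnitude 0 \<le> dim" "rat_magnitude (-1) \<le> dim"
      using rat_magnitude_val(1)[OF k_pos, of 0] rat_magnitude_val(1)[OF k_pos, of "-1"] dim_pos by simp_all
    have neg: "rat_magnitude (val k NegHalf) \<le> dim" using rat_magnitude_val(3)[OF k_pos] T_dim by simp
    from assms(2) consider "r = 0" | "r = -1" | "r = val k NegHalf" | i j where "i < dim" "r = Bas i j"
      by (auto simp: mitr_nums_def Off_def rows_def split: if_splits)
    then show ?thesis
    proof cases
      case 4
      have "i div D < T * T" using 4(1) D_pos by (simp add: dim_def less_mult_imp_div_less)
      then show ?thesis unfolding 4(2) Bas_def by (intro entry rho)
    qed (use int_mag neg in auto)
  qed
  also have "dim \<le> length (mitr_nums inst)" by (simp add: mitr_nums_def)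
  also have "\<dots> \<le> length (enc_mitr inst)" using length_enc_rats[of "mitr_nums inst"] by (simp add: enc_mitr_def)
  finally show ?thesis .
qed

lemma NP_generator:
  assumes "in_NP L"
  obtains N g \<tau> e where "generator N \<tau> e"
    "\<And>w. w \<in> L \<longleftrightarrow> (\<exists>\<theta>. ntiling N (generator.T g \<tau> w) (generator.\<rho> g \<tau> w) \<theta>)"
proof -
  show ?thesis
  proof (rule NP_tiling[OF assms])
    fix N g \<tau>0
    assume N: "\<And>i. i < count N \<Longrightarrow> 1 \<le> wn N i \<and> 1 \<le> en N i"
      and L: "\<And>\<tau> w. poly \<tau>0 (length w) \<le> \<tau> \<Longrightarrow> w \<in> L \<longleftrightarrow>
         (\<exists>\<theta>. ntiling N (width \<tau> (poly g (length w)) (length w)) (row_syms \<tau> (poly g (length w)) w) \<theta>)"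
    \<comment> \<open>Enlarging \<open>\<tau>0\<close> keeps the tiling correct and lifts the grid
      above the modulus; \<open>e = count N\<close> suffices since \<open>e < 2 ^ e\<close>.\<close>
    define \<tau> where "\<tau> = \<tau>0 + [:modulus N:]"
    define e where "e = count N"
    interpret generator N g \<tau> e
    proof
      have "count N < 2 ^ e" by (simp add: e_def)
      also have "\<dots> \<le> 4 * 2 ^ e * 2 ^ e" by simp
      finally show "count N < 4 * 2 ^ e * 2 ^ e" .
      show "modulus N \<le> poly \<tau> l" for l by (simp add: \<tau>_def)
    qed (rule N)
    show ?thesis
    proof (rule that[OF generator_axioms])
      fix w :: "bool list"
      have "poly \<tau>0 (length w) \<le> poly \<tau> (length w)" by (simp add: \<tau>_def)
      from L[OF this] show "w \<in> L \<longleftrightarrow> (\<exists>\<theta>. ntiling N (T w) (\<rho> w) \<theta>)" unfolding T_width \<rho>_def .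
    qed
  qed
qed

lemma hard_decision: "strongly_NP_hard_MITR MITR_pure_feasible"
  unfolding strongly_NP_hard_MITR_def strongly_NP_hard_def NP_hard_def
\<comment> \<open>The identity polynomial: no number of the instance exceeds the length of its
  code.\<close>
proof (intro exI[of _ "[:0, 1:]"] allI impI)
  fix L assume NP: "in_NP L"
  obtain N g \<tau> e where g: "generator N \<tau> e"
    and L: "\<And>w. w \<in> L \<longleftrightarrow> (\<exists>\<theta>. ntiling N (generator.T g \<tau> w) (generator.\<rho> g \<tau> w) \<theta>)"
    by (rule NP_generator[OF NP]) (rule that)
  interpret generator N g \<tau> e by fact
  let ?\<gamma> = "\<lambda>w. val (b * T w) NegHalf"
  let ?f = "\<lambda>w. enc_mitr (inst.inst w) @ enc_rat (?\<gamma> w)"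
  have "modulus N \<le> T w" for w
    using tau[of "length w"] by (simp add: T_width width_def)
  then have small: "rat_magnitude r \<le> length (enc_mitr (inst.inst w)) + length (enc_rat (?\<gamma> w))"
    if "r \<in> set (mitr_nums (inst.inst w) @ [?\<gamma> w])" for r w
    using inst.nums_bounded[of w r] that by (intro trans_le_add1) (auto simp: inst_eqs simp del: val.simps)
  show "\<exists>f. polytime f \<and> (\<forall>w. \<exists>I\<in>{I \<in> MITR_pure_feasible \<times> UNIV. \<forall>r\<in>set (case I of (I, \<gamma>) \<Rightarrow> mitr_nums I @ [\<gamma>]).
      rat_magnitude r \<le> poly [:0, 1:] (length (case I of (I, \<gamma>) \<Rightarrow> enc_mitr I @ enc_rat \<gamma>))}.
      f w = (case I of (I, \<gamma>) \<Rightarrow> enc_mitr I @ enc_rat \<gamma>) \<and>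
      (w \<in> L \<longleftrightarrow> (case I of (I, \<gamma>) \<Rightarrow> \<exists>x\<in>mitr_feasible I. mitr_objective I x \<le> real_of_rat \<gamma>)))"
  proof (intro exI[of _ ?f] conjI allI)
    show "polytime ?f" using polytime_code[of True] by (simp del: val.simps)
    fix w
    show "\<exists>I\<in>{I \<in> MITR_pure_feasible \<times> UNIV. \<forall>r\<in>set (case I of (I, \<gamma>) \<Rightarrow> mitr_nums I @ [\<gamma>]).
      rat_magnitude r \<le> poly [:0, 1:] (length (case I of (I, \<gamma>) \<Rightarrow> enc_mitr I @ enc_rat \<gamma>))}.
      ?f w = (case I of (I, \<gamma>) \<Rightarrow> enc_mitr I @ enc_rat \<gamma>) \<and>
      (w \<in> L \<longleftrightarrow> (case I of (I, \<gamma>) \<Rightarrow> \<exists>x\<in>mitr_feasible I. mitr_objective I x \<le> real_of_rat \<gamma>))"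
    proof (intro bexI[of _ "(inst.inst w, ?\<gamma> w)"] conjI)
      show "w \<in> L \<longleftrightarrow> (case (inst.inst w, ?\<gamma> w) of (I, \<gamma>) \<Rightarrow> \<exists>x\<in>mitr_feasible I. mitr_objective I x \<le> real_of_rat \<gamma>)"
        using inst.low_value_iff[of w] L[of w] by (simp add: inst_eqs del: val.simps)
      show "(inst.inst w, ?\<gamma> w) \<in> {I \<in> MITR_pure_feasible \<times> UNIV. \<forall>r\<in>set (case I of (I, \<gamma>) \<Rightarrow> mitr_nums I @ [\<gamma>]).
        rat_magnitude r \<le> poly [:0, 1:] (length (case I of (I, \<gamma>) \<Rightarrow> enc_mitr I @ enc_rat \<gamma>))}"
        using inst.inst_pure[of w] small[of _ w] by (simp del: val.simps)
    qed simp
  qed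
qed

lemma NP_hard_mono:
  assumes "NP_hard enc D Q" "D \<subseteq> D'"
  shows "NP_hard enc D' Q"
  unfolding NP_hard_def
proof (intro allI impI)
  fix L assume "in_NP L"
  then obtain f where "polytime f" "\<And>w. \<exists>I\<in>D. f w = enc I \<and> (w \<in> L \<longleftrightarrow> Q I)"
    using assms(1) unfolding NP_hard_def by blast
  then show "\<exists>f. polytime f \<and> (\<forall>w. \<exists>I\<in>D'. f w = enc I \<and> (w \<in> L \<longleftrightarrow> Q I))"
    using assms(2) by (meson subsetD)
qed

lemma strongly_NP_hard_mono:
  assumes "strongly_NP_hard_MITR D" "D \<subseteq> D'"
  shows "strongly_NP_hard_MITR D'"
proof -
  obtain P where P: "NP_hard (\<lambda>(I, \<gamma>). enc_mitr I @ enc_rat \<gamma>) {I \<in> D \<times> UNIV. \<forall>r\<in>set (case I of (I, \<gamma>) \<Rightarrow> mitr_nums I @ [\<gamma>]).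
      rat_magnitude r \<le> poly P (length (case I of (I, \<gamma>) \<Rightarrow> enc_mitr I @ enc_rat \<gamma>))}
      (\<lambda>(I, \<gamma>). \<exists>x\<in>mitr_feasible I. mitr_objective I x \<le> real_of_rat \<gamma>)"
    using assms(1) unfolding strongly_NP_hard_MITR_def strongly_NP_hard_def by blast
  show ?thesis unfolding strongly_NP_hard_MITR_def strongly_NP_hard_def
    by (rule exI[of _ P], rule NP_hard_mono[OF P]) (use assms(2) in auto)
qed

text \<open>For any \<open>D\<close> between the pure feasible instances and all instances the same
  machine works: its queries lie in \<open>D\<close>, and codes are injective on
  \<open>D\<close>.\<close>

lemma hard_search:
  assumes D: "MITR_pure_feasible \<subseteq> D" "D \<subseteq> MITR" and e: "0 \<le> \<epsilon>" "\<epsilon> < 1"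
  shows "NP_hard_search (mitr_approx_search D \<epsilon>)"
  unfolding NP_hard_search_def
proof (intro allI impI)
  fix L assume NP: "in_NP L"
  obtain N g \<tau> e where g: "generator N \<tau> e"
    and L: "\<And>w. w \<in> L \<longleftrightarrow> (\<exists>\<theta>. ntiling N (generator.T g \<tau> w) (generator.\<rho> g \<tau> w) \<theta>)"
    by (rule NP_generator[OF NP]) (rule that)
  interpret generator N g \<tau> e by fact
  obtain M and P :: "nat poly" where M: "wf_tm M"
    "\<And>F w. 1 < length (F (enc_mitr (inst.inst w))) \<Longrightarrow>
      outputs_within (Some F) M w (poly P (length w)) [\<not> F (enc_mitr (inst.inst w)) ! 1]"
    by (rule search_machine) (rule that)
  show "\<exists>M (P :: nat poly). wf_tm M \<and> (\<forall>F. solves F (mitr_approx_search D \<epsilon>) \<longrightarrow>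
      (\<forall>w. outputs_within (Some F) M w (poly P (length w)) [w \<in> L]))"
  proof (intro exI conjI allI impI)
    show "wf_tm M" by (rule M(1))
    fix F w assume F: "solves F (mitr_approx_search D \<epsilon>)"
    let ?I = "inst.inst w"
    have "?I \<in> D" using inst.inst_pure D(1) by blast
    obtain x where "approx_solution (mitr_objective ?I) (mitr_feasible ?I) \<epsilon> (real_vec x)"
      using inst.approx_exists[OF \<open>0 \<le> \<epsilon>\<close>] by blast
    then have "mitr_approx_search D \<epsilon> (enc_mitr ?I) (enc_vec x)"
      unfolding mitr_approx_search_def using \<open>?I \<in> D\<close> by blast
    then have "mitr_approx_search D \<epsilon> (enc_mitr ?I) (F (enc_mitr ?I))"
      using F unfolding solves_def by blast
    then obtain J y where J: "J \<in> D" "enc_mitr ?I = enc_mitr J" "F (enc_mitr ?I) = enc_vec y"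
      "approx_solution (mitr_objective J) (mitr_feasible J) \<epsilon> (real_vec y)"
      unfolding mitr_approx_search_def by blast
    have "J = ?I" using enc_mitr_inj[of ?I J] J(1,2) \<open>?I \<in> D\<close> D(2) by blast
    then have y: "approx_solution (mitr_objective ?I) (mitr_feasible ?I) \<epsilon> (real_vec y)" using J(4) by simp
    note sign = inst.approx_sign[OF \<open>\<epsilon> < 1\<close> y]
    have "0 < dim_vec y" using sign(1) inst.dim_pos[of w] by simp
    note ev = enc_vec_sign[OF this]
    have "[\<not> F (enc_mitr ?I) ! 1] = [w \<in> L]" using ev(2) sign(2) L[of w] J(3) by simp
    then show "outputs_within (Some F) M w (poly P (length w)) [w \<in> L]"
      using M(2)[of F w] ev(1) J(3) by simp
  qed
qed

theorem theorem3:
  "strongly_NP_hard_MITR MITR \<and>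
   (\<forall>\<epsilon>::real. 0 \<le> \<epsilon> \<and> \<epsilon> < 1 / 17 \<longrightarrow> NP_hard_search (mitr_approx_search MITR \<epsilon>)) \<and>
   strongly_NP_hard_MITR MITR_pure_feasible \<and>
   (\<forall>\<epsilon>::real. 0 \<le> \<epsilon> \<and> \<epsilon> < 1 / 17 \<longrightarrow>
      NP_hard_search (mitr_approx_search MITR_pure_feasible \<epsilon>))"
proof -
  have sub: "MITR_pure_feasible \<subseteq> MITR" by (auto simp: MITR_pure_feasible_def)
  show ?thesis
    using hard_decision strongly_NP_hard_mono[OF hard_decision sub] hard_search[OF sub order_refl]
      hard_search[OF order_refl sub]
    by auto
qed

end
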